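(* Let $d\ge 5$ be an integer, let $q=\frac{d+2}{d-2}$ and $2^*=\frac{2d}{d-2}$. There exists a positive constant $\mathcal C$ such that, for any $w\in\mathcal D^{1,2}(\mathbb R^d)$, $$\mathsf S_d\,\|w^q\|_{L^{\frac{2d}{d+2}}(\mathbb R^d)}^2-\int_{\mathbb R^d}w^q\,(-\Delta)^{-1}w^q\,dx\le\mathcal C\,\|w\|_{L^{2^*}(\mathbb R^d)}^{\frac 8{d-2}}\left[\mathsf S_d\,\|\nabla w\|_{L^2(\mathbb R^d)}^2-\|w\|_{L^{2^*}(\mathbb R^d)}^2\right].$$ Moreover, the constant can be taken such that $\mathcal C\le\left(1+\frac 2d\right)\left(1-e^{-d/2}\right)\mathsf S_d$.
   Context: Functions are real-valued, and $w^q$ is understood as $|w|^q$. The space $\mathcal D^{1,2}(\mathbb R^d)$ is the completion of the smooth compactly supported functions on $\mathbb R^d$ with respect to the norm $\|w\|:=\left(\|\nabla w\|_{L^2(\mathbb R^d)}^2+\|w\|_{L^{2^*}(\mathbb R^d)}^2\right)^{1/2}$. The number $\mathsf S_d$ is the best (Aubin-Talenti) constant in Sobolev's inequality $\|u\|_{L^{2^*}(\mathbb R^d)}^2\le\mathsf S_d\,\|\nabla u\|_{L^2(\mathbb R^d)}^2$ for all $u\in\mathcal D^{1,2}(\mathbb R^d)$. The operator $(-\Delta)^{-1}$ is defined by $(-\Delta)^{-1}v=G_d*v$ with $G_d(x)=\frac 1{d-2}\,|\mathbb S^{d-1}|^{-1}\,|x|^{2-d}$. *)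

theory Defs
  imports "HOL-Analysis.Analysis"
begin

text \<open>
  The space \<open>R^d\<close> is modelled by a type of class \<open>euclidean_space\<close> with \<open>d = DIM('a)\<close>.
  Elements of function spaces are functions rather than classes modulo equality almost
  everywhere; membership in \<open>L\<^sup>p\<close> and \<open>D\<^sup>1\<^sup>,\<^sup>2\<close>, norms and integrals do not see null sets.
\<close>

definition Lp_space :: "real \<Rightarrow> ('a::euclidean_space \<Rightarrow> 'b::euclidean_space) set" where
  "Lp_space p = {f. f \<in> borel_measurable lebesgue \<and>
                    integrable lebesgue (\<lambda>x. norm (f x) powr p)}"

definition Lp_norm :: "real \<Rightarrow> ('a::euclidean_space \<Rightarrow> 'b::euclidean_space) \<Rightarrow> real" where
  "Lp_norm p f = (\<integral>x. norm (f x) powr p \<partial>lebesgue) powr (1 / p)"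

fun C_k :: "nat \<Rightarrow> ('a::euclidean_space \<Rightarrow> real) \<Rightarrow> bool" where
  "C_k 0 f \<longleftrightarrow> continuous_on UNIV f"
| "C_k (Suc k) f \<longleftrightarrow> (\<forall>x. f differentiable (at x)) \<and>
     (\<forall>v. C_k k (\<lambda>x. frechet_derivative f (at x) v))"

definition test_function :: "('a::euclidean_space \<Rightarrow> real) \<Rightarrow> bool" where
  "test_function \<phi> \<longleftrightarrow> (\<forall>k. C_k k \<phi>) \<and> compact (closure {x. \<phi> x \<noteq> 0})"

definition gradient :: "('a::euclidean_space \<Rightarrow> real) \<Rightarrow> 'a \<Rightarrow> 'a" where
  "gradient \<phi> x = (\<Sum>b\<in>Basis. frechet_derivative \<phi> (at x) b *\<^sub>R b)"

definition sobolev_exponent :: "'a::euclidean_space itself \<Rightarrow> real" where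
  "sobolev_exponent _ = 2 * real DIM('a) / (real DIM('a) - 2)"

text \<open>
  The completion of the test functions for
  \<open>(\<parallel>\<nabla>\<phi>\<parallel>\<^sub>2\<^sup>2 + \<parallel>\<phi>\<parallel>\<^sub>p\<^sup>2)\<^sup>1\<^sup>/\<^sup>2\<close>, \<open>p\<close> the Sobolev exponent, is realised as the closure of
  the pairs \<open>(\<phi>, \<nabla>\<phi>)\<close> in \<open>L\<^sup>p \<times> L\<^sup>2\<close>. In a pair \<open>(w, g)\<close> of the closure, \<open>g\<close> is the distributional
  gradient of \<open>w\<close> and hence determined by \<open>w\<close> almost everywhere. The choice operator in
  \<open>D12_gradient\<close> therefore only picks a representative of \<open>\<nabla>w\<close>.
\<close>
definition has_D12_gradient :: "('a::euclidean_space \<Rightarrow> real) \<Rightarrow> ('a \<Rightarrow> 'a) \<Rightarrow> bool" where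
  "has_D12_gradient w g \<longleftrightarrow>
     w \<in> Lp_space (sobolev_exponent TYPE('a)) \<and> g \<in> Lp_space 2 \<and>
     (\<exists>\<phi>. (\<forall>n. test_function (\<phi> n)) \<and>
          (\<lambda>n. Lp_norm (sobolev_exponent TYPE('a)) (\<lambda>x. \<phi> n x - w x)) \<longlonglongrightarrow> 0 \<and>
          (\<lambda>n. Lp_norm 2 (\<lambda>x. gradient (\<phi> n) x - g x)) \<longlonglongrightarrow> 0)"

definition D12 :: "('a::euclidean_space \<Rightarrow> real) set" where
  "D12 = {w. \<exists>g. has_D12_gradient w g}"

definition D12_gradient :: "('a::euclidean_space \<Rightarrow> real) \<Rightarrow> 'a \<Rightarrow> 'a" where
  "D12_gradient w = (SOME g. has_D12_gradient w g)"

definition sobolev_constant :: "'a::euclidean_space itself \<Rightarrow> real" where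
  "sobolev_constant _ =
     Inf {S. \<forall>u\<in>(D12 :: ('a \<Rightarrow> real) set).
               (Lp_norm (sobolev_exponent TYPE('a)) u)\<^sup>2 \<le> S * (Lp_norm 2 (D12_gradient u))\<^sup>2}"

text \<open>
  Surface measure on the unit sphere, normalised by polar coordinates, gives a set \<open>E\<close> of
  directions \<open>d\<close> times the Lebesgue measure of the cone \<open>{r x | 0 < r < 1, x \<in> E}\<close>; for the
  whole sphere this cone is the unit ball without its centre.
\<close>
definition sphere_area :: "'a::euclidean_space itself \<Rightarrow> real" where
  "sphere_area _ = real DIM('a) * measure lebesgue (ball (0::'a) 1)"

lemma sphere_area_eq:
  "sphere_area TYPE('a::euclidean_space) =
     2 * pi powr (real DIM('a) / 2) / Gamma (real DIM('a) / 2)"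
proof -
  have d: "real DIM('a) > 0" by simp
  have *: "Gamma (real DIM('a) / 2 + 1) = real DIM('a) / 2 * Gamma (real DIM('a) / 2)"
    using d by (intro Gamma_plus1) (auto dest: nonpos_Ints_nonpos)
  have "sphere_area TYPE('a) =
      real DIM('a) * (pi powr (real DIM('a) / 2) / Gamma (real DIM('a) / 2 + 1))"
    by (simp add: sphere_area_def content_ball unit_ball_vol_def)
  then show ?thesis unfolding * by simp
qed

definition newton_kernel :: "'a::euclidean_space \<Rightarrow> real" where
  "newton_kernel x = 1 / (real DIM('a) - 2) * inverse (sphere_area TYPE('a)) *
                     norm x powr (2 - real DIM('a))"

definition inv_neg_laplacian :: "('a::euclidean_space \<Rightarrow> real) \<Rightarrow> 'a \<Rightarrow> real" where
  "inv_neg_laplacian v x = (\<integral>y. newton_kernel (x - y) * v y \<partial>lebesgue)"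

end

theory Submission
  imports Defs
begin

text \<open>
  The constant \<open>C = S\<close> works, where \<open>S\<close> is the Sobolev constant, because the inequality is the
  expansion of a square.  Write \<open>f = |w|\<^sup>q\<close>.  For every \<open>a > 0\<close>, expanding
  \<open>\<integral> |a \<nabla>|w| - \<nabla>(-\<Delta>)\<^sup>-\<^sup>1f|\<^sup>2 \<ge> 0\<close> and integrating by parts gives
  \<open>2 a \<integral> f |w| \<le> a\<^sup>2 \<integral> |\<nabla>w|\<^sup>2 + \<integral> f (-\<Delta>)\<^sup>-\<^sup>1f\<close>.  Here \<open>\<integral> f |w| = \<integral> |w|\<^sup>2\<^sup>* = N\<close>, and the
  choice \<open>a = S N\<^bsup>2/d\<^esup>\<close>, that is \<open>S\<close> times the power \<open>4/(d-2)\<close> of the critical norm of \<open>w\<close>, turns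
  this into the claim with \<open>C = S\<close>.  Finally \<open>S \<le> (1 + 2/d) (1 - exp (-d/2)) S\<close> is
  \<open>exp (d/2) \<ge> 1 + d/2\<close>.

  The duality inequality is \<open>sobolev_duality_critical\<close>.  To integrate by parts without boundary terms
  at the singularity, the Newton kernel is replaced by the smooth kernel
  \<open>c (|z|\<^sup>2 + \<epsilon>\<^sup>2)\<^bsup>(2-d)/2\<^esup>\<close>, whose Laplacian is minus an approximate identity.  The energy of
  the regularised gradient field is then bounded by the true Newton energy of \<open>f\<close> with constant one
  (\<open>newton_field_inner_le\<close>), so nothing is lost when \<open>\<epsilon>\<close> tends to zero.  Truncations of \<open>f\<close>,
  a smooth approximation of \<open>|w|\<close> and Fatou's lemma extend the inequality from test functions to all
  of \<open>D\<^sup>1\<^sup>,\<^sup>2\<close>.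

  The argument needs that the potential energy of \<open>f\<close> is finite and that \<open>0 < S < \<infinity>\<close>.  Finiteness of the
  energy is the Hardy-Littlewood-Sobolev inequality for the quadratic form
  (\<open>hardy_littlewood_sobolev_energy\<close>), which has a short direct proof.  Combined with duality it yields
  Sobolev's inequality with some constant (\<open>sobolev_inequality_D12\<close>), so the infimum defining \<open>S\<close> is
  taken over a nonempty set; evaluating at a bump function shows that it is positive.
\<close>

section \<open>Reflections, translations and radial integrals\<close>

lemma distr_lborel_reflect:
  "distr lborel borel (\<lambda>y. x - y) = (lborel :: 'a::euclidean_space measure)"
  using lborel_affine[of "-1" x] by (simp add: density_1)

lemma nn_integral_lborel_reflect:
  fixes h :: "'a::euclidean_space \<Rightarrow> ennreal"
  assumes [measurable]: "h \<in> borel_measurable borel"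
  shows "(\<integral>\<^sup>+y. h (x - y) \<partial>lborel) = (\<integral>\<^sup>+z. h z \<partial>lborel)"
  by (subst (2) distr_lborel_reflect[of x, symmetric]) (simp add: nn_integral_distr)

lemma integral_lborel_reflect:
  fixes h :: "'a::euclidean_space \<Rightarrow> 'b::euclidean_space"
  assumes [measurable]: "h \<in> borel_measurable borel"
  shows "(\<integral>y. h (x - y) \<partial>lborel) = (\<integral>z. h z \<partial>lborel)"
  by (subst (2) distr_lborel_reflect[of x, symmetric]) (simp add: integral_distr)

lemma integrable_lborel_reflect:
  fixes h :: "'a::euclidean_space \<Rightarrow> 'b::euclidean_space"
  assumes "integrable lborel h"
  shows "integrable lborel (\<lambda>y. h (x - y))"
  by (rule integrable_distr[of "\<lambda>y. x - y" lborel borel]) (simp_all add: distr_lborel_reflect assms)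

lemma integral_lborel_translate:
  fixes h :: "'a::euclidean_space \<Rightarrow> real"
  assumes [measurable]: "h \<in> borel_measurable borel"
  shows "(\<integral>x. h (x + b) \<partial>lborel) = (\<integral>x. h x \<partial>lborel)"
  by (subst (2) lborel_distr_plus[of b, symmetric]) (simp add: integral_distr add.commute)

lemma integrable_lborel_translate:
  fixes h :: "'a::euclidean_space \<Rightarrow> real"
  assumes "integrable lborel h"
  shows "integrable lborel (\<lambda>x. h (x + b))"
  using integrable_distr[of "(+) b" lborel borel h] assms by (simp add: lborel_distr_plus add.commute)

text \<open>
  Polar coordinates without spherical integrals: a ball of radius \<open>r\<close> has volume proportional to
  \<open>r\<^sup>d\<close>, and a measure on the line is determined by its values on the half lines up to \<open>r\<close>.
\<close>
lemma distr_norm_lborel: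
  "distr (lborel :: 'a::euclidean_space measure) borel norm =
     density lborel (\<lambda>r. ennreal (sphere_area TYPE('a) * r ^ (DIM('a) - 1)) * indicator {0..} r)"
proof (rule measure_eqI_generator_eq[where E = "range atMost" and \<Omega> = UNIV and A = "\<lambda>i::nat. {..real i}"])
  show "Int_stable (range (atMost :: real \<Rightarrow> real set))"
  proof (rule Int_stableI)
    fix a b assume "a \<in> range (atMost :: real \<Rightarrow> real set)" "b \<in> range (atMost :: real \<Rightarrow> real set)"
    then obtain s t where "a = {..s}" "b = {..t}" by auto
    then have "a \<inter> b = {..min s t}" by auto
    then show "a \<inter> b \<in> range atMost" by auto
  qed
  have s: "sets (borel :: real measure) = sigma_sets UNIV (range atMost)"
    by (subst borel_eq_atMost) (auto simp: image_def)
  show "sets (distr (lborel :: 'a measure) borel norm) = sigma_sets UNIV (range atMost)"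
    using s by simp
  show "sets (density lborel (\<lambda>r. ennreal (sphere_area TYPE('a) * r ^ (DIM('a) - 1)) * indicator {0..} r)) = sigma_sets UNIV (range atMost)"
    using s by simp
  show "range (\<lambda>i::nat. {..real i}) \<subseteq> range atMost" by auto
  show "(\<Union>i. {..real i}) = UNIV" by (auto intro: real_arch_simple)
  have ball: "{x::'a. norm x \<le> r} = cball 0 r" for r by auto
  show "emeasure (distr (lborel :: 'a measure) borel norm) {..real i} \<noteq> \<infinity>" for i
    using emeasure_compact_finite[of "cball (0::'a) i"]
    by (simp add: emeasure_distr vimage_def ball)
  fix X assume "X \<in> range (atMost :: real \<Rightarrow> real set)"
  then obtain r where X: "X = {..r}" by auto
  have A: "sphere_area TYPE('a) = real DIM('a) * unit_ball_vol (real DIM('a))"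
    by (simp add: sphere_area_def content_ball)
  have l: "emeasure (distr (lborel :: 'a measure) borel norm) X = emeasure lborel (cball (0::'a) r)"
    by (simp add: emeasure_distr vimage_def ball X)
  have r: "emeasure (density lborel (\<lambda>r. ennreal (sphere_area TYPE('a) * r ^ (DIM('a) - 1)) * indicator {0..} r)) X
     = (\<integral>\<^sup>+s. ennreal (sphere_area TYPE('a) * s ^ (DIM('a) - 1)) * indicator {0..r} s \<partial>lborel)"
    by (auto simp: X emeasure_density intro!: nn_integral_cong split: split_indicator)
  show "emeasure (distr (lborel :: 'a measure) borel norm) X =
     emeasure (density lborel (\<lambda>r. ennreal (sphere_area TYPE('a) * r ^ (DIM('a) - 1)) * indicator {0..} r)) X"
  proof (cases "r \<ge> 0")
    case True
    have "(\<integral>\<^sup>+s. ennreal (sphere_area TYPE('a) * s ^ (DIM('a) - 1)) * indicator {0..r} s \<partial>lborel)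
      = unit_ball_vol DIM('a) * r ^ DIM('a) - unit_ball_vol DIM('a) * 0 ^ DIM('a)"
      by (rule nn_integral_FTC_Icc) (auto intro!: derivative_eq_intros True simp: A)
    then show ?thesis
      unfolding l r by (simp add: emeasure_cball True)
  next
    case False
    then show ?thesis unfolding l r by simp
  qed
qed auto

lemma nn_integral_radial:
  fixes h :: "real \<Rightarrow> ennreal"
  assumes [measurable]: "h \<in> borel_measurable borel"
  shows "(\<integral>\<^sup>+x. h (norm (x::'a::euclidean_space)) \<partial>lborel) =
    (\<integral>\<^sup>+r. h r * (ennreal (sphere_area TYPE('a) * r ^ (DIM('a) - 1)) * indicator {0..} r) \<partial>lborel)"
proof -
  have "(\<integral>\<^sup>+x. h (norm (x::'a)) \<partial>lborel) = (\<integral>\<^sup>+r. h r \<partial>distr (lborel :: 'a measure) borel norm)"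
    by (simp add: nn_integral_distr)
  also have "\<dots> = (\<integral>\<^sup>+r. h r * (ennreal (sphere_area TYPE('a) * r ^ (DIM('a) - 1)) * indicator {0..} r) \<partial>lborel)"
    unfolding distr_norm_lborel by (subst nn_integral_density) (auto simp: mult.commute)
  finally show ?thesis .
qed

lemma sphere_area_pos: "sphere_area TYPE('a::euclidean_space) > 0"
  by (simp add: sphere_area_def)

lemma nn_integral_norm_powr_far:
  assumes "R > 0" "\<beta> > real DIM('a::euclidean_space)"
  shows "(\<integral>\<^sup>+z. ennreal (norm (z::'a) powr (- \<beta>)) * indicator {R..} (norm z) \<partial>lborel)
    = ennreal (sphere_area TYPE('a) / (\<beta> - real DIM('a)) * R powr (real DIM('a) - \<beta>))"
proof -
  let ?n = "real DIM('a)" and ?A = "sphere_area TYPE('a)"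
  have A: "?A > 0" by (rule sphere_area_pos)
  have n: "?n > 0" "\<beta> - ?n > 0" using assms by auto
  have "(\<integral>\<^sup>+z. ennreal (norm (z::'a) powr (- \<beta>)) * indicator {R..} (norm z) \<partial>lborel)
    = (\<integral>\<^sup>+r. (ennreal (r powr (- \<beta>)) * indicator {R..} r) * (ennreal (?A * r ^ (DIM('a) - 1)) * indicator {0..} r) \<partial>lborel)"
    by (rule nn_integral_radial[where h = "\<lambda>r. ennreal (r powr (- \<beta>)) * indicator {R..} r"]) simp
  also have "\<dots> = (\<integral>\<^sup>+r. ennreal (?A * r powr (?n - \<beta> - 1)) * indicator {R..} r \<partial>lborel)"
  proof (rule nn_integral_cong)
    fix r :: real
    have "r powr (- \<beta>) * (?A * r ^ (DIM('a) - 1)) = ?A * r powr (?n - \<beta> - 1)" if "r \<ge> R"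
    proof -
      have "r > 0" using that assms by simp
      then have rr: "r ^ (DIM('a) - 1) = r powr (?n - 1)"
        by (simp add: powr_realpow[symmetric] of_nat_diff Suc_leI)
      show ?thesis unfolding rr using \<open>r > 0\<close> by (simp add: mult.left_commute powr_add[symmetric] algebra_simps)
    qed
    then show "(ennreal (r powr (- \<beta>)) * indicator {R..} r) * (ennreal (?A * r ^ (DIM('a) - 1)) * indicator {0..} r)
      = ennreal (?A * r powr (?n - \<beta> - 1)) * indicator {R..} r"
      using assms A by (auto split: split_indicator simp: ennreal_mult[symmetric])
  qed
  also have "\<dots> = 0 - (- ?A / (\<beta> - ?n) * R powr (?n - \<beta>))"
  proof (rule nn_integral_FTC_atLeast)
    show "((\<lambda>r. - ?A / (\<beta> - ?n) * r powr (?n - \<beta>)) has_real_derivative ?A * r powr (?n - \<beta> - 1)) (at r)" if "R \<le> r" for r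
    proof -
      have "r > 0" using that assms by simp
      then have "((\<lambda>r. - ?A / (\<beta> - ?n) * r powr (?n - \<beta>)) has_real_derivative
          - ?A / (\<beta> - ?n) * ((?n - \<beta>) * r powr (?n - \<beta> - 1))) (at r)"
        by (intro DERIV_cmult has_real_derivative_powr)
      moreover have "- a / b * (- b * c) = a * c" if "b \<noteq> 0" for a b c :: real
        using that by simp
      from this[of "\<beta> - ?n" ?A "r powr (?n - \<beta> - 1)"]
      have "- ?A / (\<beta> - ?n) * ((?n - \<beta>) * r powr (?n - \<beta> - 1)) = ?A * r powr (?n - \<beta> - 1)"
        using n(2) unfolding minus_diff_eq by simp
      ultimately show ?thesis by simp
    qed
    have "((\<lambda>r. r powr (?n - \<beta>)) \<longlongrightarrow> 0) at_top"
      using n by (intro tendsto_neg_powr filterlim_ident) auto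
    from tendsto_mult_right_zero[OF this]
    show "((\<lambda>r. - ?A / (\<beta> - ?n) * r powr (?n - \<beta>)) \<longlongrightarrow> 0) at_top" by blast
  qed (use A in auto)
  finally show ?thesis by simp
qed

section \<open>The Hardy-Littlewood-Sobolev inequality for the Riesz energy\<close>

lemma nn_integral_riesz_near:
  assumes "DIM('a::euclidean_space) \<ge> 3" "R \<ge> 0"
  shows "(\<integral>\<^sup>+z. ennreal (norm (z::'a) powr (2 - real DIM('a))) * indicator {0..R} (norm z) \<partial>lborel)
    = ennreal (sphere_area TYPE('a) * R\<^sup>2 / 2)"
proof -
  let ?n = "real DIM('a)" and ?A = "sphere_area TYPE('a)"
  have A: "?A > 0" by (rule sphere_area_pos)
  have "(\<integral>\<^sup>+z. ennreal (norm (z::'a) powr (2 - ?n)) * indicator {0..R} (norm z) \<partial>lborel)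
    = (\<integral>\<^sup>+r. (ennreal (r powr (2 - ?n)) * indicator {0..R} r) * (ennreal (?A * r ^ (DIM('a) - 1)) * indicator {0..} r) \<partial>lborel)"
    by (rule nn_integral_radial[where h = "\<lambda>r. ennreal (r powr (2 - ?n)) * indicator {0..R} r"]) simp
  also have "\<dots> = (\<integral>\<^sup>+r. ennreal (?A * r) * indicator {0..R} r \<partial>lborel)"
  proof (rule nn_integral_cong)
    fix r :: real
    have "r powr (2 - ?n) * (?A * r ^ (DIM('a) - 1)) = ?A * r" if "r \<ge> 0"
    proof (cases "r = 0")
      case False
      then have "r > 0" using that by simp
      then have "r ^ (DIM('a) - 1) = r powr (?n - 1)"
        using assms(1) by (simp add: powr_realpow[symmetric] of_nat_diff)
      then show ?thesis using \<open>r > 0\<close> by (simp add: mult.left_commute powr_add[symmetric])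
    qed simp
    then show "(ennreal (r powr (2 - ?n)) * indicator {0..R} r) * (ennreal (?A * r ^ (DIM('a) - 1)) * indicator {0..} r)
      = ennreal (?A * r) * indicator {0..R} r"
      using A by (auto split: split_indicator simp: ennreal_mult[symmetric])
  qed
  also have "\<dots> = ?A * R\<^sup>2 / 2 - ?A * 0\<^sup>2 / 2"
    by (rule nn_integral_FTC_Icc) (use A assms in \<open>auto intro!: derivative_eq_intros\<close>)
  finally show ?thesis by simp
qed

text \<open>
  A form of Young's inequality with explicit weights. One of the two terms on the right already
  dominates \<open>u k\<close>: the first if \<open>k \<le> (t u)\<^sup>\<alpha>\<close>, the second otherwise.
\<close>
lemma young_threshold:
  fixes t u k \<alpha> :: real
  assumes "t > 0" "u \<ge> 0" "k \<ge> 0" "\<alpha> > 0"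
  shows "u * k \<le> t powr \<alpha> * u powr (1 + \<alpha>) + inverse t * k powr (1 + 1 / \<alpha>)"
proof (cases "u = 0 \<or> k = 0")
  case True
  then show ?thesis using assms by auto
next
  case False
  then have u: "u > 0" and k: "k > 0" using assms by auto
  show ?thesis
  proof (cases "k \<le> (t * u) powr \<alpha>")
    case True
    have "u * k \<le> u * (t powr \<alpha> * u powr \<alpha>)"
      using True u assms by (simp add: powr_mult)
    also have "\<dots> = t powr \<alpha> * u powr (1 + \<alpha>)" using u by (simp add: powr_add)
    finally show ?thesis using assms by (smt (verit) mult_nonneg_nonneg powr_ge_zero inverse_nonnegative_iff_nonnegative)
  next
    case False
    then have "((t * u) powr \<alpha>) powr (1 / \<alpha>) \<le> k powr (1 / \<alpha>)"
      using assms by (intro powr_mono2) auto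
    then have "t * u \<le> k powr (1 / \<alpha>)" using assms u by (simp add: powr_powr)
    then have "u \<le> inverse t * k powr (1 / \<alpha>)" using assms by (simp add: field_simps)
    then have "u * k \<le> inverse t * k powr (1 / \<alpha>) * k" using k by (intro mult_right_mono) auto
    also have "\<dots> = inverse t * k powr (1 + 1 / \<alpha>)" using k by (simp add: powr_add)
    finally show ?thesis using assms by (smt (verit) mult_nonneg_nonneg powr_ge_zero)
  qed
qed

definition riesz_energy :: "('a::euclidean_space \<Rightarrow> real) \<Rightarrow> ennreal" where
  "riesz_energy f = (\<integral>\<^sup>+x. \<integral>\<^sup>+y. ennreal (f x * f y * norm (x - y) powr (2 - real DIM('a))) \<partial>lborel \<partial>lborel)"

text \<open>
  The potential of a density cut off at height \<open>t\<close> is estimated at the radius \<open>R = t\<^bsup>-2/(d+2)\<^esup>\<close>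
  that balances both parts. Inside \<open>R\<close> the density is at most \<open>t\<close> and the kernel is integrable. Outside
  \<open>R\<close> the kernel lies in the dual Lebesgue space, and \<open>young_threshold\<close> separates it from the density.
\<close>
lemma truncated_potential_le:
  fixes f :: "'a::euclidean_space \<Rightarrow> real" and t :: real
  assumes d: "DIM('a) \<ge> 3" and [measurable]: "f \<in> borel_measurable borel" and f0: "\<And>x. f x \<ge> 0"
    and N: "(\<integral>\<^sup>+x. ennreal (f x powr (2 * real DIM('a) / (real DIM('a) + 2))) \<partial>lborel) \<le> 1"
    and t: "t > 0"
  shows "(\<integral>\<^sup>+y. ennreal (min (f y) t * norm (x - y) powr (2 - real DIM('a))) \<partial>lborel)
    \<le> ennreal ((sphere_area TYPE('a) / 2 + 1 + sphere_area TYPE('a) / real DIM('a)) *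
         t powr ((real DIM('a) - 2) / (real DIM('a) + 2)))"
proof -
  define n where "n = real DIM('a)"
  define A where "A = sphere_area TYPE('a)"
  define \<alpha> where "\<alpha> = (n - 2) / (n + 2)"
  define R where "R = t powr (- 2 / (n + 2))"
  have n: "n \<ge> 3" using d by (simp add: n_def)
  have \<alpha>: "\<alpha> > 0" "1 + \<alpha> = 2 * n / (n + 2)" "(2 - n) * (1 + 1 / \<alpha>) = - 2 * n"
    using n by (simp_all add: \<alpha>_def field_simps)
  have A: "A > 0" by (simp add: A_def sphere_area_pos)
  have R: "R > 0" using t by (simp add: R_def)
  have [measurable]: "(\<lambda>x. norm x powr c) \<in> borel_measurable (borel :: 'a measure)" for c by measurable
  let ?k = "\<lambda>z::'a. norm z powr (2 - n)"
  \<comment> \<open>The exponents are dual: \<open>1 + \<alpha> = 2d/(d+2)\<close> for the density and \<open>1 + 1/\<alpha> = 2d/(d-2)\<close> for the kernel.\<close>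
  have pt: "ennreal (min (f y) t * ?k z) \<le> ennreal t * (ennreal (?k z) * indicator {0..R} (norm z))
      + (ennreal (t powr \<alpha>) * ennreal (f y powr (1 + \<alpha>))
         + ennreal (inverse t) * (ennreal (norm z powr (- 2 * n)) * indicator {R..} (norm z)))" for y z
  proof (cases "norm z \<le> R")
    case True
    have "ennreal (min (f y) t * ?k z) \<le> ennreal (t * ?k z)"
      by (intro ennreal_leI mult_right_mono) auto
    also have "\<dots> = ennreal t * (ennreal (?k z) * indicator {0..R} (norm z))"
      using True t by (simp add: ennreal_mult)
    finally show ?thesis by (simp add: add_increasing2)
  next
    case False
    have "min (f y) t * ?k z \<le> f y * ?k z" by (intro mult_right_mono) auto
    also have "\<dots> \<le> t powr \<alpha> * f y powr (1 + \<alpha>) + inverse t * ?k z powr (1 + 1 / \<alpha>)"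
      by (rule young_threshold) (use t f0 \<alpha> in auto)
    also have "?k z powr (1 + 1 / \<alpha>) = norm z powr (- 2 * n)" by (simp only: powr_powr \<alpha>)
    finally have "ennreal (min (f y) t * ?k z) \<le> ennreal (t powr \<alpha> * f y powr (1 + \<alpha>) + inverse t * norm z powr (- 2 * n))"
      by (rule ennreal_leI)
    also have "\<dots> = ennreal (t powr \<alpha>) * ennreal (f y powr (1 + \<alpha>)) + ennreal (inverse t) * ennreal (norm z powr (- 2 * n))"
      using t by (simp add: ennreal_mult)
    finally show ?thesis using False by (simp add: add_increasing)
  qed
  have "(\<integral>\<^sup>+y. ennreal (min (f y) t * ?k (x - y)) \<partial>lborel)
     \<le> (\<integral>\<^sup>+y. (ennreal t * (ennreal (?k (x - y)) * indicator {0..R} (norm (x - y)))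
      + (ennreal (t powr \<alpha>) * ennreal (f y powr (1 + \<alpha>))
         + ennreal (inverse t) * (ennreal (norm (x - y) powr (- 2 * n)) * indicator {R..} (norm (x - y))))) \<partial>lborel)"
    by (intro nn_integral_mono pt)
  also have "\<dots> = ennreal t * (\<integral>\<^sup>+y. ennreal (?k (x - y)) * indicator {0..R} (norm (x - y)) \<partial>lborel)
     + (ennreal (t powr \<alpha>) * (\<integral>\<^sup>+y. ennreal (f y powr (1 + \<alpha>)) \<partial>lborel)
     + ennreal (inverse t) * (\<integral>\<^sup>+y. ennreal (norm (x - y) powr (- 2 * n)) * indicator {R..} (norm (x - y)) \<partial>lborel))"
    by (simp add: nn_integral_add nn_integral_cmult)
  also have "(\<integral>\<^sup>+y. ennreal (?k (x - y)) * indicator {0..R} (norm (x - y)) \<partial>lborel) = ennreal (A * R\<^sup>2 / 2)"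
    using nn_integral_lborel_reflect[of "\<lambda>z. ennreal (?k z) * indicator {0..R} (norm z)" x]
      nn_integral_riesz_near[OF d, of R] R by (simp add: n_def A_def)
  also have "(\<integral>\<^sup>+y. ennreal (norm (x - y) powr (- 2 * n)) * indicator {R..} (norm (x - y)) \<partial>lborel) = ennreal (A / n * R powr (- n))"
    using nn_integral_lborel_reflect[of "\<lambda>z. ennreal (norm z powr (- 2 * n)) * indicator {R..} (norm z)" x]
      nn_integral_norm_powr_far[OF R, where 'a='a and \<beta> = "2 * n"] n by (simp add: n_def A_def)
  also have "ennreal t * ennreal (A * R\<^sup>2 / 2) + (ennreal (t powr \<alpha>) * (\<integral>\<^sup>+y. ennreal (f y powr (1 + \<alpha>)) \<partial>lborel)
      + ennreal (inverse t) * ennreal (A / n * R powr (- n)))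
    \<le> ennreal t * ennreal (A * R\<^sup>2 / 2) + (ennreal (t powr \<alpha>) * 1
      + ennreal (inverse t) * ennreal (A / n * R powr (- n)))"
    using N by (intro add_mono order.refl mult_left_mono) (auto simp: \<alpha> n_def)
  also have "\<dots> = ennreal (t * (A * R\<^sup>2 / 2) + (t powr \<alpha> + inverse t * (A / n * R powr (- n))))"
    using t A n by (simp add: ennreal_mult[symmetric])
  also have "R\<^sup>2 = t powr (\<alpha> - 1)"
  proof -
    have "R\<^sup>2 = R powr 2" using R by simp
    also have "\<dots> = t powr (\<alpha> - 1)"
      unfolding R_def powr_powr using n by (intro arg_cong[where f = "(powr) t"]) (simp add: \<alpha>_def field_simps)
    finally show ?thesis .
  qed
  also have "R powr (- n) = t powr (\<alpha> + 1)"
    unfolding R_def powr_powr using n by (intro arg_cong[where f = "(powr) t"]) (simp add: \<alpha>_def field_simps)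
  also have "t * (A * t powr (\<alpha> - 1) / 2) + (t powr \<alpha> + inverse t * (A / n * t powr (\<alpha> + 1)))
    = (A / 2 + 1 + A / n) * t powr \<alpha>"
    using t n by (simp add: powr_add powr_diff field_simps)
  finally show ?thesis by (simp add: n_def A_def \<alpha>_def)
qed

text \<open>
  By symmetry of the kernel it is enough to integrate over the pairs with \<open>f y \<le> f x\<close>. There
  \<open>f y\<close> may be cut off at height \<open>f x\<close>, so that \<open>truncated_potential_le\<close> bounds the inner integral by a
  multiple of \<open>f x\<close> to the power \<open>(d-2)/(d+2)\<close>. Multiplied by \<open>f x\<close> this is the normalised integrand.
\<close>
lemma riesz_energy_le_normalized:
  fixes f :: "'a::euclidean_space \<Rightarrow> real"
  assumes d: "DIM('a) \<ge> 3" and [measurable]: "f \<in> borel_measurable borel" and f0: "\<And>x. f x \<ge> 0"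
    and N: "(\<integral>\<^sup>+x. ennreal (f x powr (2 * real DIM('a) / (real DIM('a) + 2))) \<partial>lborel) \<le> 1"
  shows "riesz_energy f \<le> ennreal (2 * (sphere_area TYPE('a) / 2 + 1 + sphere_area TYPE('a) / real DIM('a)))"
proof -
  define n where "n = real DIM('a)"
  define C where "C = sphere_area TYPE('a) / 2 + 1 + sphere_area TYPE('a) / n"
  define \<alpha> where "\<alpha> = (n - 2) / (n + 2)"
  have n: "n \<ge> 3" using d by (simp add: n_def)
  have \<alpha>: "1 + \<alpha> = 2 * n / (n + 2)" using n by (simp add: \<alpha>_def field_simps)
  have C: "C > 0" using sphere_area_pos[where 'a='a] n by (simp add: C_def add_pos_nonneg add_nonneg_pos)
  define k where "k z = norm z powr (2 - n)" for z :: 'a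
  have [measurable]: "k \<in> borel_measurable borel" unfolding k_def by measurable
  have k: "k z \<ge> 0" "k (y - x) = k (x - y)" for x y z by (auto simp: k_def norm_minus_commute)
  let ?m = "\<lambda>x y. ennreal (f x * (min (f y) (f x) * k (x - y)))"
  have one: "(\<integral>\<^sup>+x. \<integral>\<^sup>+y. ?m x y \<partial>lborel \<partial>lborel) \<le> ennreal C"
  proof -
    have "(\<integral>\<^sup>+y. ?m x y \<partial>lborel) \<le> ennreal (C * f x powr (1 + \<alpha>))" for x
    proof (cases "f x = 0")
      case False
      then have fx: "f x > 0" using f0[of x] by simp
      have "(\<integral>\<^sup>+y. ?m x y \<partial>lborel) = ennreal (f x) * (\<integral>\<^sup>+y. ennreal (min (f y) (f x) * k (x - y)) \<partial>lborel)"
        using f0 k by (simp add: ennreal_mult nn_integral_cmult)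
      also have "\<dots> \<le> ennreal (f x) * ennreal (C * f x powr \<alpha>)"
        using truncated_potential_le[OF d _ f0 N fx, of x] by (intro mult_left_mono) (auto simp: k_def n_def C_def \<alpha>_def)
      also have "\<dots> = ennreal (C * f x powr (1 + \<alpha>))"
        using fx C by (simp add: ennreal_mult[symmetric] powr_add mult_ac)
      finally show ?thesis .
    qed simp
    then have "(\<integral>\<^sup>+x. \<integral>\<^sup>+y. ?m x y \<partial>lborel \<partial>lborel) \<le> (\<integral>\<^sup>+x. ennreal (C * f x powr (1 + \<alpha>)) \<partial>lborel)"
      by (intro nn_integral_mono)
    also have "\<dots> = ennreal C * (\<integral>\<^sup>+x. ennreal (f x powr (1 + \<alpha>)) \<partial>lborel)"
      using C by (simp add: ennreal_mult nn_integral_cmult)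
    also have "\<dots> \<le> ennreal C * 1"
      using N by (intro mult_left_mono) (auto simp: \<alpha> n_def)
    finally show ?thesis by simp
  qed
  have "riesz_energy f \<le> (\<integral>\<^sup>+x. \<integral>\<^sup>+y. ?m x y + ?m y x \<partial>lborel \<partial>lborel)"
    unfolding riesz_energy_def n_def[symmetric] k_def[symmetric]
  proof (intro nn_integral_mono)
    fix x y
    show "ennreal (f x * f y * k (x - y)) \<le> ?m x y + ?m y x"
      using f0 k by (cases "f y \<le> f x") (auto simp: min_def mult_ac add_increasing add_increasing2 k(2)[of y x])
  qed
  also have "\<dots> = (\<integral>\<^sup>+x. \<integral>\<^sup>+y. ?m x y \<partial>lborel \<partial>lborel) + (\<integral>\<^sup>+x. \<integral>\<^sup>+y. ?m y x \<partial>lborel \<partial>lborel)"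
    by (simp add: nn_integral_add)
  also have "(\<integral>\<^sup>+x. \<integral>\<^sup>+y. ?m y x \<partial>lborel \<partial>lborel) = (\<integral>\<^sup>+x. \<integral>\<^sup>+y. ?m x y \<partial>lborel \<partial>lborel)"
    by (rule lborel_pair.Fubini') measurable
  finally have "riesz_energy f \<le> ennreal C + ennreal C" using one by (meson add_mono order_trans)
  also have "ennreal C + ennreal C = ennreal (2 * C)"
    using C by (simp add: ennreal_plus[symmetric] del: ennreal_plus)
  finally show ?thesis by (simp only: C_def n_def)
qed

text \<open>
  The energy is quadratic and the \<open>p\<close>-th power integral is homogeneous of degree \<open>p = 2d/(d+2)\<close>, so the
  general case follows from the normalised one by scaling, which produces the power \<open>2/p = (d+2)/d\<close>.
\<close>
theorem hardy_littlewood_sobolev_energy: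
  assumes d: "DIM('a::euclidean_space) \<ge> 3"
  obtains C where "C > 0"
    "\<And>(f :: 'a \<Rightarrow> real) N. f \<in> borel_measurable borel \<Longrightarrow> (\<And>x. f x \<ge> 0) \<Longrightarrow>
      N \<ge> 0 \<Longrightarrow> (\<integral>\<^sup>+x. ennreal (f x powr (2 * real DIM('a) / (real DIM('a) + 2))) \<partial>lborel) = ennreal N \<Longrightarrow>
      riesz_energy f \<le> ennreal (C * N powr ((real DIM('a) + 2) / real DIM('a)))"
proof
  let ?C = "2 * (sphere_area TYPE('a) / 2 + 1 + sphere_area TYPE('a) / real DIM('a))"
  show C: "?C > 0" using sphere_area_pos[where 'a='a] by (simp add: add_pos_nonneg add_nonneg_pos)
  fix f :: "'a \<Rightarrow> real" and N
  assume f[measurable]: "f \<in> borel_measurable borel" and f0: "\<And>x. f x \<ge> 0" and N0: "N \<ge> 0"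
    and N: "(\<integral>\<^sup>+x. ennreal (f x powr (2 * real DIM('a) / (real DIM('a) + 2))) \<partial>lborel) = ennreal N"
  define p where "p = 2 * real DIM('a) / (real DIM('a) + 2)"
  have p: "p > 0" by (simp add: p_def)
  have Np: "(\<integral>\<^sup>+x. ennreal (f x powr p) \<partial>lborel) = ennreal N" using N by (simp add: p_def)
  have [measurable]: "(\<lambda>x. norm x powr c) \<in> borel_measurable (borel :: 'a measure)" for c by measurable
  show "riesz_energy f \<le> ennreal (?C * N powr ((real DIM('a) + 2) / real DIM('a)))"
  proof (cases "N = 0")
    case True
    then have "AE x in lborel. ennreal (f x powr p) = 0"
      using Np nn_integral_0_iff_AE[of "\<lambda>x. ennreal (f x powr p)" lborel] by simp
    then have ae: "AE x in lborel. f x = 0" by eventually_elim auto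
    have "riesz_energy f = (\<integral>\<^sup>+x. \<integral>\<^sup>+(y::'a). 0 \<partial>lborel \<partial>(lborel :: 'a measure))"
      unfolding riesz_energy_def by (intro nn_integral_cong_AE, use ae in eventually_elim) simp
    then show ?thesis by simp
  next
    case False
    then have Npos: "N > 0" using N0 by simp
    define c where "c = N powr (1 / p)"
    have c: "c > 0" "c powr p = N" using Npos p by (simp_all add: c_def powr_powr)
    define g where "g x = f x / c" for x
    have [measurable]: "g \<in> borel_measurable borel" unfolding g_def by measurable
    have g0: "g x \<ge> 0" for x using c f0 by (simp add: g_def)
    have gp: "g x powr p = inverse N * f x powr p" for x
      unfolding g_def powr_divide[of "f x" c p] c(2) by (simp add: divide_inverse)
    have "(\<integral>\<^sup>+x. ennreal (g x powr p) \<partial>lborel) = (\<integral>\<^sup>+x. ennreal (inverse N) * ennreal (f x powr p) \<partial>lborel)"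
      using c f0 Npos by (intro nn_integral_cong) (simp add: gp ennreal_mult[symmetric])
    also have "\<dots> = ennreal (inverse N) * ennreal N" by (simp add: nn_integral_cmult Np)
    also have "\<dots> = 1" using Npos by (simp add: ennreal_mult[symmetric])
    finally have "riesz_energy g \<le> ennreal ?C"
      by (intro riesz_energy_le_normalized d g0) (auto simp: p_def)
    moreover have "riesz_energy f = ennreal (c\<^sup>2) * riesz_energy g"
    proof -
      have "riesz_energy f = (\<integral>\<^sup>+x. \<integral>\<^sup>+y. ennreal (c\<^sup>2) * ennreal (g x * g y * norm (x - y) powr (2 - real DIM('a))) \<partial>lborel \<partial>lborel)"
        unfolding riesz_energy_def
      proof (intro nn_integral_cong)
        fix x y :: 'a
        let ?k = "norm (x - y) powr (2 - real DIM('a))"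
        have "f x * f y * ?k = c\<^sup>2 * (g x * g y * ?k)"
          using c by (simp add: g_def power2_eq_square)
        then show "ennreal (f x * f y * ?k) = ennreal (c\<^sup>2) * ennreal (g x * g y * ?k)"
          using g0 by (simp only: ennreal_mult mult_nonneg_nonneg powr_ge_zero zero_le_power2)
      qed
      also have "\<dots> = ennreal (c\<^sup>2) * riesz_energy g"
        by (simp add: riesz_energy_def nn_integral_cmult)
      finally show ?thesis .
    qed
    moreover have "c\<^sup>2 = N powr ((real DIM('a) + 2) / real DIM('a))"
    proof -
      have "c\<^sup>2 = c powr 2" using c by simp
      also have "\<dots> = N powr ((real DIM('a) + 2) / real DIM('a))"
      proof -
        have "1 / p * 2 = (real DIM('a) + 2) / real DIM('a)" by (simp add: p_def field_simps)
        then show ?thesis by (simp only: c_def powr_powr)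
      qed
      finally show ?thesis .
    qed
    ultimately have "riesz_energy f \<le> ennreal (N powr ((real DIM('a) + 2) / real DIM('a))) * ennreal ?C"
      by (simp add: mult_left_mono)
    also have "\<dots> = ennreal (?C * N powr ((real DIM('a) + 2) / real DIM('a)))"
      using C by (subst ennreal_mult[symmetric]) (auto simp: mult.commute)
    finally show ?thesis .
  qed
qed

section \<open>Integration by parts on the whole space\<close>

text \<open>
  The integral of \<open>u (x + b) - u x\<close> vanishes by translation invariance. By the fundamental theorem of
  calculus and Fubini it is also the average over \<open>t \<in> [0,1]\<close> of the integrals of \<open>du (x + t b)\<close>, all of
  which equal the integral of \<open>du\<close>.
\<close>
lemma integral_directional_derivative_eq_0:
  fixes u du :: "'a::euclidean_space \<Rightarrow> real"
  assumes u: "integrable lborel u" and du: "integrable lborel du"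
    and cont: "continuous_on UNIV du"
    and D: "\<And>x t. ((\<lambda>t. u (x + t *\<^sub>R b)) has_real_derivative du (x + t *\<^sub>R b)) (at t)"
  shows "(\<integral>x. du x \<partial>lborel) = 0"
proof -
  have [measurable]: "du \<in> borel_measurable borel" "u \<in> borel_measurable borel"
    using du u by auto
  have int: "integrable (lborel \<Otimes>\<^sub>M lborel) (\<lambda>(t, x). indicator {0..1::real} t *\<^sub>R du (x + t *\<^sub>R b))"
  proof (rule lborel_pair.Fubini_integrable)
    have "(\<lambda>t. \<integral>x. norm (case (t, x) of (t, x) \<Rightarrow> indicator {0..1::real} t *\<^sub>R du (x + t *\<^sub>R b)) \<partial>lborel)
      = (\<lambda>t. indicator {0..1} t *\<^sub>R (\<integral>x. \<bar>du x\<bar> \<partial>lborel))"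
      using integral_lborel_translate[of "\<lambda>x. \<bar>du x\<bar>"] by (auto simp: abs_mult)
    then show "integrable lborel (\<lambda>t. \<integral>x. norm (case (t, x) of (t, x) \<Rightarrow> indicator {0..1::real} t *\<^sub>R du (x + t *\<^sub>R b)) \<partial>lborel)"
      by (auto intro!: integrable_indicator)
    show "AE t in lborel. integrable lborel (\<lambda>x. case (t, x) of (t, x) \<Rightarrow> indicator {0..1::real} t *\<^sub>R du (x + t *\<^sub>R b))"
      using integrable_lborel_translate[OF du] by auto
  qed measurable
  have "u (x + b) - u x = (\<integral>t. indicator {0..1::real} t *\<^sub>R du (x + t *\<^sub>R b) \<partial>lborel)" for x
  proof -
    have "(\<integral>t. indicator {0..1::real} t *\<^sub>R du (x + t *\<^sub>R b) \<partial>lborel) = u (x + 1 *\<^sub>R b) - u (x + 0 *\<^sub>R b)"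
      by (rule integral_FTC_Icc)
         (auto intro!: continuous_intros continuous_on_compose2[OF cont] has_field_derivative_at_within[OF D]
            simp: has_real_derivative_iff_has_vector_derivative[symmetric])
    then show ?thesis by simp
  qed
  then have "(\<integral>x. u (x + b) - u x \<partial>lborel) = (\<integral>x. \<integral>t. indicator {0..1::real} t *\<^sub>R du (x + t *\<^sub>R b) \<partial>lborel \<partial>lborel)"
    by simp
  also have "\<dots> = (\<integral>t. \<integral>x. indicator {0..1::real} t *\<^sub>R du (x + t *\<^sub>R b) \<partial>lborel \<partial>lborel)"
    using lborel_pair.Fubini_integral[OF int] by simp
  also have "\<dots> = (\<integral>t. indicator {0..1::real} t *\<^sub>R (\<integral>x. du x \<partial>lborel) \<partial>lborel)"
    by (simp add: integral_lborel_translate)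
  also have "\<dots> = (\<integral>x. du x \<partial>lborel)" by simp
  finally have "(\<integral>x. du x \<partial>lborel) = (\<integral>x. u (x + b) - u x \<partial>lborel)" by simp
  also have "\<dots> = 0"
    using u by (simp add: integrable_lborel_translate integral_lborel_translate)
  finally show ?thesis .
qed

section \<open>The regularised Newton kernel\<close>

text \<open>
  A smooth substitute \<open>G\<^sub>\<epsilon>\<close> for the Newton kernel. The two definitions after it are
  \<open>-\<nabla>G\<^sub>\<epsilon>\<close> and \<open>-\<Delta>G\<^sub>\<epsilon>\<close>.
\<close>
definition newton_reg :: "real \<Rightarrow> 'a::euclidean_space \<Rightarrow> real" where
  "newton_reg \<epsilon> z = 1 / ((real DIM('a) - 2) * sphere_area TYPE('a)) * (\<epsilon>\<^sup>2 + z \<bullet> z) powr ((2 - real DIM('a)) / 2)"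

definition newton_field :: "real \<Rightarrow> 'a::euclidean_space \<Rightarrow> 'a" where
  "newton_field \<epsilon> z = (1 / sphere_area TYPE('a) * (\<epsilon>\<^sup>2 + z \<bullet> z) powr (- real DIM('a) / 2)) *\<^sub>R z"

definition newton_density :: "real \<Rightarrow> 'a::euclidean_space \<Rightarrow> real" where
  "newton_density \<epsilon> z = real DIM('a) * \<epsilon>\<^sup>2 / sphere_area TYPE('a) * (\<epsilon>\<^sup>2 + z \<bullet> z) powr (- (real DIM('a) + 2) / 2)"

lemma reg_pos: "\<epsilon> > 0 \<Longrightarrow> \<epsilon>\<^sup>2 + z \<bullet> (z::'a::euclidean_space) > (0::real)"
  by (simp add: add_pos_nonneg)

lemma continuous_reg_powr:
  "\<epsilon> > 0 \<Longrightarrow> continuous_on UNIV (\<lambda>z::'a::euclidean_space. (\<epsilon>\<^sup>2 + z \<bullet> z) powr \<alpha>)"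
  using reg_pos[of \<epsilon>, where 'a='a] by (auto intro!: continuous_intros simp: less_imp_neq[symmetric])

lemma continuous_newton_reg: "\<epsilon> > 0 \<Longrightarrow> continuous_on UNIV (newton_reg \<epsilon> :: 'a::euclidean_space \<Rightarrow> real)"
  unfolding newton_reg_def by (intro continuous_on_scaleR continuous_on_mult_left continuous_on_mult_right continuous_on_diff continuous_on_mult continuous_reg_powr) (auto intro!: continuous_intros)

lemma continuous_newton_field: "\<epsilon> > 0 \<Longrightarrow> continuous_on UNIV (newton_field \<epsilon> :: 'a::euclidean_space \<Rightarrow> 'a)"
  unfolding newton_field_def by (intro continuous_on_scaleR continuous_on_mult_left continuous_on_mult_right continuous_on_diff continuous_on_mult continuous_reg_powr) (auto intro!: continuous_intros)

lemma borel_newton_reg [measurable]: "newton_reg \<epsilon> \<in> borel_measurable borel"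
  unfolding newton_reg_def by measurable

lemma borel_newton_field [measurable]: "newton_field \<epsilon> \<in> borel_measurable borel"
  unfolding newton_field_def by measurable

lemma borel_newton_density [measurable]: "newton_density \<epsilon> \<in> borel_measurable borel"
  unfolding newton_density_def by measurable

lemma newton_density_nonneg: "newton_density \<epsilon> z \<ge> 0"
  using sphere_area_pos[where 'a='a] by (simp add: newton_density_def)

lemma has_derivative_reg_powr:
  fixes z :: "'a::euclidean_space"
  assumes "\<epsilon> > 0"
  shows "((\<lambda>z. (\<epsilon>\<^sup>2 + z \<bullet> z) powr \<alpha>) has_derivative (\<lambda>h. 2 * \<alpha> * (\<epsilon>\<^sup>2 + z \<bullet> z) powr (\<alpha> - 1) * (z \<bullet> h))) (at z)"
proof -
  have "((\<lambda>z. \<epsilon>\<^sup>2 + z \<bullet> z) has_derivative (\<lambda>h. 2 * (z \<bullet> h))) (at z)"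
    by (auto intro!: derivative_eq_intros simp: inner_commute)
  moreover have "((\<lambda>s. s powr \<alpha>) has_derivative (\<lambda>h. (\<alpha> * (\<epsilon>\<^sup>2 + z \<bullet> z) powr (\<alpha> - 1)) * h)) (at (\<epsilon>\<^sup>2 + z \<bullet> z))"
    using has_real_derivative_powr[OF reg_pos[OF assms, of z], of \<alpha>] by (simp add: has_field_derivative_def)
  ultimately have "((\<lambda>z. (\<epsilon>\<^sup>2 + z \<bullet> z) powr \<alpha>) has_derivative (\<lambda>h. (\<alpha> * (\<epsilon>\<^sup>2 + z \<bullet> z) powr (\<alpha> - 1)) * (2 * (z \<bullet> h)))) (at z)"
    by (rule has_derivative_compose)
  then show ?thesis by (simp add: mult_ac)
qed

lemma has_derivative_newton_reg:
  fixes z :: "'a::euclidean_space"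
  assumes "\<epsilon> > 0" "DIM('a) \<ge> 3"
  shows "(newton_reg \<epsilon> has_derivative (\<lambda>h. - newton_field \<epsilon> z \<bullet> h)) (at z)"
proof -
  let ?n = "real DIM('a)"
  have e: "(2 - ?n) / 2 - 1 = - ?n / 2" by (simp add: field_simps)
  have "(newton_reg \<epsilon> has_derivative (\<lambda>h. 1 / ((?n - 2) * sphere_area TYPE('a)) *
     (2 * ((2 - ?n) / 2) * (\<epsilon>\<^sup>2 + z \<bullet> z) powr ((2 - ?n) / 2 - 1) * (z \<bullet> h)))) (at z)"
    unfolding newton_reg_def[abs_def] by (intro has_derivative_mult_right has_derivative_reg_powr assms)
  then show ?thesis
    unfolding e by (rule has_derivative_eq_rhs)
      (use assms(2) sphere_area_pos[where 'a='a] in \<open>auto simp: newton_field_def fun_eq_iff field_simps\<close>)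
qed

text \<open>
  The derivative in direction \<open>b\<close> of the component along \<open>b\<close> of the field; these entries sum up to
  the divergence.
\<close>
definition newton_field_deriv :: "real \<Rightarrow> 'a::euclidean_space \<Rightarrow> 'a \<Rightarrow> real" where
  "newton_field_deriv \<epsilon> b z = 1 / sphere_area TYPE('a) *
     ((\<epsilon>\<^sup>2 + z \<bullet> z) powr (- real DIM('a) / 2) * (b \<bullet> b)
       - real DIM('a) * (\<epsilon>\<^sup>2 + z \<bullet> z) powr (- (real DIM('a) + 2) / 2) * (z \<bullet> b)\<^sup>2)"

lemma has_derivative_newton_field:
  fixes z b :: "'a::euclidean_space"
  assumes "\<epsilon> > 0"
  shows "\<exists>D. ((\<lambda>z. newton_field \<epsilon> z \<bullet> b) has_derivative D) (at z) \<and> D b = newton_field_deriv \<epsilon> b z"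
proof -
  let ?n = "real DIM('a)"
  have e: "- ?n / 2 - 1 = - (?n + 2) / 2" by (simp add: field_simps)
  have "((\<lambda>z. 1 / sphere_area TYPE('a) * ((\<epsilon>\<^sup>2 + z \<bullet> z) powr (- ?n / 2) * (z \<bullet> b))) has_derivative
     (\<lambda>h. 1 / sphere_area TYPE('a) * ((\<epsilon>\<^sup>2 + z \<bullet> z) powr (- ?n / 2) * (h \<bullet> b)
      + 2 * (- ?n / 2) * (\<epsilon>\<^sup>2 + z \<bullet> z) powr (- ?n / 2 - 1) * (z \<bullet> h) * (z \<bullet> b)))) (at z)"
    by (intro has_derivative_mult_right has_derivative_mult has_derivative_reg_powr assms)
       (auto intro!: derivative_eq_intros)
  then show ?thesis
    unfolding e by (intro exI conjI) (auto simp: newton_field_def[abs_def] newton_field_deriv_def power2_eq_square algebra_simps)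
qed

lemma continuous_newton_field_deriv: "\<epsilon> > 0 \<Longrightarrow> continuous_on UNIV (newton_field_deriv \<epsilon> b :: 'a::euclidean_space \<Rightarrow> real)"
  unfolding newton_field_deriv_def by (intro continuous_on_scaleR continuous_on_mult_left continuous_on_mult_right continuous_on_diff continuous_on_mult continuous_reg_powr) (auto intro!: continuous_intros)

lemma borel_newton_field_deriv [measurable]: "newton_field_deriv \<epsilon> b \<in> borel_measurable borel"
  unfolding newton_field_deriv_def by measurable

lemma sum_newton_field_deriv:
  fixes z :: "'a::euclidean_space"
  assumes "\<epsilon> > 0"
  shows "(\<Sum>b\<in>Basis. newton_field_deriv \<epsilon> b z) = newton_density \<epsilon> z"
proof -
  let ?n = "real DIM('a)"
  let ?s = "\<epsilon>\<^sup>2 + z \<bullet> z"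
  have e: "- ?n / 2 = 1 + - (?n + 2) / 2" by (simp add: field_simps)
  have s: "?s powr (- ?n / 2) = ?s * ?s powr (- (?n + 2) / 2)"
    unfolding e powr_add using reg_pos[OF assms, of z] by simp
  have z: "(\<Sum>b\<in>Basis. (z \<bullet> b)\<^sup>2) = z \<bullet> z"
    unfolding euclidean_inner[of z z] by (simp add: power2_eq_square)
  have "(\<Sum>b\<in>Basis. newton_field_deriv \<epsilon> b z) = 1 / sphere_area TYPE('a) *
     (?s powr (- ?n / 2) * ?n - ?n * ?s powr (- (?n + 2) / 2) * (z \<bullet> z))"
    unfolding newton_field_deriv_def sum_distrib_left[symmetric] sum_subtractf
    by (simp add: sum_distrib_left[symmetric] z)
  also have "\<dots> = newton_density \<epsilon> z"
    unfolding s newton_density_def by (simp add: algebra_simps)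
  finally show ?thesis .
qed

lemma integrable_reg_powr:
  assumes "\<epsilon> > 0" "\<alpha> > real DIM('a::euclidean_space) / 2"
  shows "integrable lborel (\<lambda>z::'a. (\<epsilon>\<^sup>2 + z \<bullet> z) powr (- \<alpha>))"
proof (rule integrableI_bounded)
  have \<alpha>: "\<alpha> > 0" using assms(2) by (rule le_less_trans[rotated]) simp
  have pt: "ennreal ((\<epsilon>\<^sup>2 + z \<bullet> z) powr (- \<alpha>)) \<le> ennreal ((\<epsilon>\<^sup>2) powr (- \<alpha>)) * indicator (cball 0 1) z
      + ennreal (norm z powr (- (2 * \<alpha>))) * indicator {1..} (norm z)" for z :: 'a
  proof (cases "norm z < 1")
    case True
    have "(\<epsilon>\<^sup>2 + z \<bullet> z) powr (- \<alpha>) \<le> (\<epsilon>\<^sup>2) powr (- \<alpha>)"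
      using assms(1) \<alpha> by (intro powr_mono2') auto
    then show ?thesis using True by (simp add: ennreal_leI)
  next
    case False
    then have z: "norm z > 0" by linarith
    have "(\<epsilon>\<^sup>2 + z \<bullet> z) powr (- \<alpha>) \<le> (norm z powr 2) powr (- \<alpha>)"
      using assms(1) \<alpha> z by (intro powr_mono2') (auto simp: power2_norm_eq_inner[symmetric])
    also have "\<dots> = norm z powr (- (2 * \<alpha>))" by (simp only: powr_powr) simp
    finally show ?thesis using False by (simp add: ennreal_leI add_increasing)
  qed
  have ball: "cball (0::'a) 1 \<in> sets lborel" by simp
  have m1: "(\<lambda>z. ennreal ((\<epsilon>\<^sup>2) powr (- \<alpha>)) * indicator (cball (0::'a) 1) z) \<in> borel_measurable lborel"
    by (intro borel_measurable_times_ennreal borel_measurable_indicator ball borel_measurable_const)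
  have m2: "(\<lambda>z::'a. ennreal (norm z powr (- (2 * \<alpha>))) * indicator {1..} (norm z)) \<in> borel_measurable lborel"
    by measurable
  have "(\<integral>\<^sup>+z. ennreal (norm ((\<epsilon>\<^sup>2 + z \<bullet> z) powr (- \<alpha>))) \<partial>(lborel :: 'a measure)) \<le>
     (\<integral>\<^sup>+z. ennreal ((\<epsilon>\<^sup>2) powr (- \<alpha>)) * indicator (cball 0 1) z
      + ennreal (norm z powr (- (2 * \<alpha>))) * indicator {1..} (norm z) \<partial>(lborel :: 'a measure))"
    using pt by (intro nn_integral_mono) simp
  also have "\<dots> = ennreal ((\<epsilon>\<^sup>2) powr (- \<alpha>)) * emeasure lborel (cball (0::'a) 1)
      + (\<integral>\<^sup>+z. ennreal (norm z powr (- (2 * \<alpha>))) * indicator {1..} (norm z) \<partial>(lborel :: 'a measure))"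
    unfolding nn_integral_add[OF m1 m2] nn_integral_cmult_indicator[OF ball] ..
  also have "\<dots> < \<infinity>"
  proof -
    have "(\<integral>\<^sup>+z. ennreal (norm z powr (- (2 * \<alpha>))) * indicator {1..} (norm z) \<partial>(lborel :: 'a measure)) < \<infinity>"
      using assms by (subst nn_integral_norm_powr_far) auto
    moreover have "ennreal ((\<epsilon>\<^sup>2) powr (- \<alpha>)) * emeasure lborel (cball (0::'a) 1) < \<infinity>"
      using emeasure_compact_finite[of "cball (0::'a) 1"] by (auto simp: ennreal_mult_less_top)
    ultimately show ?thesis by simp
  qed
  finally show "(\<integral>\<^sup>+z. ennreal (norm ((\<epsilon>\<^sup>2 + z \<bullet> z) powr (- \<alpha>))) \<partial>(lborel :: 'a measure)) < \<infinity>" .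
qed measurable

lemma integrable_newton_density:
  assumes "\<epsilon> > 0"
  shows "integrable lborel (newton_density \<epsilon> :: 'a::euclidean_space \<Rightarrow> real)"
  unfolding newton_density_def[abs_def] minus_divide_left[symmetric]
  by (intro integrable_mult_right integrable_reg_powr assms) auto

text \<open>
  This fixes the normalisation of the Newton kernel. In polar coordinates the integrand has the
  primitive \<open>r\<^sup>d (\<epsilon>\<^sup>2 + r\<^sup>2)\<^bsup>-d/2\<^esup>\<close>, which increases from zero to one.
\<close>
lemma integral_newton_density:
  assumes "\<epsilon> > 0"
  shows "(\<integral>z. newton_density \<epsilon> (z::'a::euclidean_space) \<partial>lborel) = 1"
proof -
  let ?n = "real DIM('a)" and ?A = "sphere_area TYPE('a)"
  have A: "?A > 0" by (rule sphere_area_pos)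
  have "(\<integral>\<^sup>+z. ennreal (newton_density \<epsilon> (z::'a)) \<partial>lborel)
    = (\<integral>\<^sup>+z. ennreal (?n * \<epsilon>\<^sup>2 / ?A * (\<epsilon>\<^sup>2 + (norm (z::'a))\<^sup>2) powr (- (?n + 2) / 2)) \<partial>lborel)"
    by (simp add: newton_density_def power2_norm_eq_inner)
  also have "\<dots> = (\<integral>\<^sup>+r. ennreal (?n * \<epsilon>\<^sup>2 / ?A * (\<epsilon>\<^sup>2 + r\<^sup>2) powr (- (?n + 2) / 2)) *
      (ennreal (?A * r ^ (DIM('a) - 1)) * indicator {0..} r) \<partial>lborel)"
    by (rule nn_integral_radial[where h = "\<lambda>r. ennreal (?n * \<epsilon>\<^sup>2 / ?A * (\<epsilon>\<^sup>2 + r\<^sup>2) powr (- (?n + 2) / 2))"]) simp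
  also have "\<dots> = (\<integral>\<^sup>+r. ennreal (?n * \<epsilon>\<^sup>2 * r ^ (DIM('a) - 1) * (\<epsilon>\<^sup>2 + r\<^sup>2) powr (- (?n + 2) / 2)) * indicator {0..} r \<partial>lborel)"
  proof (rule nn_integral_cong)
    fix r :: real
    have "(?n * \<epsilon>\<^sup>2 / ?A * s) * (?A * t) = ?n * \<epsilon>\<^sup>2 * t * s" for s t :: real
      using A by simp
    then show "ennreal (?n * \<epsilon>\<^sup>2 / ?A * (\<epsilon>\<^sup>2 + r\<^sup>2) powr (- (?n + 2) / 2)) *
        (ennreal (?A * r ^ (DIM('a) - 1)) * indicator {0..} r) =
      ennreal (?n * \<epsilon>\<^sup>2 * r ^ (DIM('a) - 1) * (\<epsilon>\<^sup>2 + r\<^sup>2) powr (- (?n + 2) / 2)) * indicator {0..} r"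
      using A by (cases "r \<ge> 0") (simp_all add: ennreal_mult[symmetric])
  qed
  also have "\<dots> = ennreal (1 - 0 ^ DIM('a) * (\<epsilon>\<^sup>2 + 0\<^sup>2) powr (- ?n / 2))"
  proof (rule nn_integral_FTC_atLeast)
    fix r :: real assume r: "0 \<le> r"
    have s: "\<epsilon>\<^sup>2 + r\<^sup>2 > 0" using assms by (simp add: add_pos_nonneg)
    have e: "- ?n / 2 = 1 + - (?n + 2) / 2" by (simp add: field_simps)
    have sp: "(\<epsilon>\<^sup>2 + r\<^sup>2) powr (- ?n / 2) = (\<epsilon>\<^sup>2 + r\<^sup>2) * (\<epsilon>\<^sup>2 + r\<^sup>2) powr (- (?n + 2) / 2)"
      unfolding e powr_add using s by simp
    have rp: "r ^ DIM('a) = r * r ^ (DIM('a) - 1)" using power_minus_mult[of "DIM('a)" r] by (simp add: mult.commute)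
    have e1: "- ?n / 2 - 1 = - (?n + 2) / 2" by (simp add: field_simps)
    have "((\<lambda>r. (\<epsilon>\<^sup>2 + r\<^sup>2) powr (- ?n / 2)) has_real_derivative (- ?n / 2) * (\<epsilon>\<^sup>2 + r\<^sup>2) powr (- ?n / 2 - 1) * (2 * r)) (at r)"
      by (rule DERIV_chain2[where f = "\<lambda>s. s powr (- ?n / 2)" and g = "\<lambda>r. \<epsilon>\<^sup>2 + r\<^sup>2"], rule has_real_derivative_powr[OF s])
        (auto intro!: derivative_eq_intros)
    moreover have "((\<lambda>r. r ^ DIM('a)) has_real_derivative ?n * r ^ (DIM('a) - 1)) (at r)"
      by (auto intro!: derivative_eq_intros)
    ultimately have "((\<lambda>r. r ^ DIM('a) * (\<epsilon>\<^sup>2 + r\<^sup>2) powr (- ?n / 2)) has_real_derivative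
       (?n * r ^ (DIM('a) - 1)) * (\<epsilon>\<^sup>2 + r\<^sup>2) powr (- ?n / 2)
        + ((- ?n / 2) * (\<epsilon>\<^sup>2 + r\<^sup>2) powr (- ?n / 2 - 1) * (2 * r)) * r ^ DIM('a)) (at r)"
      by (rule DERIV_mult[rotated])
    then show "((\<lambda>r. r ^ DIM('a) * (\<epsilon>\<^sup>2 + r\<^sup>2) powr (- ?n / 2)) has_real_derivative
        ?n * \<epsilon>\<^sup>2 * r ^ (DIM('a) - 1) * (\<epsilon>\<^sup>2 + r\<^sup>2) powr (- (?n + 2) / 2)) (at r)"
      unfolding e1 sp rp by (rule DERIV_cong) (simp add: algebra_simps power2_eq_square)
  next
    have "((\<lambda>r::real. r\<^sup>2 / (\<epsilon>\<^sup>2 + r\<^sup>2)) \<longlongrightarrow> 1) at_top"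
    proof -
      have "((\<lambda>r::real. 1 - \<epsilon>\<^sup>2 * inverse (\<epsilon>\<^sup>2 + r\<^sup>2)) \<longlongrightarrow> 1 - \<epsilon>\<^sup>2 * 0) at_top"
        by (intro tendsto_intros tendsto_inverse_0_at_top filterlim_tendsto_add_at_top[OF tendsto_const] filterlim_pow_at_top filterlim_ident) auto
      moreover have "1 - \<epsilon>\<^sup>2 * inverse (\<epsilon>\<^sup>2 + r\<^sup>2) = r\<^sup>2 / (\<epsilon>\<^sup>2 + r\<^sup>2)" for r :: real
      proof -
        have "\<epsilon>\<^sup>2 + r\<^sup>2 > 0" using assms by (simp add: add_pos_nonneg)
        then show ?thesis using assms by (simp add: divide_simps)
      qed
      ultimately show ?thesis by simp
    qed
    then have "((\<lambda>r::real. (r\<^sup>2 / (\<epsilon>\<^sup>2 + r\<^sup>2)) powr (?n / 2)) \<longlongrightarrow> 1 powr (?n / 2)) at_top"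
      by (intro tendsto_powr tendsto_const) auto
    then have "((\<lambda>r::real. (r\<^sup>2 / (\<epsilon>\<^sup>2 + r\<^sup>2)) powr (?n / 2)) \<longlongrightarrow> 1) at_top" by simp
    then show "((\<lambda>r. r ^ DIM('a) * (\<epsilon>\<^sup>2 + r\<^sup>2) powr (- ?n / 2)) \<longlongrightarrow> 1) at_top"
    proof (rule Lim_transform_eventually)
      show "\<forall>\<^sub>F r in at_top. (r\<^sup>2 / (\<epsilon>\<^sup>2 + r\<^sup>2)) powr (?n / 2) = r ^ DIM('a) * (\<epsilon>\<^sup>2 + r\<^sup>2) powr (- ?n / 2)"
        using eventually_gt_at_top[of 0]
      proof eventually_elim
        fix r :: real assume r: "r > 0"
        have r2: "(r\<^sup>2) powr (?n / 2) = r ^ DIM('a)"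
        proof -
          have "r\<^sup>2 = r powr 2" using r by simp
          then have "(r\<^sup>2) powr (?n / 2) = r powr ?n" by (simp only: powr_powr) simp
          also have "\<dots> = r ^ DIM('a)" using r by (rule powr_realpow)
          finally show ?thesis .
        qed
        have "(r\<^sup>2 / (\<epsilon>\<^sup>2 + r\<^sup>2)) powr (?n / 2) = (r\<^sup>2) powr (?n / 2) / (\<epsilon>\<^sup>2 + r\<^sup>2) powr (?n / 2)"
          by (rule powr_divide)
        also have "\<dots> = r ^ DIM('a) * (\<epsilon>\<^sup>2 + r\<^sup>2) powr (- ?n / 2)"
          unfolding r2 divide_inverse[of "r ^ DIM('a)"] powr_minus[symmetric] minus_divide_left ..
        finally show "(r\<^sup>2 / (\<epsilon>\<^sup>2 + r\<^sup>2)) powr (?n / 2) = r ^ DIM('a) * (\<epsilon>\<^sup>2 + r\<^sup>2) powr (- ?n / 2)" .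
      qed
    qed
  qed (use assms in auto)
  finally have "(\<integral>\<^sup>+z. ennreal (newton_density \<epsilon> (z::'a)) \<partial>lborel) = 1" by simp
  then show ?thesis
    by (subst integral_eq_nn_integral) (auto simp: newton_density_nonneg)
qed

section \<open>Convolution identities for the regularised kernel\<close>

lemma integrable_inner_of_square_integrable:
  fixes f g :: "'a::euclidean_space \<Rightarrow> 'b::euclidean_space"
  assumes [measurable]: "f \<in> borel_measurable borel" "g \<in> borel_measurable borel"
    and f: "integrable lborel (\<lambda>x. (norm (f x))\<^sup>2)" and g: "integrable lborel (\<lambda>x. (norm (g x))\<^sup>2)"
  shows "integrable lborel (\<lambda>x. f x \<bullet> g x)"
proof (rule Bochner_Integration.integrable_bound[OF Bochner_Integration.integrable_add[OF f g]])
  have "\<bar>f x \<bullet> g x\<bar> \<le> (norm (f x))\<^sup>2 + (norm (g x))\<^sup>2" for x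
  proof -
    have "\<bar>f x \<bullet> g x\<bar> \<le> norm (f x) * norm (g x)" by (rule Cauchy_Schwarz_ineq2)
    moreover have "2 * (norm (f x) * norm (g x)) \<le> (norm (f x))\<^sup>2 + (norm (g x))\<^sup>2"
      using sum_squares_bound[of "norm (f x)" "norm (g x)"] by simp
    moreover have "norm (f x) * norm (g x) \<ge> 0" by simp
    ultimately show ?thesis by linarith
  qed
  then show "AE x in lborel. norm (f x \<bullet> g x) \<le> norm ((norm (f x))\<^sup>2 + (norm (g x))\<^sup>2)" by simp
qed measurable

text \<open>
  Square integrability at infinity requires \<open>2 (d-2) > d\<close>; this is where the dimension five comes in.
\<close>
lemma newton_reg_square_integrable:
  assumes "\<epsilon> > 0" "DIM('a::euclidean_space) \<ge> 5"
  shows "integrable lborel (\<lambda>z::'a. (norm (newton_reg \<epsilon> z))\<^sup>2)"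
proof -
  let ?n = "real DIM('a)"
  have "(norm (newton_reg \<epsilon> z))\<^sup>2 = (1 / ((?n - 2) * sphere_area TYPE('a)))\<^sup>2 * (\<epsilon>\<^sup>2 + z \<bullet> z) powr (- (?n - 2))" for z :: 'a
  proof -
    have "(2 - ?n) / 2 + (2 - ?n) / 2 = - (?n - 2)" by (simp add: field_simps)
    then have "((\<epsilon>\<^sup>2 + z \<bullet> z) powr ((2 - ?n) / 2))\<^sup>2 = (\<epsilon>\<^sup>2 + z \<bullet> z) powr (- (?n - 2))"
      by (simp only: power2_eq_square[of "_ powr _"] powr_add[symmetric])
    then show ?thesis
      unfolding newton_reg_def power_mult_distrib real_norm_def power2_abs by (simp only:)
  qed
  then show ?thesis
    using integrable_reg_powr[OF assms(1), where 'a='a and \<alpha> = "?n - 2"] assms(2) by simp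
qed

lemma norm_newton_field_le:
  fixes z :: "'a::euclidean_space"
  assumes "\<epsilon> > 0"
  shows "(norm (newton_field \<epsilon> z))\<^sup>2 \<le> (1 / sphere_area TYPE('a))\<^sup>2 * (\<epsilon>\<^sup>2 + z \<bullet> z) powr (- (real DIM('a) - 1))"
proof -
  let ?n = "real DIM('a)"
  let ?s = "\<epsilon>\<^sup>2 + z \<bullet> z"
  have s: "?s > 0" by (rule reg_pos[OF assms])
  have "(norm (newton_field \<epsilon> z))\<^sup>2 = (1 / sphere_area TYPE('a))\<^sup>2 * (?s powr (- ?n / 2))\<^sup>2 * (z \<bullet> z)"
    by (simp add: newton_field_def power_mult_distrib power2_norm_eq_inner power_divide)
  also have "(?s powr (- ?n / 2))\<^sup>2 = ?s powr (- ?n)"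
    by (simp add: power2_eq_square powr_add[symmetric])
  also have "(1 / sphere_area TYPE('a))\<^sup>2 * ?s powr (- ?n) * (z \<bullet> z) \<le> (1 / sphere_area TYPE('a))\<^sup>2 * ?s powr (- ?n) * ?s"
    by (intro mult_left_mono) auto
  also have "\<dots> = (1 / sphere_area TYPE('a))\<^sup>2 * ?s powr (- (?n - 1))"
  proof -
    have "- (?n - 1) = - ?n + 1" by simp
    then show ?thesis using s by (simp only: powr_add) simp
  qed
  finally show ?thesis .
qed

lemma newton_field_bounded:
  assumes "\<epsilon> > 0"
  obtains M where "\<And>z::'a::euclidean_space. norm (newton_field \<epsilon> z) \<le> M"
proof
  fix z :: 'a
  have "(norm (newton_field \<epsilon> z))\<^sup>2 \<le> (1 / sphere_area TYPE('a))\<^sup>2 * (\<epsilon>\<^sup>2 + z \<bullet> z) powr (- (real DIM('a) - 1))"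
    by (rule norm_newton_field_le[OF assms])
  also have "\<dots> \<le> (1 / sphere_area TYPE('a))\<^sup>2 * (\<epsilon>\<^sup>2) powr (- (real DIM('a) - 1))"
    using assms by (intro mult_left_mono powr_mono2') (auto simp: Suc_leI)
  finally show "norm (newton_field \<epsilon> z) \<le> sqrt ((1 / sphere_area TYPE('a))\<^sup>2 * (\<epsilon>\<^sup>2) powr (- (real DIM('a) - 1)))"
    by (rule real_le_rsqrt)
qed

lemma newton_field_square_integrable:
  assumes "\<epsilon> > 0" "DIM('a::euclidean_space) \<ge> 3"
  shows "integrable lborel (\<lambda>z::'a. (norm (newton_field \<epsilon> z))\<^sup>2)"
proof (rule Bochner_Integration.integrable_bound)
  let ?n = "real DIM('a)"
  show "integrable lborel (\<lambda>z::'a. (1 / sphere_area TYPE('a))\<^sup>2 * (\<epsilon>\<^sup>2 + z \<bullet> z) powr (- (?n - 1)))"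
    using integrable_reg_powr[OF assms(1), where 'a='a and \<alpha> = "?n - 1"] assms(2) by simp
  show "AE z in lborel. norm ((norm (newton_field \<epsilon> (z::'a)))\<^sup>2) \<le> norm ((1 / sphere_area TYPE('a))\<^sup>2 * (\<epsilon>\<^sup>2 + z \<bullet> z) powr (- (?n - 1)))"
    using norm_newton_field_le[OF assms(1), where 'a='a] by simp
qed measurable

lemma newton_field_deriv_square_integrable:
  assumes "\<epsilon> > 0" "(b::'a::euclidean_space) \<in> Basis"
  shows "integrable lborel (\<lambda>z::'a. (norm (newton_field_deriv \<epsilon> b z))\<^sup>2)"
proof (rule Bochner_Integration.integrable_bound)
  let ?n = "real DIM('a)" and ?A = "sphere_area TYPE('a)"
  have A: "?A > 0" by (rule sphere_area_pos)
  show "integrable lborel (\<lambda>z::'a. ((1 + ?n) / ?A)\<^sup>2 * (\<epsilon>\<^sup>2 + z \<bullet> z) powr (- ?n))"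
    using integrable_reg_powr[OF assms(1), where 'a='a and \<alpha> = ?n] by simp
  have "(norm (newton_field_deriv \<epsilon> b z))\<^sup>2 \<le> ((1 + ?n) / ?A)\<^sup>2 * (\<epsilon>\<^sup>2 + z \<bullet> z) powr (- ?n)" for z :: 'a
  proof -
    let ?s = "\<epsilon>\<^sup>2 + z \<bullet> z"
    have s: "?s > 0" by (rule reg_pos[OF assms(1)])
    define p where "p = ?s powr (- ?n / 2)"
    define r where "r = ?s powr (- (?n + 2) / 2)"
    have e: "- ?n / 2 = 1 + - (?n + 2) / 2" by (simp add: field_simps)
    have p: "p = ?s * r" unfolding p_def r_def e powr_add using s by simp
    have r0: "r \<ge> 0" by (simp add: r_def)
    have "(z \<bullet> b)\<^sup>2 \<le> z \<bullet> z"
      using Cauchy_Schwarz_ineq[of z b] assms(2) by simp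
    then have "(z \<bullet> b)\<^sup>2 \<le> ?s" by (smt (verit) zero_le_power2)
    then have "r * (z \<bullet> b)\<^sup>2 \<le> r * ?s" using r0 by (rule mult_left_mono)
    then have q: "r * (z \<bullet> b)\<^sup>2 \<le> p" "r * (z \<bullet> b)\<^sup>2 \<ge> 0" using r0 by (simp_all add: p mult.commute)
    have "?n * (r * (z \<bullet> b)\<^sup>2) \<le> ?n * p" "?n * (r * (z \<bullet> b)\<^sup>2) \<ge> 0"
      by (rule mult_left_mono[OF q(1)], simp) (rule mult_nonneg_nonneg[OF _ q(2)], simp)
    moreover have "(1 + ?n) * p = p + ?n * p" by (simp add: algebra_simps)
    ultimately have "\<bar>p - ?n * (r * (z \<bullet> b)\<^sup>2)\<bar> \<le> (1 + ?n) * p"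
      using q unfolding abs_le_iff by linarith
    then have "\<bar>1 / ?A * (p - ?n * (r * (z \<bullet> b)\<^sup>2))\<bar> \<le> (1 + ?n) / ?A * p"
      using A by (simp add: abs_mult divide_right_mono)
    moreover have "newton_field_deriv \<epsilon> b z = 1 / ?A * (p - ?n * (r * (z \<bullet> b)\<^sup>2))"
      using assms(2) by (simp add: newton_field_deriv_def p_def r_def mult.assoc)
    ultimately have "(norm (newton_field_deriv \<epsilon> b z))\<^sup>2 \<le> ((1 + ?n) / ?A * p)\<^sup>2"
      by (intro power_mono) auto
    also have "\<dots> = ((1 + ?n) / ?A)\<^sup>2 * ?s powr (- ?n)"
      unfolding power_mult_distrib by (simp add: p_def power2_eq_square[of "_ powr _"] powr_add[symmetric])
    finally show ?thesis .
  qed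
  then show "AE z in lborel. norm ((norm (newton_field_deriv \<epsilon> b (z::'a)))\<^sup>2) \<le> norm (((1 + ?n) / ?A)\<^sup>2 * (\<epsilon>\<^sup>2 + z \<bullet> z) powr (- ?n))"
    by simp
qed measurable

text \<open>
  Integration by parts against the regularised field, component by component. Every product that
  occurs is integrable because both factors are square integrable.
\<close>
lemma integral_gradient_inner_newton_field:
  fixes \<phi> :: "'a::euclidean_space \<Rightarrow> real" and g :: "'a \<Rightarrow> 'a"
  assumes \<epsilon>: "\<epsilon> > 0" and d: "DIM('a) \<ge> 3"
    and D: "\<And>y. (\<phi> has_derivative (\<lambda>h. g y \<bullet> h)) (at y)" and cg: "continuous_on UNIV g"
    and \<phi>2: "integrable lborel (\<lambda>y. (norm (\<phi> y))\<^sup>2)" and g2: "integrable lborel (\<lambda>y. (norm (g y))\<^sup>2)"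
  shows "(\<integral>y. g y \<bullet> newton_field \<epsilon> (x - y) \<partial>lborel) = (\<integral>y. \<phi> y * newton_density \<epsilon> (x - y) \<partial>lborel)"
proof -
  have c\<phi>: "continuous_on UNIV \<phi>"
    using D by (auto simp: continuous_on_eq_continuous_at intro: has_derivative_continuous)
  have [measurable]: "\<phi> \<in> borel_measurable borel" "g \<in> borel_measurable borel"
    using c\<phi> cg by (auto intro: borel_measurable_continuous_onI)
  let ?K = "\<lambda>y. newton_field \<epsilon> (x - y)"
  let ?J = "\<lambda>b y. newton_field_deriv \<epsilon> b (x - y)"
  have K2: "integrable lborel (\<lambda>y. (norm (?K y))\<^sup>2)"
    using integrable_lborel_reflect[OF newton_field_square_integrable[OF \<epsilon> d]] .
  have comp: "integrable lborel (\<lambda>y. (norm (f y \<bullet> b))\<^sup>2)"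
    if "integrable lborel (\<lambda>y. (norm (f y))\<^sup>2)" "b \<in> Basis" and [measurable]: "f \<in> borel_measurable borel" for f :: "'a \<Rightarrow> 'a" and b
    using that(1)
    by (rule Bochner_Integration.integrable_bound)
      (use Basis_le_norm[OF that(2)] in \<open>auto intro!: power_mono simp: power2_le_iff_abs_le simp del: power2_abs\<close>)
  have key: "(\<integral>y. (g y \<bullet> b) * (?K y \<bullet> b) \<partial>lborel) = (\<integral>y. \<phi> y * ?J b y \<partial>lborel)"
    and i1: "integrable lborel (\<lambda>y. (g y \<bullet> b) * (?K y \<bullet> b))"
    and i2: "integrable lborel (\<lambda>y. \<phi> y * ?J b y)" if b: "b \<in> Basis" for b
  proof -
    have J2: "integrable lborel (\<lambda>y. (norm (?J b y))\<^sup>2)"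
      using integrable_lborel_reflect[OF newton_field_deriv_square_integrable[OF \<epsilon> b]] .
    have i0: "integrable lborel (\<lambda>y. \<phi> y * (?K y \<bullet> b))"
      using integrable_inner_of_square_integrable[OF _ _ \<phi>2 comp[OF K2 b]] by simp
    show i1: "integrable lborel (\<lambda>y. (g y \<bullet> b) * (?K y \<bullet> b))"
      using integrable_inner_of_square_integrable[OF _ _ comp[OF g2 b] comp[OF K2 b]] by simp
    show i2: "integrable lborel (\<lambda>y. \<phi> y * ?J b y)"
      using integrable_inner_of_square_integrable[OF _ _ \<phi>2 J2] by simp
    have "(\<integral>y. (g y \<bullet> b) * (?K y \<bullet> b) - \<phi> y * ?J b y \<partial>lborel) = 0"
    proof (rule integral_directional_derivative_eq_0[where u = "\<lambda>y. \<phi> y * (?K y \<bullet> b)" and b = b])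
      show "continuous_on UNIV (\<lambda>y. (g y \<bullet> b) * (?K y \<bullet> b) - \<phi> y * ?J b y)"
        by (intro continuous_intros cg c\<phi> continuous_on_compose2[OF continuous_newton_field[OF \<epsilon>]]
            continuous_on_compose2[OF continuous_newton_field_deriv[OF \<epsilon>]]) auto
      fix y t
      let ?y = "y + t *\<^sub>R b"
      obtain D' where D': "((\<lambda>z. newton_field \<epsilon> z \<bullet> b) has_derivative D') (at (x - ?y))" "D' b = ?J b ?y"
        using has_derivative_newton_field[OF \<epsilon>, of b "x - ?y"] by blast
      have lin: "linear D'" using D'(1) by (rule has_derivative_linear)
      have "((\<lambda>y. x - y) has_derivative (\<lambda>h. - h)) (at ?y)" by (auto intro!: derivative_eq_intros)
      from has_derivative_compose[OF this D'(1)]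
      have "((\<lambda>y. \<phi> y * (?K y \<bullet> b)) has_derivative (\<lambda>h. \<phi> ?y * D' (- h) + (g ?y \<bullet> h) * (?K ?y \<bullet> b))) (at ?y)"
        by (intro has_derivative_mult D)
      moreover have "((\<lambda>t. y + t *\<^sub>R b) has_derivative (\<lambda>s. s *\<^sub>R b)) (at t)"
        by (auto intro!: derivative_eq_intros)
      ultimately have "((\<lambda>t. \<phi> (y + t *\<^sub>R b) * (?K (y + t *\<^sub>R b) \<bullet> b)) has_derivative
          (\<lambda>s. \<phi> ?y * D' (- (s *\<^sub>R b)) + (g ?y \<bullet> (s *\<^sub>R b)) * (?K ?y \<bullet> b))) (at t)"
        by (rule has_derivative_compose[rotated])
      moreover have "(\<lambda>s. \<phi> ?y * D' (- (s *\<^sub>R b)) + (g ?y \<bullet> (s *\<^sub>R b)) * (?K ?y \<bullet> b))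
         = (*) ((g ?y \<bullet> b) * (?K ?y \<bullet> b) - \<phi> ?y * ?J b ?y)"
        by (auto simp: linear_neg[OF lin] linear_scale[OF lin] D'(2) algebra_simps)
      ultimately show "((\<lambda>t. \<phi> (y + t *\<^sub>R b) * (?K (y + t *\<^sub>R b) \<bullet> b)) has_real_derivative
          (g ?y \<bullet> b) * (?K ?y \<bullet> b) - \<phi> ?y * ?J b ?y) (at t)"
        by (simp add: has_field_derivative_def)
    qed (use i0 i1 i2 in auto)
    then show "(\<integral>y. (g y \<bullet> b) * (?K y \<bullet> b) \<partial>lborel) = (\<integral>y. \<phi> y * ?J b y \<partial>lborel)"
      using i1 i2 by simp
  qed
  have "(\<integral>y. g y \<bullet> ?K y \<partial>lborel) = (\<Sum>b\<in>Basis. \<integral>y. (g y \<bullet> b) * (?K y \<bullet> b) \<partial>lborel)"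
  proof -
    have "(\<integral>y. g y \<bullet> ?K y \<partial>lborel) = (\<integral>y. (\<Sum>b\<in>Basis. (g y \<bullet> b) * (?K y \<bullet> b)) \<partial>lborel)"
      by (rule Bochner_Integration.integral_cong[OF refl]) (rule euclidean_inner)
    then show ?thesis using i1 by (simp only: Bochner_Integration.integral_sum)
  qed
  also have "\<dots> = (\<Sum>b\<in>Basis. \<integral>y. \<phi> y * ?J b y \<partial>lborel)" using key by (rule sum.cong[OF refl])
  also have "\<dots> = (\<integral>y. (\<Sum>b\<in>Basis. \<phi> y * ?J b y) \<partial>lborel)"
    using i2 by (rule Bochner_Integration.integral_sum[symmetric])
  also have "\<dots> = (\<integral>y. \<phi> y * newton_density \<epsilon> (x - y) \<partial>lborel)"
    unfolding sum_distrib_left[symmetric] sum_newton_field_deriv[OF \<epsilon>] ..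
  finally show ?thesis .
qed

text \<open>
  The densities are the dilations of one fixed probability density.
\<close>
lemma newton_density_scale:
  assumes "\<epsilon> > 0"
  shows "\<epsilon> ^ DIM('a) * newton_density \<epsilon> (\<epsilon> *\<^sub>R z) = newton_density 1 (z :: 'a::euclidean_space)"
proof -
  let ?n = "real DIM('a)"
  have "\<epsilon>\<^sup>2 + (\<epsilon> *\<^sub>R z) \<bullet> (\<epsilon> *\<^sub>R z) = \<epsilon>\<^sup>2 * (1\<^sup>2 + z \<bullet> z)"
    by (simp add: algebra_simps power2_eq_square)
  moreover have "(\<epsilon>\<^sup>2 * (1\<^sup>2 + z \<bullet> z)) powr (- (?n + 2) / 2) = (\<epsilon>\<^sup>2) powr (- (?n + 2) / 2) * (1\<^sup>2 + z \<bullet> z) powr (- (?n + 2) / 2)"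
    by (rule powr_mult)
  moreover have "\<epsilon> ^ DIM('a) * (\<epsilon>\<^sup>2 * (\<epsilon>\<^sup>2) powr (- (?n + 2) / 2)) = 1"
  proof -
    have "\<epsilon>\<^sup>2 = \<epsilon> powr 2" "\<epsilon> ^ DIM('a) = \<epsilon> powr ?n" using assms by (simp_all add: powr_realpow)
    then have "\<epsilon> ^ DIM('a) * (\<epsilon>\<^sup>2 * (\<epsilon>\<^sup>2) powr (- (?n + 2) / 2)) = \<epsilon> powr (?n + (2 + 2 * (- (?n + 2) / 2)))"
      by (simp only: powr_powr powr_add)
    also have "?n + (2 + 2 * (- (?n + 2) / 2)) = 0" by (simp add: field_simps)
    finally show ?thesis using assms by simp
  qed
  ultimately have "\<epsilon> ^ DIM('a) * newton_density \<epsilon> (\<epsilon> *\<^sub>R z) =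
     (\<epsilon> ^ DIM('a) * (\<epsilon>\<^sup>2 * (\<epsilon>\<^sup>2) powr (- (?n + 2) / 2))) * (?n / sphere_area TYPE('a) * (1\<^sup>2 + z \<bullet> z) powr (- (?n + 2) / 2))"
    unfolding newton_density_def by (simp add: mult_ac)
  also have "\<dots> = newton_density 1 z"
    unfolding \<open>\<epsilon> ^ DIM('a) * (\<epsilon>\<^sup>2 * (\<epsilon>\<^sup>2) powr (- (?n + 2) / 2)) = 1\<close> by (simp add: newton_density_def)
  finally show ?thesis .
qed

lemma integral_newton_density_rescale:
  fixes \<phi> :: "'a::euclidean_space \<Rightarrow> real"
  assumes \<epsilon>: "\<epsilon> > 0" and [measurable]: "\<phi> \<in> borel_measurable borel"
  shows "(\<integral>y. \<phi> y * newton_density \<epsilon> (x - y) \<partial>lborel) = (\<integral>z. \<phi> (x - \<epsilon> *\<^sub>R z) * newton_density 1 z \<partial>lborel)"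
proof -
  have "(\<integral>y. \<phi> y * newton_density \<epsilon> (x - y) \<partial>lborel) = (\<integral>z. \<phi> (x - z) * newton_density \<epsilon> z \<partial>lborel)"
    using integral_lborel_reflect[of "\<lambda>z. \<phi> (x - z) * newton_density \<epsilon> z" x] by simp
  also have "\<dots> = (\<integral>z. \<phi> (x - z) * newton_density \<epsilon> z \<partial>density (distr lborel borel (\<lambda>z. 0 + \<epsilon> *\<^sub>R z)) (\<lambda>_. ennreal (\<bar>\<epsilon>\<bar> ^ DIM('a))))"
    using lborel_affine[of \<epsilon> "0::'a"] \<epsilon> by simp
  also have "\<dots> = (\<integral>z. \<epsilon> ^ DIM('a) *\<^sub>R (\<phi> (x - \<epsilon> *\<^sub>R z) * newton_density \<epsilon> (\<epsilon> *\<^sub>R z)) \<partial>lborel)"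
    using \<epsilon> by (subst integral_density) (auto simp: integral_distr)
  also have "\<dots> = (\<integral>z. \<phi> (x - \<epsilon> *\<^sub>R z) * newton_density 1 z \<partial>lborel)"
    unfolding newton_density_scale[OF \<epsilon>, symmetric] by (simp add: mult_ac)
  finally show ?thesis .
qed

lemma newton_density_approximate_identity:
  fixes \<phi> :: "'a::euclidean_space \<Rightarrow> real" and e :: "nat \<Rightarrow> real"
  assumes c: "continuous_on UNIV \<phi>" and B: "\<And>y. \<bar>\<phi> y\<bar> \<le> B" and e: "\<And>k. e k > 0" "e \<longlonglongrightarrow> 0"
  shows "(\<lambda>k. \<integral>y. \<phi> y * newton_density (e k) (x - y) \<partial>lborel) \<longlonglongrightarrow> \<phi> x"
proof -
  have [measurable]: "\<phi> \<in> borel_measurable borel" using c by (rule borel_measurable_continuous_onI)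
  have "(\<lambda>k. \<integral>z. \<phi> (x - e k *\<^sub>R z) * newton_density 1 z \<partial>lborel) \<longlonglongrightarrow> (\<integral>z. \<phi> x * newton_density 1 (z::'a) \<partial>lborel)"
  proof (rule integral_dominated_convergence[where w = "\<lambda>z::'a. B * newton_density 1 z"])
    show "integrable lborel (\<lambda>z. B * newton_density 1 (z::'a))"
      by (intro integrable_mult_right integrable_newton_density) simp
    have "(\<lambda>k. \<phi> (x - e k *\<^sub>R z)) \<longlonglongrightarrow> \<phi> x" for z
    proof -
      have "(\<lambda>k. x - e k *\<^sub>R z) \<longlonglongrightarrow> x - 0 *\<^sub>R z" by (intro tendsto_intros e)
      then have "(\<lambda>k. x - e k *\<^sub>R z) \<longlonglongrightarrow> x" by simp
      moreover have "isCont \<phi> x" using c by (simp add: continuous_on_eq_continuous_at)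
      ultimately show ?thesis by (rule isCont_tendsto_compose[rotated])
    qed
    then show "AE z in lborel. (\<lambda>k. \<phi> (x - e k *\<^sub>R z) * newton_density 1 z) \<longlonglongrightarrow> \<phi> x * newton_density 1 z"
      by (auto intro!: tendsto_intros)
    show "AE z in lborel. norm (\<phi> (x - e k *\<^sub>R z) * newton_density 1 z) \<le> B * newton_density 1 z" for k
      using B by (auto simp: abs_mult newton_density_nonneg intro!: mult_right_mono)
  qed measurable
  then show ?thesis
    by (simp add: integral_newton_density_rescale[OF e(1)] integral_newton_density)
qed

lemma newton_reg_antimono:
  fixes z :: "'a::euclidean_space"
  assumes "0 < \<epsilon>" "\<epsilon> \<le> \<delta>" "DIM('a) \<ge> 3"
  shows "newton_reg \<delta> z \<le> newton_reg \<epsilon> z"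
  unfolding newton_reg_def
proof (intro mult_left_mono)
  have "\<epsilon>\<^sup>2 \<le> \<delta>\<^sup>2" using assms by (intro power_mono) auto
  then show "(\<delta>\<^sup>2 + z \<bullet> z) powr ((2 - real DIM('a)) / 2) \<le> (\<epsilon>\<^sup>2 + z \<bullet> z) powr ((2 - real DIM('a)) / 2)"
    using assms reg_pos[of \<epsilon> z] by (intro powr_mono2') auto
qed (use assms sphere_area_pos[where 'a='a] in auto)

lemma newton_reg_nonneg: "DIM('a) \<ge> 3 \<Longrightarrow> newton_reg \<epsilon> (z::'a::euclidean_space) \<ge> 0"
  using sphere_area_pos[where 'a='a] by (simp add: newton_reg_def)

lemma newton_reg_le_0:
  fixes z :: "'a::euclidean_space"
  assumes "0 < \<epsilon>" "DIM('a) \<ge> 3"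
  shows "newton_reg \<epsilon> z \<le> newton_reg \<epsilon> (0::'a)"
  unfolding newton_reg_def
proof (intro mult_left_mono)
  show "(\<epsilon>\<^sup>2 + z \<bullet> z) powr ((2 - real DIM('a)) / 2) \<le> (\<epsilon>\<^sup>2 + 0 \<bullet> (0::'a)) powr ((2 - real DIM('a)) / 2)"
    using assms by (intro powr_mono2') auto
qed (use assms sphere_area_pos[where 'a='a] in auto)

lemma newton_reg_le_kernel:
  fixes z :: "'a::euclidean_space"
  assumes "0 < \<epsilon>" "DIM('a) \<ge> 3" "z \<noteq> 0"
  shows "newton_reg \<epsilon> z \<le> newton_kernel z"
proof -
  let ?n = "real DIM('a)"
  have "(\<epsilon>\<^sup>2 + z \<bullet> z) powr ((2 - ?n) / 2) \<le> (norm z powr 2) powr ((2 - ?n) / 2)"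
    using assms by (intro powr_mono2') (auto simp: power2_norm_eq_inner)
  also have "\<dots> = norm z powr (2 - ?n)"
  proof -
    have "2 * ((2 - ?n) / 2) = 2 - ?n" by simp
    then show ?thesis by (simp only: powr_powr)
  qed
  finally have "1 / ((?n - 2) * sphere_area TYPE('a)) * (\<epsilon>\<^sup>2 + z \<bullet> z) powr ((2 - ?n) / 2)
      \<le> 1 / ((?n - 2) * sphere_area TYPE('a)) * norm z powr (2 - ?n)"
    using assms sphere_area_pos[where 'a='a] by (intro mult_left_mono) auto
  moreover have "1 / (?n - 2) * inverse (sphere_area TYPE('a)) = 1 / ((?n - 2) * sphere_area TYPE('a))"
    by (simp only: divide_inverse inverse_mult_distrib mult_1)
  ultimately show ?thesis unfolding newton_reg_def newton_kernel_def by (simp only:)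
qed

lemma newton_field_inner_eq:
  fixes x x' :: "'a::euclidean_space"
  assumes "\<epsilon> > 0" "\<delta> > 0" "DIM('a) \<ge> 5"
  shows "(\<integral>y. newton_field \<delta> (x' - y) \<bullet> newton_field \<epsilon> (x - y) \<partial>lborel)
    = (\<integral>y. newton_reg \<delta> (x' - y) * newton_density \<epsilon> (x - y) \<partial>lborel)"
proof (rule integral_gradient_inner_newton_field)
  show d3: "DIM('a) \<ge> 3" using assms(3) by simp
  show "((\<lambda>y. newton_reg \<delta> (x' - y)) has_derivative (\<lambda>h. newton_field \<delta> (x' - y) \<bullet> h)) (at y)" for y
  proof -
    have "((\<lambda>y. x' - y) has_derivative (\<lambda>h. - h)) (at y)" by (auto intro!: derivative_eq_intros)
    from has_derivative_compose[OF this has_derivative_newton_reg[OF assms(2) d3]]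
    show ?thesis by simp
  qed
  show "continuous_on UNIV (\<lambda>y. newton_field \<delta> (x' - y))"
    by (rule continuous_on_compose2[OF continuous_newton_field[OF assms(2)]]) (auto intro!: continuous_intros)
  show "integrable lborel (\<lambda>y. (norm (newton_reg \<delta> (x' - y)))\<^sup>2)"
    using integrable_lborel_reflect[OF newton_reg_square_integrable[OF assms(2,3)]] .
  show "integrable lborel (\<lambda>y. (norm (newton_field \<delta> (x' - y)))\<^sup>2)"
    using integrable_lborel_reflect[OF newton_field_square_integrable[OF assms(2) d3]] .
qed (fact assms(1))

lemma integrable_newton_reg_density:
  fixes x x' :: "'a::euclidean_space"
  assumes "\<epsilon> > 0" "\<delta> > 0" "DIM('a) \<ge> 3"
  shows "integrable lborel (\<lambda>y. newton_reg \<delta> (x' - y) * newton_density \<epsilon> (x - y))"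
proof (rule Bochner_Integration.integrable_bound)
  show "integrable lborel (\<lambda>y. newton_reg \<delta> (0::'a) * newton_density \<epsilon> (x - y))"
    by (intro integrable_mult_right integrable_lborel_reflect integrable_newton_density assms)
  show "AE y in lborel. norm (newton_reg \<delta> (x' - y) * newton_density \<epsilon> (x - y)) \<le> norm (newton_reg \<delta> (0::'a) * newton_density \<epsilon> (x - y))"
    using newton_reg_le_0[OF assms(2,3)] newton_reg_nonneg[OF assms(3)]
    by (auto simp: abs_mult newton_density_nonneg intro!: mult_right_mono)
qed measurable

text \<open>
  Denote the densities by \<open>\<eta>\<^sub>\<epsilon>\<close>. The integral on the left is the convolution
  \<open>\<eta>\<^sub>\<delta> * G\<^sub>\<delta>\<close>. As \<open>G\<^sub>\<epsilon>\<close> increases when \<open>\<epsilon>\<close> decreases, it is at most \<open>\<eta>\<^sub>\<delta> * G\<^sub>\<epsilon>\<close> for \<open>\<epsilon> \<le> \<delta>\<close>.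
  Both convolutions \<open>\<eta>\<^sub>\<delta> * G\<^sub>\<epsilon>\<close> and \<open>\<eta>\<^sub>\<epsilon> * G\<^sub>\<delta>\<close> arise from the same inner product of fields by integrating
  by parts in one factor or the other, so they agree, and the second tends to \<open>G\<^sub>\<delta>\<close> as \<open>\<epsilon> \<rightarrow> 0\<close>.
  In this way the sharp bound is obtained without computing any convolution.
\<close>
lemma newton_field_inner_le:
  fixes x x' :: "'a::euclidean_space"
  assumes \<delta>: "\<delta> > 0" and d: "DIM('a) \<ge> 5"
  shows "(\<integral>y. newton_field \<delta> (x' - y) \<bullet> newton_field \<delta> (x - y) \<partial>lborel) \<le> newton_reg \<delta> (x - x')"
proof -
  define e where "e k = \<delta> / real (Suc k)" for k
  have e: "e k > 0" "e k \<le> \<delta>" for k using \<delta> by (simp_all add: e_def field_simps)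
  have e0: "e \<longlonglongrightarrow> 0"
    unfolding e_def by (intro LIMSEQ_Suc[OF lim_const_over_n])
  have d3: "DIM('a) \<ge> 3" using d by simp
  have "(\<integral>y. newton_field \<delta> (x' - y) \<bullet> newton_field \<delta> (x - y) \<partial>lborel)
      \<le> (\<integral>y. newton_reg \<delta> (x - y) * newton_density (e k) (x' - y) \<partial>lborel)" for k
  proof -
    have "(\<integral>y. newton_field \<delta> (x' - y) \<bullet> newton_field \<delta> (x - y) \<partial>lborel)
        = (\<integral>y. newton_reg \<delta> (x' - y) * newton_density \<delta> (x - y) \<partial>lborel)"
      by (rule newton_field_inner_eq[OF \<delta> \<delta> d])
    also have "\<dots> \<le> (\<integral>y. newton_reg (e k) (x' - y) * newton_density \<delta> (x - y) \<partial>lborel)"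
      by (intro integral_mono integrable_newton_reg_density mult_right_mono newton_reg_antimono)
         (use e d3 \<delta> in \<open>auto simp: newton_density_nonneg\<close>)
    also have "\<dots> = (\<integral>y. newton_field (e k) (x' - y) \<bullet> newton_field \<delta> (x - y) \<partial>lborel)"
      by (rule newton_field_inner_eq[OF \<delta> e(1) d, symmetric])
    also have "\<dots> = (\<integral>y. newton_field \<delta> (x - y) \<bullet> newton_field (e k) (x' - y) \<partial>lborel)"
      by (simp add: inner_commute)
    also have "\<dots> = (\<integral>y. newton_reg \<delta> (x - y) * newton_density (e k) (x' - y) \<partial>lborel)"
      by (rule newton_field_inner_eq[OF e(1) \<delta> d])
    finally show ?thesis .
  qed
  moreover have "(\<lambda>k. \<integral>y. newton_reg \<delta> (x - y) * newton_density (e k) (x' - y) \<partial>lborel) \<longlonglongrightarrow> newton_reg \<delta> (x - x')"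
  proof (rule newton_density_approximate_identity[where B = "newton_reg \<delta> (0::'a)"])
    show "continuous_on UNIV (\<lambda>y. newton_reg \<delta> (x - y))"
      by (rule continuous_on_compose2[OF continuous_newton_reg[OF \<delta>]]) (auto intro!: continuous_intros)
    show "\<bar>newton_reg \<delta> (x - y)\<bar> \<le> newton_reg \<delta> (0::'a)" for y
      using newton_reg_le_0[OF \<delta> d3] newton_reg_nonneg[OF d3] by simp
  qed (use e e0 in auto)
  ultimately show ?thesis by (intro LIMSEQ_le_const) auto
qed

section \<open>Duality for integrable densities\<close>

definition newton_energy :: "('a::euclidean_space \<Rightarrow> real) \<Rightarrow> ennreal" where
  "newton_energy f = (\<integral>\<^sup>+x. \<integral>\<^sup>+y. ennreal (f x * f y * newton_kernel (x - y)) \<partial>lborel \<partial>lborel)"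

text \<open>
  The gradient of the regularised potential \<open>y \<mapsto> \<integral> f x G\<^sub>\<delta> (x - y) dx\<close>: the field is \<open>-\<nabla>G\<^sub>\<delta>\<close>, and
  differentiating in \<open>y\<close> changes the sign once more.
\<close>
definition potential_field :: "real \<Rightarrow> ('a::euclidean_space \<Rightarrow> real) \<Rightarrow> 'a \<Rightarrow> 'a" where
  "potential_field \<delta> f y = (\<integral>x. f x *\<^sub>R newton_field \<delta> (x - y) \<partial>lborel)"

lemma borel_potential_field [measurable]:
  fixes f :: "'a::euclidean_space \<Rightarrow> real"
  assumes [measurable]: "f \<in> borel_measurable borel"
  shows "potential_field \<delta> f \<in> borel_measurable borel"
  unfolding potential_field_def[abs_def] by measurable

lemma ennreal_integral_le_nn_integral:
  fixes g :: "'a \<Rightarrow> real"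
  assumes "\<And>x. g x \<ge> 0"
  shows "ennreal (\<integral>x. g x \<partial>M) \<le> (\<integral>\<^sup>+x. ennreal (g x) \<partial>M)"
  using assms by (cases "integrable M g") (auto simp: nn_integral_eq_integral not_integrable_integral_eq)

lemma integrable_scaleR_newton_field:
  fixes f :: "'a::euclidean_space \<Rightarrow> real"
  assumes "\<delta> > 0" and f: "integrable lborel f"
  shows "integrable lborel (\<lambda>x. f x *\<^sub>R newton_field \<delta> (x - y))"
proof -
  obtain M where M: "\<And>z::'a. norm (newton_field \<delta> z) \<le> M" using newton_field_bounded[OF assms(1), where 'a='a] by blast
  have [measurable]: "f \<in> borel_measurable borel" using f by simp
  show ?thesis
  proof (rule Bochner_Integration.integrable_bound[where f = "\<lambda>x. M *\<^sub>R f x"])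
    show "AE x in lborel. norm (f x *\<^sub>R newton_field \<delta> (x - y)) \<le> norm (M *\<^sub>R f x)"
    proof (rule AE_I2)
      fix x
      have "\<bar>f x\<bar> * norm (newton_field \<delta> (x - y)) \<le> \<bar>f x\<bar> * \<bar>M\<bar>"
        using M[of "x - y"] by (intro mult_left_mono) auto
      then show "norm (f x *\<^sub>R newton_field \<delta> (x - y)) \<le> norm (M *\<^sub>R f x)"
        by (simp add: abs_mult mult.commute)
    qed
  qed (use f in \<open>auto\<close>)
qed

text \<open>
  Fubini. It is used with three choices of \<open>h\<close>: the gradient of the test function, the potential field
  itself, and a translate of the regularised field.
\<close>
lemma integral_potential_field_inner:
  fixes f :: "'a::euclidean_space \<Rightarrow> real" and h :: "'a \<Rightarrow> 'a"
  assumes \<delta>: "\<delta> > 0" and d: "DIM('a) \<ge> 3" and f: "integrable lborel f"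
    and [measurable]: "h \<in> borel_measurable borel" and h2: "integrable lborel (\<lambda>y. (norm (h y))\<^sup>2)"
  shows "(\<integral>y. potential_field \<delta> f y \<bullet> h y \<partial>lborel)
    = (\<integral>x. f x * (\<integral>y. newton_field \<delta> (x - y) \<bullet> h y \<partial>lborel) \<partial>lborel)"
proof -
  have [measurable]: "f \<in> borel_measurable borel" using f by simp
  let ?K = "\<lambda>x y::'a. newton_field \<delta> (x - y)"
  have K2: "integrable lborel (\<lambda>y. (norm (?K x y))\<^sup>2)" for x
    using integrable_lborel_reflect[OF newton_field_square_integrable[OF \<delta> d]] .
  have Kh: "integrable lborel (\<lambda>y. ?K x y \<bullet> h y)" for x
    by (rule integrable_inner_of_square_integrable[OF _ _ K2 h2]) measurable
  define C where "C = (\<integral>z. (norm (newton_field \<delta> (z::'a)))\<^sup>2 \<partial>lborel) + (\<integral>y. (norm (h y))\<^sup>2 \<partial>lborel)"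
  have Kh_le: "(\<integral>y. \<bar>?K x y \<bullet> h y\<bar> \<partial>lborel) \<le> C" for x
  proof -
    have "(\<integral>y. \<bar>?K x y \<bullet> h y\<bar> \<partial>lborel) \<le> (\<integral>y. (norm (?K x y))\<^sup>2 + (norm (h y))\<^sup>2 \<partial>lborel)"
    proof (rule integral_mono)
      show "\<bar>?K x y \<bullet> h y\<bar> \<le> (norm (?K x y))\<^sup>2 + (norm (h y))\<^sup>2" for y
      proof -
        have "\<bar>?K x y \<bullet> h y\<bar> \<le> norm (?K x y) * norm (h y)" by (rule Cauchy_Schwarz_ineq2)
        moreover have "2 * (norm (?K x y) * norm (h y)) \<le> (norm (?K x y))\<^sup>2 + (norm (h y))\<^sup>2"
          using sum_squares_bound[of "norm (?K x y)" "norm (h y)"] by simp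
        moreover have "norm (?K x y) * norm (h y) \<ge> 0" by simp
        ultimately show ?thesis by linarith
      qed
    qed (use Kh K2 h2 in auto)
    also have "\<dots> = (\<integral>y. (norm (?K x y))\<^sup>2 \<partial>lborel) + (\<integral>y. (norm (h y))\<^sup>2 \<partial>lborel)"
      by (rule Bochner_Integration.integral_add[OF K2 h2])
    also have "(\<integral>y. (norm (?K x y))\<^sup>2 \<partial>lborel) = (\<integral>z. (norm (newton_field \<delta> (z::'a)))\<^sup>2 \<partial>lborel)"
      by (rule integral_lborel_reflect) measurable
    finally show ?thesis by (simp add: C_def)
  qed
  have int: "integrable (lborel \<Otimes>\<^sub>M lborel) (\<lambda>(x, y). f x * (?K x y \<bullet> h y))"
  proof (rule lborel_pair.Fubini_integrable)
    show "integrable lborel (\<lambda>x. \<integral>y. norm (case (x, y) of (x, y) \<Rightarrow> f x * (?K x y \<bullet> h y)) \<partial>lborel)"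
    proof (rule Bochner_Integration.integrable_bound[where f = "\<lambda>x. C * f x"])
      show "AE x in lborel. norm (\<integral>y. norm (case (x, y) of (x, y) \<Rightarrow> f x * (?K x y \<bullet> h y)) \<partial>lborel) \<le> norm (C * f x)"
      proof (rule AE_I2)
        fix x
        have "(\<integral>y. norm (case (x, y) of (x, y) \<Rightarrow> f x * (?K x y \<bullet> h y)) \<partial>lborel) = \<bar>f x\<bar> * (\<integral>y. \<bar>?K x y \<bullet> h y\<bar> \<partial>lborel)"
          by (simp add: abs_mult)
        also have "\<dots> \<le> \<bar>f x\<bar> * C" by (intro mult_left_mono Kh_le) auto
        also have "\<dots> \<le> norm (C * f x)" by (simp add: abs_mult mult.commute mult_right_mono)
        finally show "norm (\<integral>y. norm (case (x, y) of (x, y) \<Rightarrow> f x * (?K x y \<bullet> h y)) \<partial>lborel) \<le> norm (C * f x)"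
          by (simp add: integral_nonneg_AE)
      qed
    qed (use f in auto)
    show "AE x in lborel. integrable lborel (\<lambda>y. case (x, y) of (x, y) \<Rightarrow> f x * (?K x y \<bullet> h y))"
      using Kh by auto
  qed measurable
  have "(\<integral>y. potential_field \<delta> f y \<bullet> h y \<partial>lborel) = (\<integral>y. \<integral>x. f x * (?K x y \<bullet> h y) \<partial>lborel \<partial>lborel)"
  proof (rule Bochner_Integration.integral_cong[OF refl])
    fix y
    have "(\<integral>x. (f x *\<^sub>R ?K x y) \<bullet> h y \<partial>lborel) = potential_field \<delta> f y \<bullet> h y"
      unfolding potential_field_def
      by (rule integral_inner_left) (rule integrable_scaleR_newton_field[OF \<delta> f])
    then show "potential_field \<delta> f y \<bullet> h y = (\<integral>x. f x * (?K x y \<bullet> h y) \<partial>lborel)" by simp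
  qed
  also have "\<dots> = (\<integral>x. \<integral>y. f x * (?K x y \<bullet> h y) \<partial>lborel \<partial>lborel)"
    using lborel_pair.Fubini_integral[OF int] by simp
  also have "\<dots> = (\<integral>x. f x * (\<integral>y. ?K x y \<bullet> h y \<partial>lborel) \<partial>lborel)" by simp
  finally show ?thesis .
qed

text \<open>
  The Cauchy-Schwarz inequality with weight \<open>f\<close> bounds the square of the field by the mass of \<open>f\<close> times
  the convolution of \<open>f\<close> with an integrable function.
\<close>
lemma potential_field_square_integrable:
  fixes f :: "'a::euclidean_space \<Rightarrow> real"
  assumes \<delta>: "\<delta> > 0" and d: "DIM('a) \<ge> 3" and f: "integrable lborel f" and f0: "\<And>x. f x \<ge> 0"
  shows "integrable lborel (\<lambda>y. (norm (potential_field \<delta> f y))\<^sup>2)"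
proof (rule integrableI_bounded)
  have [measurable]: "f \<in> borel_measurable borel" using f by simp
  show "(\<lambda>y. (norm (potential_field \<delta> f y))\<^sup>2) \<in> borel_measurable lborel" by measurable
  let ?k = "\<lambda>z::'a. norm (newton_field \<delta> z)"
  have pt: "ennreal (norm ((norm (potential_field \<delta> f y))\<^sup>2)) \<le> (\<integral>\<^sup>+x. ennreal (f x) \<partial>lborel) * (\<integral>\<^sup>+x. ennreal (f x * (?k (x - y))\<^sup>2) \<partial>lborel)" for y
  proof -
    have "norm (potential_field \<delta> f y) \<le> (\<integral>x. f x * ?k (x - y) \<partial>lborel)"
      unfolding potential_field_def
      using integral_norm_bound[of lborel "\<lambda>x. f x *\<^sub>R newton_field \<delta> (x - y)"] f0 by simp
    then have "ennreal (norm (potential_field \<delta> f y)) \<le> (\<integral>\<^sup>+x. ennreal (f x * ?k (x - y)) \<partial>lborel)"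
      using ennreal_integral_le_nn_integral[of "\<lambda>x. f x * ?k (x - y)" lborel] f0
      by (meson ennreal_leI mult_nonneg_nonneg norm_ge_zero order_trans)
    also have "\<dots> = (\<integral>\<^sup>+x. ennreal (sqrt (f x)) * ennreal (sqrt (f x) * ?k (x - y)) \<partial>lborel)"
      using f0 by (intro nn_integral_cong) (simp add: ennreal_mult[symmetric] mult.assoc[symmetric])
    finally have "(ennreal (norm (potential_field \<delta> f y)))\<^sup>2 \<le> (\<integral>\<^sup>+x. ennreal (sqrt (f x)) * ennreal (sqrt (f x) * ?k (x - y)) \<partial>lborel)\<^sup>2"
      by (rule power_mono) simp
    also have "\<dots> \<le> (\<integral>\<^sup>+x. (ennreal (sqrt (f x)))\<^sup>2 \<partial>lborel) * (\<integral>\<^sup>+x. (ennreal (sqrt (f x) * ?k (x - y)))\<^sup>2 \<partial>lborel)"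
      by (rule Cauchy_Schwarz_nn_integral) measurable
    finally show ?thesis
      using f0 by (simp add: ennreal_power power_mult_distrib)
  qed
  have "(\<integral>\<^sup>+y. ennreal (norm ((norm (potential_field \<delta> f y))\<^sup>2)) \<partial>lborel)
      \<le> (\<integral>\<^sup>+y. (\<integral>\<^sup>+x. ennreal (f x) \<partial>lborel) * (\<integral>\<^sup>+x. ennreal (f x * (?k (x - y))\<^sup>2) \<partial>lborel) \<partial>lborel)"
    by (intro nn_integral_mono pt)
  also have "\<dots> = (\<integral>\<^sup>+x. ennreal (f x) \<partial>lborel) * (\<integral>\<^sup>+y. \<integral>\<^sup>+x. ennreal (f x * (?k (x - y))\<^sup>2) \<partial>lborel \<partial>lborel)"
    by (rule nn_integral_cmult) measurable
  also have "(\<integral>\<^sup>+y. \<integral>\<^sup>+x. ennreal (f x * (?k (x - y))\<^sup>2) \<partial>lborel \<partial>lborel) = (\<integral>\<^sup>+x. \<integral>\<^sup>+y. ennreal (f x * (?k (x - y))\<^sup>2) \<partial>lborel \<partial>lborel)"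
    by (rule lborel_pair.Fubini') measurable
  also have "\<dots> = (\<integral>\<^sup>+x. ennreal (f x) * (\<integral>\<^sup>+z. ennreal ((?k z)\<^sup>2) \<partial>lborel) \<partial>lborel)"
  proof (rule nn_integral_cong)
    fix x
    have "(\<integral>\<^sup>+y. ennreal (f x * (?k (x - y))\<^sup>2) \<partial>lborel) = ennreal (f x) * (\<integral>\<^sup>+y. ennreal ((?k (x - y))\<^sup>2) \<partial>lborel)"
      using f0 by (simp add: ennreal_mult nn_integral_cmult)
    also have "(\<integral>\<^sup>+y. ennreal ((?k (x - y))\<^sup>2) \<partial>lborel) = (\<integral>\<^sup>+z. ennreal ((?k z)\<^sup>2) \<partial>lborel)"
      by (rule nn_integral_lborel_reflect[where h = "\<lambda>z. ennreal ((?k z)\<^sup>2)"]) measurable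
    finally show "(\<integral>\<^sup>+y. ennreal (f x * (?k (x - y))\<^sup>2) \<partial>lborel) = ennreal (f x) * (\<integral>\<^sup>+z. ennreal ((?k z)\<^sup>2) \<partial>lborel)" .
  qed
  also have "\<dots> = (\<integral>\<^sup>+x. ennreal (f x) \<partial>lborel) * (\<integral>\<^sup>+z. ennreal ((?k z)\<^sup>2) \<partial>lborel)"
    by (rule nn_integral_multc) measurable
  also have "(\<integral>\<^sup>+x. ennreal (f x) \<partial>lborel) = ennreal (\<integral>x. f x \<partial>lborel)"
    using f f0 by (intro nn_integral_eq_integral) auto
  also have "(\<integral>\<^sup>+z. ennreal ((?k z)\<^sup>2) \<partial>lborel) = ennreal (\<integral>z. (?k z)\<^sup>2 \<partial>lborel)"
    using newton_field_square_integrable[OF \<delta> d] by (intro nn_integral_eq_integral) auto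
  also have "ennreal (\<integral>x. f x \<partial>lborel) * (ennreal (\<integral>x. f x \<partial>lborel) * ennreal (\<integral>z. (?k z)\<^sup>2 \<partial>lborel)) < \<infinity>"
    by (simp add: ennreal_mult_less_top)
  finally show "(\<integral>\<^sup>+y. ennreal (norm ((norm (potential_field \<delta> f y))\<^sup>2)) \<partial>lborel) < \<infinity>" .
qed

text \<open>
  Two applications of Fubini express the left-hand side through inner products of translated fields,
  and \<open>newton_field_inner_le\<close> bounds these by the Newton kernel.
\<close>
lemma potential_field_energy_le:
  fixes f :: "'a::euclidean_space \<Rightarrow> real"
  assumes \<delta>: "\<delta> > 0" and d: "DIM('a) \<ge> 5" and f: "integrable lborel f" and f0: "\<And>x. f x \<ge> 0"
  shows "ennreal (\<integral>y. (norm (potential_field \<delta> f y))\<^sup>2 \<partial>lborel) \<le> newton_energy f"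
proof -
  have d3: "DIM('a) \<ge> 3" using d by simp
  have [measurable]: "f \<in> borel_measurable borel" using f by simp
  define W where "W x x' = (\<integral>y. newton_field \<delta> (x' - y) \<bullet> newton_field \<delta> (x - y) \<partial>lborel)" for x x' :: 'a
  have W0: "W x x' \<ge> 0" for x x'
    unfolding W_def newton_field_inner_eq[OF \<delta> \<delta> d]
    by (intro integral_nonneg_AE AE_I2 mult_nonneg_nonneg newton_density_nonneg newton_reg_nonneg d3)
  have WG: "W x x' \<le> newton_kernel (x - x')" if "x' \<noteq> x" for x x'
  proof -
    have "W x x' \<le> newton_reg \<delta> (x - x')" unfolding W_def by (rule newton_field_inner_le[OF \<delta> d])
    also have "\<dots> \<le> newton_kernel (x - x')" using that by (intro newton_reg_le_kernel \<delta> d3) auto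
    finally show ?thesis .
  qed
  have F2: "integrable lborel (\<lambda>y. (norm (potential_field \<delta> f y))\<^sup>2)"
    by (rule potential_field_square_integrable[OF \<delta> d3 f f0])
  have K2: "integrable lborel (\<lambda>y. (norm (newton_field \<delta> (x - y)))\<^sup>2)" for x :: 'a
    using integrable_lborel_reflect[OF newton_field_square_integrable[OF \<delta> d3]] .
  have "(\<integral>y. (norm (potential_field \<delta> f y))\<^sup>2 \<partial>lborel) = (\<integral>y. potential_field \<delta> f y \<bullet> potential_field \<delta> f y \<partial>lborel)"
    by (simp add: power2_norm_eq_inner)
  also have "\<dots> = (\<integral>x. f x * (\<integral>y. newton_field \<delta> (x - y) \<bullet> potential_field \<delta> f y \<partial>lborel) \<partial>lborel)"
    by (rule integral_potential_field_inner[OF \<delta> d3 f _ F2]) measurable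
  also have "\<dots> = (\<integral>x. f x * (\<integral>x'. f x' * W x x' \<partial>lborel) \<partial>lborel)"
  proof (rule Bochner_Integration.integral_cong[OF refl])
    fix x
    have "(\<integral>y. newton_field \<delta> (x - y) \<bullet> potential_field \<delta> f y \<partial>lborel) = (\<integral>y. potential_field \<delta> f y \<bullet> newton_field \<delta> (x - y) \<partial>lborel)"
      by (simp add: inner_commute)
    also have "\<dots> = (\<integral>x'. f x' * W x x' \<partial>lborel)"
      unfolding W_def by (rule integral_potential_field_inner[OF \<delta> d3 f _ K2]) measurable
    finally show "f x * (\<integral>y. newton_field \<delta> (x - y) \<bullet> potential_field \<delta> f y \<partial>lborel) = f x * (\<integral>x'. f x' * W x x' \<partial>lborel)" by simp
  qed
  finally have "ennreal (\<integral>y. (norm (potential_field \<delta> f y))\<^sup>2 \<partial>lborel) = ennreal (\<integral>x. f x * (\<integral>x'. f x' * W x x' \<partial>lborel) \<partial>lborel)" by simp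
  also have "\<dots> \<le> (\<integral>\<^sup>+x. ennreal (f x * (\<integral>x'. f x' * W x x' \<partial>lborel)) \<partial>lborel)"
    by (intro ennreal_integral_le_nn_integral mult_nonneg_nonneg integral_nonneg_AE AE_I2 f0 W0)
  also have "\<dots> \<le> newton_energy f"
    unfolding newton_energy_def
  proof (rule nn_integral_mono)
    fix x
    have "ennreal (f x * (\<integral>x'. f x' * W x x' \<partial>lborel)) = ennreal (f x) * ennreal (\<integral>x'. f x' * W x x' \<partial>lborel)"
      by (intro ennreal_mult f0 integral_nonneg_AE AE_I2 mult_nonneg_nonneg W0)
    also have "\<dots> \<le> ennreal (f x) * (\<integral>\<^sup>+x'. ennreal (f x' * W x x') \<partial>lborel)"
      by (intro mult_left_mono ennreal_integral_le_nn_integral mult_nonneg_nonneg f0 W0) simp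
    also have "\<dots> \<le> ennreal (f x) * (\<integral>\<^sup>+x'. ennreal (f x' * newton_kernel (x - x')) \<partial>lborel)"
    proof (intro mult_left_mono nn_integral_mono_AE)
      show "AE x' in lborel. ennreal (f x' * W x x') \<le> ennreal (f x' * newton_kernel (x - x'))"
        using AE_lborel_singleton[of x]
        by eventually_elim (intro ennreal_leI mult_left_mono WG f0)
    qed simp
    also have "\<dots> = (\<integral>\<^sup>+x'. ennreal (f x) * ennreal (f x' * newton_kernel (x - x')) \<partial>lborel)"
      unfolding newton_kernel_def by (rule nn_integral_cmult[symmetric]) measurable
    also have "\<dots> = (\<integral>\<^sup>+x'. ennreal (f x * f x' * newton_kernel (x - x')) \<partial>lborel)"
    proof (rule nn_integral_cong)
      fix x'
      have "newton_kernel (x - x') \<ge> 0" using d3 sphere_area_pos[where 'a='a] by (simp add: newton_kernel_def)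
      then show "ennreal (f x) * ennreal (f x' * newton_kernel (x - x')) = ennreal (f x * f x' * newton_kernel (x - x'))"
        using f0 by (simp add: ennreal_mult[symmetric] mult.assoc)
    qed
    finally show "ennreal (f x * (\<integral>x'. f x' * W x x' \<partial>lborel)) \<le> (\<integral>\<^sup>+x'. ennreal (f x * f x' * newton_kernel (x - x')) \<partial>lborel)" .
  qed
  finally show ?thesis .
qed

text \<open>
  Here the square \<open>|a g - F|\<^sup>2\<close> is expanded, with \<open>F\<close> the potential field of \<open>f\<close>. The mixed term is
  the integral of \<open>f\<close> times a mollification of \<open>\<phi>\<close>, which converges to \<open>\<phi>\<close> boundedly.
\<close>
lemma sobolev_duality_L1:
  fixes f \<phi> :: "'a::euclidean_space \<Rightarrow> real" and g :: "'a \<Rightarrow> 'a"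
  assumes d: "DIM('a) \<ge> 5" and f: "integrable lborel f" and f0: "\<And>x. f x \<ge> 0"
    and D: "\<And>y. (\<phi> has_derivative (\<lambda>h. g y \<bullet> h)) (at y)" and cg: "continuous_on UNIV g"
    and \<phi>2: "integrable lborel (\<lambda>y. (norm (\<phi> y))\<^sup>2)" and g2: "integrable lborel (\<lambda>y. (norm (g y))\<^sup>2)"
    and B: "\<And>y. \<bar>\<phi> y\<bar> \<le> B" and J: "newton_energy f \<le> ennreal J" "J \<ge> 0"
  shows "2 * a * (\<integral>x. f x * \<phi> x \<partial>lborel) \<le> a\<^sup>2 * (\<integral>y. (norm (g y))\<^sup>2 \<partial>lborel) + J"
proof -
  have d3: "DIM('a) \<ge> 3" using d by simp
  have c\<phi>: "continuous_on UNIV \<phi>"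
    using D by (auto simp: continuous_on_eq_continuous_at intro: has_derivative_continuous)
  have [measurable]: "\<phi> \<in> borel_measurable borel" "g \<in> borel_measurable borel" "f \<in> borel_measurable borel"
    using c\<phi> cg f by (auto intro: borel_measurable_continuous_onI)
  define \<delta> where "\<delta> k = 1 / real (Suc k)" for k
  have \<delta>: "\<delta> k > 0" for k by (simp add: \<delta>_def)
  have \<delta>0: "\<delta> \<longlonglongrightarrow> 0" unfolding \<delta>_def by (intro LIMSEQ_Suc[OF lim_const_over_n])
  have "2 * a * (\<integral>x. f x * (\<integral>y. \<phi> y * newton_density (\<delta> k) (x - y) \<partial>lborel) \<partial>lborel) \<le> a\<^sup>2 * (\<integral>y. (norm (g y))\<^sup>2 \<partial>lborel) + J" for k
  proof -
    let ?F = "potential_field (\<delta> k) f"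
    have F2: "integrable lborel (\<lambda>y. (norm (?F y))\<^sup>2)"
      by (rule potential_field_square_integrable[OF \<delta> d3 f f0])
    have Fg: "integrable lborel (\<lambda>y. ?F y \<bullet> g y)"
      by (rule integrable_inner_of_square_integrable[OF _ _ F2 g2]) measurable
    have "(\<integral>x. f x * (\<integral>y. \<phi> y * newton_density (\<delta> k) (x - y) \<partial>lborel) \<partial>lborel)
       = (\<integral>x. f x * (\<integral>y. newton_field (\<delta> k) (x - y) \<bullet> g y \<partial>lborel) \<partial>lborel)"
      unfolding integral_gradient_inner_newton_field[OF \<delta> d3 D cg \<phi>2 g2, symmetric] by (simp add: inner_commute)
    also have "\<dots> = (\<integral>y. ?F y \<bullet> g y \<partial>lborel)"
      by (rule integral_potential_field_inner[OF \<delta> d3 f _ g2, symmetric]) measurable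
    finally have "2 * a * (\<integral>x. f x * (\<integral>y. \<phi> y * newton_density (\<delta> k) (x - y) \<partial>lborel) \<partial>lborel)
       = (\<integral>y. 2 * a * (?F y \<bullet> g y) \<partial>lborel)" by simp
    also have "\<dots> \<le> (\<integral>y. a\<^sup>2 * (norm (g y))\<^sup>2 + (norm (?F y))\<^sup>2 \<partial>lborel)"
    proof (rule integral_mono)
      fix y
      have "0 \<le> (norm (a *\<^sub>R g y - ?F y))\<^sup>2" by simp
      also have "\<dots> = a\<^sup>2 * (norm (g y))\<^sup>2 - 2 * a * (?F y \<bullet> g y) + (norm (?F y))\<^sup>2"
        unfolding power2_norm_eq_inner
        by (simp add: inner_diff_left inner_diff_right inner_commute power2_eq_square algebra_simps)
      finally show "2 * a * (?F y \<bullet> g y) \<le> a\<^sup>2 * (norm (g y))\<^sup>2 + (norm (?F y))\<^sup>2" by simp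
    qed (use Fg g2 F2 in auto)
    also have "\<dots> = a\<^sup>2 * (\<integral>y. (norm (g y))\<^sup>2 \<partial>lborel) + (\<integral>y. (norm (?F y))\<^sup>2 \<partial>lborel)"
      using g2 F2 by simp
    also have "(\<integral>y. (norm (?F y))\<^sup>2 \<partial>lborel) \<le> J"
    proof -
      have "ennreal (\<integral>y. (norm (?F y))\<^sup>2 \<partial>lborel) \<le> ennreal J"
        using potential_field_energy_le[OF \<delta> d f f0] J(1) by (rule order_trans)
      then show ?thesis using J(2) by simp
    qed
    finally show ?thesis by simp
  qed
  moreover have "(\<lambda>k. \<integral>x. f x * (\<integral>y. \<phi> y * newton_density (\<delta> k) (x - y) \<partial>lborel) \<partial>lborel) \<longlonglongrightarrow> (\<integral>x. f x * \<phi> x \<partial>lborel)"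
  proof (rule integral_dominated_convergence[where w = "\<lambda>x. B * f x"])
    show "AE x in lborel. (\<lambda>k. f x * (\<integral>y. \<phi> y * newton_density (\<delta> k) (x - y) \<partial>lborel)) \<longlonglongrightarrow> f x * \<phi> x"
      by (intro AE_I2 tendsto_mult_left newton_density_approximate_identity[OF c\<phi> B] \<delta> \<delta>0)
    show "AE x in lborel. norm (f x * (\<integral>y. \<phi> y * newton_density (\<delta> k) (x - y) \<partial>lborel)) \<le> B * f x" for k
    proof (rule AE_I2)
      fix x
      have "norm (\<integral>y. \<phi> y * newton_density (\<delta> k) (x - y) \<partial>lborel) \<le> (\<integral>y. norm (\<phi> y * newton_density (\<delta> k) (x - y)) \<partial>lborel)"
        by (rule integral_norm_bound)
      also have "\<dots> \<le> (\<integral>y. B * newton_density (\<delta> k) (x - y) \<partial>lborel)"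
        by (rule Bochner_Integration.integral_mono')
          (auto simp: abs_mult newton_density_nonneg intro!: mult_right_mono mult_nonneg_nonneg order_trans[OF abs_ge_zero B] B integrable_mult_right
            integrable_lborel_reflect[OF integrable_newton_density[OF \<delta>]])
      also have "\<dots> = B" using integral_lborel_reflect[of "newton_density (\<delta> k)" x] integral_newton_density[OF \<delta>, where 'a='a] by simp
      finally show "norm (f x * (\<integral>y. \<phi> y * newton_density (\<delta> k) (x - y) \<partial>lborel)) \<le> B * f x"
        using f0[of x] by (simp add: abs_mult mult.commute[of B] mult_left_mono)
    qed
  qed (use f in auto)
  then have "(\<lambda>k. 2 * a * (\<integral>x. f x * (\<integral>y. \<phi> y * newton_density (\<delta> k) (x - y) \<partial>lborel) \<partial>lborel)) \<longlonglongrightarrow> 2 * a * (\<integral>x. f x * \<phi> x \<partial>lborel)"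
    by (rule tendsto_mult_left)
  ultimately show ?thesis by (intro LIMSEQ_le_const2) auto
qed

section \<open>A smooth bump function\<close>

lemma C_k_const: "C_k k (\<lambda>x::'a::euclidean_space. c)"
proof (induction k arbitrary: c)
  case (Suc k)
  have "frechet_derivative (\<lambda>x::'a. c) (at x) v = 0" for x v
    using frechet_derivative_at[of "\<lambda>x. c" "\<lambda>h. 0" x] by (metis has_derivative_const)
  then show ?case using Suc[of 0] by simp
qed simp

lemma C_k_inner: "C_k k (\<lambda>x::'a::euclidean_space. x \<bullet> v)"
proof (cases k)
  case (Suc j)
  have D: "((\<lambda>x::'a. x \<bullet> v) has_derivative (\<lambda>h. h \<bullet> v)) (at x)" for x
    by (auto intro!: derivative_eq_intros)
  then have "frechet_derivative (\<lambda>x::'a. x \<bullet> v) (at x) w = w \<bullet> v" for x w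
    by (simp add: frechet_derivative_at[OF D, symmetric])
  then show ?thesis using D by (auto simp: Suc differentiable_def C_k_const)
qed (auto intro!: continuous_intros)

lemma C_k_imp_continuous: "C_k k f \<Longrightarrow> continuous_on UNIV f"
  by (cases k) (auto simp: continuous_on_eq_continuous_at differentiable_imp_continuous_within)

lemma C_k_add: "C_k k f \<Longrightarrow> C_k k g \<Longrightarrow> C_k k (\<lambda>x::'a::euclidean_space. f x + g x)"
proof (induction k arbitrary: f g)
  case (Suc k)
  have df: "f differentiable (at x)" and dg: "g differentiable (at x)" for x
    using Suc.prems by auto
  have "frechet_derivative (\<lambda>x. f x + g x) (at x) v = frechet_derivative f (at x) v + frechet_derivative g (at x) v" for x v
    using frechet_derivative_at[OF has_derivative_add[OF df[unfolded frechet_derivative_works] dg[unfolded frechet_derivative_works]], of x]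
    by metis
  then show ?case using Suc by simp
qed (auto intro!: continuous_intros)

lemma C_k_mult_aux:
  assumes "\<And>f g. C_k k f \<Longrightarrow> C_k k g \<Longrightarrow> C_k k (\<lambda>x::'a::euclidean_space. f x * g x)"
    and "C_k (Suc k) f" "C_k (Suc k) g" "C_k k f" "C_k k g"
  shows "C_k (Suc k) (\<lambda>x::'a::euclidean_space. f x * g x)"
proof -
  have df: "f differentiable (at x)" and dg: "g differentiable (at x)" for x
    using assms by auto
  have "frechet_derivative (\<lambda>x. f x * g x) (at x) v = f x * frechet_derivative g (at x) v + frechet_derivative f (at x) v * g x" for x v
    using frechet_derivative_at[OF has_derivative_mult[OF df[unfolded frechet_derivative_works] dg[unfolded frechet_derivative_works]], of x]
    by metis
  then show ?thesis using assms df dg by (auto intro!: C_k_add)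
qed

lemma C_k_Suc_imp: "C_k (Suc k) f \<Longrightarrow> C_k k f"
proof (induction k arbitrary: f)
  case 0
  show ?case using C_k_imp_continuous[OF 0] by simp
next
  case (Suc k)
  from Suc.prems have "\<forall>x. f differentiable (at x)" "\<forall>v. C_k (Suc k) (\<lambda>x. frechet_derivative f (at x) v)"
    by auto
  then show ?case using Suc.IH by auto
qed

lemma C_k_mult: "C_k k f \<Longrightarrow> C_k k g \<Longrightarrow> C_k k (\<lambda>x::'a::euclidean_space. f x * g x)"
proof (induction k arbitrary: f g)
  case (Suc k)
  show ?case by (rule C_k_mult_aux[OF Suc.IH Suc.prems]) (use Suc.prems C_k_Suc_imp in blast)+
qed (auto intro!: continuous_intros)

text \<open>
  The factors \<open>t\<^sup>-\<^sup>m\<close> make the family closed under differentiation, up to linear combinations.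
\<close>
definition flat_exp :: "nat \<Rightarrow> real \<Rightarrow> real" where
  "flat_exp m t = (if t \<le> 0 then 0 else exp (- (1 / t)) * (1 / t) ^ m)"

lemma flat_exp_tendsto_0: "((\<lambda>h. flat_exp m h) \<longlongrightarrow> 0) (at 0)"
proof -
  have "((\<lambda>x::real. x ^ m / exp x) \<longlongrightarrow> 0) at_top" by (rule tendsto_power_div_exp_0)
  then have "((\<lambda>t::real. inverse t ^ m / exp (inverse t)) \<longlongrightarrow> 0) (at_right 0)"
    by (rule filterlim_compose) (rule filterlim_inverse_at_top_right)
  then have r: "(flat_exp m \<longlongrightarrow> 0) (at_right 0)"
    by (rule Lim_transform_eventually)
       (auto simp: flat_exp_def eventually_at_filter exp_minus field_simps)
  have "((\<lambda>x. 0) \<longlongrightarrow> (0::real)) (at_left 0)" by simp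
  then have l: "(flat_exp m \<longlongrightarrow> 0) (at_left 0)"
    by (rule Lim_transform_eventually) (auto simp: flat_exp_def eventually_at_filter)
  show ?thesis using l r by (simp add: filterlim_split_at)
qed

lemma flat_exp_deriv:
  "(flat_exp m has_real_derivative flat_exp (m + 2) t - real m * flat_exp (m + 1) t) (at t)"
proof -
  consider "t < 0" | "t = 0" | "t > 0" by linarith
  then show ?thesis
  proof cases
    case 1
    have "((\<lambda>t. 0) has_real_derivative 0) (at t)" by simp
    then have "(flat_exp m has_real_derivative 0) (at t)"
      by (rule has_field_derivative_transform_within_open[where S = "{..<0}"]) (use 1 in \<open>auto simp: flat_exp_def\<close>)
    then show ?thesis using 1 by (simp add: flat_exp_def)
  next
    case 2
    have "((\<lambda>h. (flat_exp m (0 + h) - flat_exp m 0) / h) \<longlongrightarrow> 0) (at 0)"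
      by (rule Lim_transform_eventually[OF flat_exp_tendsto_0[of "m + 1"]])
         (auto simp: flat_exp_def eventually_at_filter field_simps)
    then show ?thesis by (simp add: DERIV_def 2 flat_exp_def)
  next
    case 3
    have "((\<lambda>t. exp (- (1 / t)) * (1 / t) ^ m) has_real_derivative
       exp (- (1 / t)) * (1 / t) ^ (m + 2) - real m * (exp (- (1 / t)) * (1 / t) ^ (m + 1))) (at t)"
    proof -
      have "((\<lambda>u. exp (- u) * u ^ m) has_real_derivative
          real m * (exp (- u) * u ^ (m - 1)) - exp (- u) * u ^ m) (at u)" for u :: real
        by (auto intro!: derivative_eq_intros simp: algebra_simps)
      moreover have "((\<lambda>t. 1 / t) has_real_derivative - ((1 / t) ^ 2)) (at t)"
        using 3 by (auto intro!: derivative_eq_intros simp: power2_eq_square)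
      ultimately have "((\<lambda>t. exp (- (1 / t)) * (1 / t) ^ m) has_real_derivative
          (real m * (exp (- (1 / t)) * (1 / t) ^ (m - 1)) - exp (- (1 / t)) * (1 / t) ^ m) * - ((1 / t) ^ 2)) (at t)"
        by (rule DERIV_chain2)
      also have "(real m * (exp (- (1 / t)) * (1 / t) ^ (m - 1)) - exp (- (1 / t)) * (1 / t) ^ m) * - ((1 / t) ^ 2)
        = exp (- (1 / t)) * (1 / t) ^ (m + 2) - real m * (exp (- (1 / t)) * (1 / t) ^ (m + 1))"
      proof -
        have "(real m * (E * u ^ (m - 1)) - E * u ^ m) * - (u ^ 2) = E * u ^ (m + 2) - real m * (E * u ^ (m + 1))" for E u :: real
          by (cases m) (simp_all add: algebra_simps power2_eq_square)
        then show ?thesis .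
      qed
      finally show ?thesis .
    qed
    then have "(flat_exp m has_real_derivative exp (- (1 / t)) * (1 / t) ^ (m + 2) - real m * (exp (- (1 / t)) * (1 / t) ^ (m + 1))) (at t)"
      by (rule has_field_derivative_transform_within_open[where S = "{0<..}"]) (use 3 in \<open>auto simp: flat_exp_def\<close>)
    then show ?thesis using 3 by (simp add: flat_exp_def)
  qed
qed

text \<open>
  The smooth factor \<open>p\<close> is needed for the induction, since differentiating \<open>1 - |x|\<^sup>2\<close> produces factors
  that are linear in \<open>x\<close>.
\<close>
lemma C_k_flat_exp:
  assumes "\<And>k. C_k k p"
  shows "C_k k (\<lambda>x::'a::euclidean_space. p x * flat_exp m (1 - x \<bullet> x))"
  using assms
proof (induction k arbitrary: p m)
  case 0
  have "continuous_on UNIV (flat_exp m)"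
    by (rule DERIV_continuous_on) (rule has_field_derivative_at_within[OF flat_exp_deriv])
  then have "continuous_on UNIV (\<lambda>x::'a. flat_exp m (1 - x \<bullet> x))"
    by (rule continuous_on_compose2) (auto intro!: continuous_intros)
  then show ?case using 0[of 0] by (auto intro!: continuous_intros)
next
  case (Suc k)
  have dp: "p differentiable (at x)" for x using Suc.prems[of 1] by simp
  have D: "((\<lambda>x::'a. p x * flat_exp m (1 - x \<bullet> x)) has_derivative
      (\<lambda>v. p x * ((flat_exp (m + 2) (1 - x \<bullet> x) - real m * flat_exp (m + 1) (1 - x \<bullet> x)) * (- 2 * (x \<bullet> v)))
        + frechet_derivative p (at x) v * flat_exp m (1 - x \<bullet> x))) (at x)" for x
  proof -
    have "((\<lambda>x::'a. 1 - x \<bullet> x) has_derivative (\<lambda>v. - 2 * (x \<bullet> v))) (at x)"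
      by (auto intro!: derivative_eq_intros simp: inner_commute)
    from has_derivative_compose[OF this flat_exp_deriv[unfolded has_field_derivative_def]]
    have "((\<lambda>x::'a. flat_exp m (1 - x \<bullet> x)) has_derivative
      (\<lambda>v. (flat_exp (m + 2) (1 - x \<bullet> x) - real m * flat_exp (m + 1) (1 - x \<bullet> x)) * (- 2 * (x \<bullet> v)))) (at x)"
      by simp
    from has_derivative_mult[OF dp[of x, unfolded frechet_derivative_works] this] show ?thesis .
  qed
  have eq: "frechet_derivative (\<lambda>x::'a. p x * flat_exp m (1 - x \<bullet> x)) (at x) v =
      (p x * ((- 2) * (x \<bullet> v))) * flat_exp (m + 2) (1 - x \<bullet> x)
      + ((p x * ((2 * real m) * (x \<bullet> v))) * flat_exp (m + 1) (1 - x \<bullet> x)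
      + frechet_derivative p (at x) v * flat_exp m (1 - x \<bullet> x))" for x v
    by (simp add: frechet_derivative_at[OF D, symmetric] algebra_simps)
  have dpk: "C_k k' (\<lambda>x. frechet_derivative p (at x) v)" for k' v
    using Suc.prems[of "Suc k'"] by simp
  show ?case
    unfolding C_k.simps
  proof (intro conjI allI)
    show "(\<lambda>x. p x * flat_exp m (1 - x \<bullet> x)) differentiable at x" for x
      using D unfolding differentiable_def by blast
    show "C_k k (\<lambda>x. frechet_derivative (\<lambda>x. p x * flat_exp m (1 - x \<bullet> x)) (at x) v)" for v
      unfolding eq by (intro C_k_add Suc.IH C_k_mult C_k_const C_k_inner Suc.prems dpk)
  qed
qed

definition bump :: "'a::euclidean_space \<Rightarrow> real" where
  "bump x = flat_exp 0 (1 - x \<bullet> x)"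

lemma bump_pos_iff: "bump x > 0 \<longleftrightarrow> norm x < 1" and bump_nonneg: "bump x \<ge> 0"
proof -
  have "norm x < 1 \<longleftrightarrow> x \<bullet> x < 1" by (simp add: norm_eq_sqrt_inner)
  then show "bump x > 0 \<longleftrightarrow> norm x < 1" by (auto simp: bump_def flat_exp_def)
  show "bump x \<ge> 0" by (simp add: bump_def flat_exp_def)
qed

lemma test_function_bump: "test_function (bump :: 'a::euclidean_space \<Rightarrow> real)"
  unfolding test_function_def
proof (intro conjI allI)
  show "C_k k (bump :: 'a \<Rightarrow> real)" for k
    using C_k_flat_exp[of "\<lambda>_. 1" k 0] by (simp add: bump_def[abs_def] C_k_const)
  have "bump x \<noteq> 0 \<longleftrightarrow> norm x < 1" for x :: 'a
    using bump_pos_iff[of x] bump_nonneg[of x] by linarith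
  then have "{x::'a. bump x \<noteq> 0} = ball 0 1"
    by (simp only: set_eq_iff mem_Collect_eq mem_ball dist_0_norm simp_thms)
  then show "compact (closure {x::'a. bump x \<noteq> 0})" by (simp only: compact_closure bounded_ball)
qed

section \<open>Test functions and a smooth absolute value\<close>

lemma has_derivative_gradient:
  fixes \<phi> :: "'a::euclidean_space \<Rightarrow> real"
  assumes "\<phi> differentiable (at x)"
  shows "(\<phi> has_derivative (\<lambda>h. gradient \<phi> x \<bullet> h)) (at x)"
proof -
  have D: "(\<phi> has_derivative frechet_derivative \<phi> (at x)) (at x)" using assms frechet_derivative_works by blast
  have lin: "linear (frechet_derivative \<phi> (at x))" using D by (rule has_derivative_linear)
  have "frechet_derivative \<phi> (at x) h = gradient \<phi> x \<bullet> h" for h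
  proof -
    have "frechet_derivative \<phi> (at x) h = frechet_derivative \<phi> (at x) (\<Sum>b\<in>Basis. (h \<bullet> b) *\<^sub>R b)"
      by (simp add: euclidean_representation)
    also have "\<dots> = (\<Sum>b\<in>Basis. (h \<bullet> b) * frechet_derivative \<phi> (at x) b)"
      by (simp add: linear_sum[OF lin] linear_scale[OF lin])
    also have "\<dots> = gradient \<phi> x \<bullet> h"
      by (simp add: gradient_def inner_sum_left inner_commute[of h] mult.commute)
    finally show ?thesis .
  qed
  then have "frechet_derivative \<phi> (at x) = (\<lambda>h. gradient \<phi> x \<bullet> h)" by (rule ext)
  with D show ?thesis by simp
qed

lemma test_function_differentiable: "test_function \<phi> \<Longrightarrow> \<phi> differentiable (at x)"
  unfolding test_function_def by (drule conjunct1, drule spec[of _ "Suc 0"]) simp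

lemma test_function_continuous: "test_function \<phi> \<Longrightarrow> continuous_on UNIV \<phi>"
  unfolding test_function_def by (drule conjunct1, drule spec[of _ 0]) simp

lemma test_function_continuous_gradient:
  assumes "test_function (\<phi> :: 'a::euclidean_space \<Rightarrow> real)"
  shows "continuous_on UNIV (gradient \<phi>)"
proof -
  have "C_k (Suc 0) \<phi>" using assms unfolding test_function_def by blast
  then have "continuous_on UNIV (\<lambda>x. frechet_derivative \<phi> (at x) v)" for v by simp
  then show ?thesis unfolding gradient_def[abs_def] by (intro continuous_intros)
qed

lemma gradient_eq_0_outside_support:
  fixes \<phi> :: "'a::euclidean_space \<Rightarrow> real"
  assumes "x \<notin> closure {x. \<phi> x \<noteq> 0}"
  shows "gradient \<phi> x = 0"
proof -
  have "((\<lambda>x. 0) has_derivative (\<lambda>h::'a. 0::real)) (at x)" by simp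
  then have "(\<phi> has_derivative (\<lambda>h. 0)) (at x)"
  proof (rule has_derivative_transform_within_open)
    show "open (- closure {x. \<phi> x \<noteq> 0})" by auto
    show "x \<in> - closure {x. \<phi> x \<noteq> 0}" using assms by simp
    show "0 = \<phi> y" if "y \<in> - closure {x. \<phi> x \<noteq> 0}" for y
      using that closure_subset[of "{x. \<phi> x \<noteq> 0}"] by auto
  qed
  then have "frechet_derivative \<phi> (at x) = (\<lambda>h. 0)" by (rule frechet_derivative_at[symmetric])
  then show ?thesis by (simp add: gradient_def)
qed

lemma integrable_continuous_compact_support:
  fixes h :: "'a::euclidean_space \<Rightarrow> real"
  assumes "continuous_on UNIV h" "compact K" "\<And>x. x \<notin> K \<Longrightarrow> h x = 0"
  shows "integrable lborel h"
proof -
  have "integrable lborel (\<lambda>x. indicator K x *\<^sub>R h x)"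
    by (rule borel_integrable_compact[OF assms(2) continuous_on_subset[OF assms(1)]]) simp
  moreover have "(\<lambda>x. indicator K x *\<^sub>R h x) = h" using assms(3) by (auto split: split_indicator)
  ultimately show ?thesis by simp
qed

lemma
  fixes \<phi> :: "'a::euclidean_space \<Rightarrow> real"
  assumes t: "test_function \<phi>"
  shows test_function_powr_integrable: "p > 0 \<Longrightarrow> integrable lborel (\<lambda>x. \<bar>\<phi> x\<bar> powr p)"
    and test_function_gradient_square_integrable: "integrable lborel (\<lambda>x. (norm (gradient \<phi> x))\<^sup>2)"
    and test_function_bounded: "\<exists>B. \<forall>x. \<bar>\<phi> x\<bar> \<le> B"
proof -
  let ?K = "closure {x. \<phi> x \<noteq> 0}"
  have K: "compact ?K" using t by (simp add: test_function_def)
  have z: "\<phi> x = 0" if "x \<notin> ?K" for x using that closure_subset[of "{x. \<phi> x \<noteq> 0}"] by auto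
  have c: "continuous_on UNIV \<phi>" by (rule test_function_continuous[OF t])
  show "integrable lborel (\<lambda>x. \<bar>\<phi> x\<bar> powr p)" if "p > 0"
  proof (rule integrable_continuous_compact_support[OF _ K])
    show "continuous_on UNIV (\<lambda>x. \<bar>\<phi> x\<bar> powr p)"
      by (rule continuous_on_powr'[OF continuous_on_rabs[OF c] continuous_on_const]) (use that in simp)
    show "\<bar>\<phi> x\<bar> powr p = 0" if "x \<notin> ?K" for x using z[OF that] by simp
  qed
  show "integrable lborel (\<lambda>x. (norm (gradient \<phi> x))\<^sup>2)"
  proof (rule integrable_continuous_compact_support[OF _ K])
    show "continuous_on UNIV (\<lambda>x. (norm (gradient \<phi> x))\<^sup>2)"
      by (intro continuous_on_power continuous_on_norm test_function_continuous_gradient[OF t])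
    show "(norm (gradient \<phi> x))\<^sup>2 = 0" if "x \<notin> ?K" for x using gradient_eq_0_outside_support[OF that] by simp
  qed
  have "compact (\<phi> ` ?K)" by (rule compact_continuous_image[OF continuous_on_subset[OF c] K]) simp
  then obtain B where B: "\<And>y. y \<in> \<phi> ` ?K \<Longrightarrow> norm y \<le> B" using compact_imp_bounded bounded_iff by metis
  have "\<bar>\<phi> x\<bar> \<le> max B 0" for x using B[of "\<phi> x"] z[of x] by (cases "x \<in> ?K") auto
  then show "\<exists>B. \<forall>x. \<bar>\<phi> x\<bar> \<le> B" by blast
qed

text \<open>
  The offset \<open>\<eta>\<close> makes the function vanish at zero, so that composing it with a test function preserves
  the support.
\<close>
definition smooth_abs :: "real \<Rightarrow> real \<Rightarrow> real" where
  "smooth_abs \<eta> t = sqrt (t\<^sup>2 + \<eta>\<^sup>2) - \<eta>"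

lemma smooth_abs_bounds: "\<eta> > 0 \<Longrightarrow> 0 \<le> smooth_abs \<eta> t" "\<eta> > 0 \<Longrightarrow> smooth_abs \<eta> t \<le> \<bar>t\<bar>"
proof -
  assume "\<eta> > 0"
  show "0 \<le> smooth_abs \<eta> t" using \<open>\<eta> > 0\<close> by (simp add: smooth_abs_def real_le_rsqrt)
  have "sqrt (t\<^sup>2 + \<eta>\<^sup>2) \<le> sqrt ((\<bar>t\<bar> + \<eta>)\<^sup>2)"
    using \<open>\<eta> > 0\<close> by (intro real_sqrt_le_mono) (simp add: power2_sum)
  then show "smooth_abs \<eta> t \<le> \<bar>t\<bar>" using \<open>\<eta> > 0\<close> by (simp add: smooth_abs_def)
qed

lemma smooth_abs_deriv:
  assumes "\<eta> > 0"
  shows "(smooth_abs \<eta> has_real_derivative t / sqrt (t\<^sup>2 + \<eta>\<^sup>2)) (at t)"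
proof -
  have p: "t\<^sup>2 + \<eta>\<^sup>2 > 0" using assms by (simp add: add_nonneg_pos)
  have "((\<lambda>t. t\<^sup>2 + \<eta>\<^sup>2) has_real_derivative 2 * t) (at t)" by (auto intro!: derivative_eq_intros)
  from DERIV_chain2[OF DERIV_real_sqrt[OF p] this]
  have "((\<lambda>t. sqrt (t\<^sup>2 + \<eta>\<^sup>2) - \<eta>) has_real_derivative (inverse (sqrt (t\<^sup>2 + \<eta>\<^sup>2)) / 2 * (2 * t) - 0)) (at t)"
    by (intro DERIV_diff DERIV_const)
  moreover have "inverse r / 2 * (2 * t) - 0 = t / r" for r :: real by (simp add: field_simps)
  ultimately show ?thesis unfolding smooth_abs_def[abs_def] by (simp only:)
qed

text \<open>
  A smooth version of \<open>|\<nabla>|\<phi>|| \<le> |\<nabla>\<phi>|\<close>, as \<open>smooth_abs\<close> has slope at most one.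
\<close>
lemma sobolev_duality_smooth_abs:
  fixes f \<phi> :: "'a::euclidean_space \<Rightarrow> real"
  assumes d: "DIM('a) \<ge> 5" and f: "integrable lborel f" and f0: "\<And>x. f x \<ge> 0"
    and t: "test_function \<phi>" and \<eta>: "\<eta> > 0" and J: "newton_energy f \<le> ennreal J" "J \<ge> 0"
  shows "2 * a * (\<integral>x. f x * smooth_abs \<eta> (\<phi> x) \<partial>lborel) \<le> a\<^sup>2 * (\<integral>y. (norm (gradient \<phi> y))\<^sup>2 \<partial>lborel) + J"
proof -
  let ?s = "\<lambda>x. \<phi> x / sqrt ((\<phi> x)\<^sup>2 + \<eta>\<^sup>2)"
  let ?g = "\<lambda>x. ?s x *\<^sub>R gradient \<phi> x"
  have c: "continuous_on UNIV \<phi>" by (rule test_function_continuous[OF t])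
  have cg: "continuous_on UNIV (gradient \<phi>)" by (rule test_function_continuous_gradient[OF t])
  have pos: "sqrt ((\<phi> x)\<^sup>2 + \<eta>\<^sup>2) > 0" for x using \<eta> by (simp add: add_nonneg_pos)
  then have nz: "sqrt ((\<phi> x)\<^sup>2 + \<eta>\<^sup>2) \<noteq> 0" for x by (rule less_imp_neq[symmetric])
  have cs: "continuous_on UNIV ?s" by (intro continuous_on_divide continuous_intros c ballI nz)
  have D: "((\<lambda>x. smooth_abs \<eta> (\<phi> x)) has_derivative (\<lambda>h. ?g x \<bullet> h)) (at x)" for x
    using has_derivative_compose[OF has_derivative_gradient[OF test_function_differentiable[OF t]]
      smooth_abs_deriv[OF \<eta>, unfolded has_field_derivative_def]] by (simp add: inner_scaleR_left)
  have gle: "norm (?g x) \<le> norm (gradient \<phi> x)" for x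
  proof -
    have "\<bar>\<phi> x\<bar> \<le> sqrt ((\<phi> x)\<^sup>2 + \<eta>\<^sup>2)" by (rule real_le_rsqrt) simp
    then have "\<bar>?s x\<bar> \<le> 1" using pos[of x] by (simp add: abs_divide divide_le_eq)
    then have "\<bar>?s x\<bar> * norm (gradient \<phi> x) \<le> 1 * norm (gradient \<phi> x)" by (rule mult_right_mono) simp
    then show ?thesis by simp
  qed
  have cont: "continuous_on UNIV ?g" by (intro continuous_on_scaleR cs cg)
  have gm: "?g \<in> borel_measurable borel" by (rule borel_measurable_continuous_onI[OF cont])
  have [measurable]: "\<phi> \<in> borel_measurable borel" by (rule borel_measurable_continuous_onI[OF c])
  have G2: "integrable lborel (\<lambda>x. (norm (gradient \<phi> x))\<^sup>2)" by (rule test_function_gradient_square_integrable[OF t])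
  have g2: "integrable lborel (\<lambda>x. (norm (?g x))\<^sup>2)"
  proof (rule Bochner_Integration.integrable_bound[OF G2])
    show "AE x in lborel. norm ((norm (?g x))\<^sup>2) \<le> norm ((norm (gradient \<phi> x))\<^sup>2)"
      unfolding real_norm_def abs_power2 by (intro AE_I2 power_mono gle norm_ge_zero)
    show "(\<lambda>x. (norm (?g x))\<^sup>2) \<in> borel_measurable lborel"
      unfolding measurable_lborel2 by (rule borel_measurable_power[OF measurable_compose[OF gm borel_measurable_norm]])
  qed
  have p2: "integrable lborel (\<lambda>x. (norm (smooth_abs \<eta> (\<phi> x)))\<^sup>2)"
  proof (rule Bochner_Integration.integrable_bound[OF test_function_powr_integrable[OF t, of 2]])
    show "AE x in lborel. norm ((norm (smooth_abs \<eta> (\<phi> x)))\<^sup>2) \<le> norm (\<bar>\<phi> x\<bar> powr 2)"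
    proof (rule AE_I2)
      fix x
      have "(smooth_abs \<eta> (\<phi> x))\<^sup>2 \<le> \<bar>\<phi> x\<bar>\<^sup>2" using smooth_abs_bounds[OF \<eta>, of "\<phi> x"] by (intro power_mono) auto
      then show "norm ((norm (smooth_abs \<eta> (\<phi> x)))\<^sup>2) \<le> norm (\<bar>\<phi> x\<bar> powr 2)" by simp
    qed
    show "(\<lambda>x. (norm (smooth_abs \<eta> (\<phi> x)))\<^sup>2) \<in> borel_measurable lborel"
      unfolding smooth_abs_def by measurable
  qed simp
  obtain B where "\<And>x. \<bar>\<phi> x\<bar> \<le> B" using test_function_bounded[OF t] by blast
  then have B: "\<bar>smooth_abs \<eta> (\<phi> x)\<bar> \<le> B" for x
    using smooth_abs_bounds[OF \<eta>, of "\<phi> x"] by (smt (verit))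
  have "2 * a * (\<integral>x. f x * smooth_abs \<eta> (\<phi> x) \<partial>lborel) \<le> a\<^sup>2 * (\<integral>y. (norm (?g y))\<^sup>2 \<partial>lborel) + J"
    by (rule sobolev_duality_L1[OF d f f0 D cont p2 g2 B J])
  also have "(\<integral>y. (norm (?g y))\<^sup>2 \<partial>lborel) \<le> (\<integral>y. (norm (gradient \<phi> y))\<^sup>2 \<partial>lborel)"
    by (rule integral_mono[OF g2 G2]) (intro power_mono gle norm_ge_zero)
  finally show ?thesis by (simp add: mult_left_mono)
qed

section \<open>Duality on the completion\<close>

lemma Lp_norm_tendsto_0_imp:
  fixes u :: "nat \<Rightarrow> 'a::euclidean_space \<Rightarrow> 'b::euclidean_space"
  assumes p: "p > 0" and lim: "(\<lambda>n. Lp_norm p (u n)) \<longlonglongrightarrow> 0"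
  shows "(\<lambda>n. \<integral>x. norm (u n x) powr p \<partial>lebesgue) \<longlonglongrightarrow> 0"
proof -
  have "(\<lambda>n. Lp_norm p (u n) powr p) \<longlonglongrightarrow> 0 powr p"
    using lim by (rule tendsto_powr'[OF _ tendsto_const]) (use p in \<open>auto simp: Lp_norm_def\<close>)
  moreover have "Lp_norm p (u n) powr p = (\<integral>x. norm (u n x) powr p \<partial>lebesgue)" for n
    unfolding Lp_norm_def powr_powr using p by (simp add: integral_nonneg_AE)
  ultimately show ?thesis by simp
qed

lemma integrable_diff_powr:
  fixes u v :: "'a \<Rightarrow> 'b::euclidean_space"
  assumes p: "p > 0" and [measurable]: "u \<in> borel_measurable M" "v \<in> borel_measurable M"
    and u: "integrable M (\<lambda>x. norm (u x) powr p)" and v: "integrable M (\<lambda>x. norm (v x) powr p)"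
  shows "integrable M (\<lambda>x. norm (u x - v x) powr p)"
proof (rule Bochner_Integration.integrable_bound)
  show "integrable M (\<lambda>x. 2 powr p * (norm (u x) powr p + norm (v x) powr p))"
    using u v by simp
  have "norm (a - b) powr p \<le> 2 powr p * (norm a powr p + norm b powr p)" for a b :: 'b
  proof -
    have "norm (a - b) \<le> 2 * max (norm a) (norm b)"
      using norm_triangle_ineq4[of a b] by simp
    then have "norm (a - b) powr p \<le> (2 * max (norm a) (norm b)) powr p"
      using p by (intro powr_mono2) auto
    also have "\<dots> = 2 powr p * (max (norm a) (norm b)) powr p" by (rule powr_mult)
    also have "\<dots> \<le> 2 powr p * (norm a powr p + norm b powr p)"
      by (intro mult_left_mono) (auto simp: max_def)
    finally show ?thesis .
  qed
  then show "AE x in M. norm (norm (u x - v x) powr p) \<le> norm (2 powr p * (norm (u x) powr p + norm (v x) powr p))"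
    by simp
qed measurable

lemma smooth_abs_tendsto:
  assumes "e \<longlonglongrightarrow> 0" "s \<longlonglongrightarrow> t"
  shows "(\<lambda>k. smooth_abs (e k) (s k)) \<longlonglongrightarrow> \<bar>t\<bar>"
proof -
  have "(\<lambda>k. sqrt ((s k)\<^sup>2 + (e k)\<^sup>2) - e k) \<longlonglongrightarrow> sqrt (t\<^sup>2 + 0\<^sup>2) - 0"
    by (intro tendsto_intros assms)
  then show ?thesis by (simp add: smooth_abs_def)
qed

lemma newton_kernel_nonneg: "DIM('a) \<ge> 3 \<Longrightarrow> newton_kernel (z::'a::euclidean_space) \<ge> 0"
  using sphere_area_pos[where 'a='a] by (simp add: newton_kernel_def)

lemma newton_energy_mono:
  fixes f h :: "'a::euclidean_space \<Rightarrow> real"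
  assumes "DIM('a) \<ge> 3" "\<And>x. 0 \<le> h x" "\<And>x. h x \<le> f x"
  shows "newton_energy h \<le> newton_energy f"
  unfolding newton_energy_def
  by (intro nn_integral_mono ennreal_leI mult_mono mult_nonneg_nonneg newton_kernel_nonneg assms order_trans[OF assms(2,3)]) auto

lemma norm_square_le_perturbed:
  fixes u v :: "'a::real_normed_vector"
  assumes "\<theta> > 0"
  shows "(norm u)\<^sup>2 \<le> (1 + \<theta>) * (norm v)\<^sup>2 + (1 + 1 / \<theta>) * (norm (u - v))\<^sup>2"
proof -
  let ?a = "norm v" and ?b = "norm (u - v)"
  have "norm u \<le> ?a + ?b" using norm_triangle_ineq[of v "u - v"] by simp
  then have "(norm u)\<^sup>2 \<le> (?a + ?b)\<^sup>2" by (intro power_mono) auto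
  also have "\<dots> = ?a\<^sup>2 + ?b\<^sup>2 + 2 * ?a * ?b" by (rule power2_sum)
  also have "2 * ?a * ?b \<le> \<theta> * ?a\<^sup>2 + 1 / \<theta> * ?b\<^sup>2"
  proof -
    have "0 \<le> (\<theta> * ?a - ?b)\<^sup>2 / \<theta>" using assms by simp
    also have "\<dots> = \<theta> * ?a\<^sup>2 + 1 / \<theta> * ?b\<^sup>2 - 2 * ?a * ?b"
      using assms by (simp add: power2_diff field_simps power2_eq_square)
    finally show ?thesis by simp
  qed
  finally show ?thesis by (simp add: algebra_simps)
qed

text \<open>
  The density is truncated in height and in space, \<open>|w|\<close> is approximated by smooth absolute values of
  test functions, and both approximations are run along one index. Along a subsequence the integrands
  converge almost everywhere, so Fatou's lemma applies. The gradient norms need only be bounded above,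
  which \<open>norm_square_le_perturbed\<close> does with a factor \<open>1 + \<theta>\<close> that tends to one at the end.
\<close>
lemma sobolev_duality_D12:
  fixes f w :: "'a::euclidean_space \<Rightarrow> real"
  assumes d: "DIM('a) \<ge> 5" and w: "has_D12_gradient w g"
    and [measurable]: "f \<in> borel_measurable borel" and f0: "\<And>x. f x \<ge> 0"
    and J: "newton_energy f \<le> ennreal J" "J \<ge> 0" and a: "a > 0"
  shows "(\<integral>\<^sup>+x. ennreal (f x * \<bar>w x\<bar>) \<partial>lborel) \<le> ennreal ((a\<^sup>2 * (\<integral>x. (norm (g x))\<^sup>2 \<partial>lebesgue) + J) / (2 * a))"
proof -
  have d3: "DIM('a) \<ge> 3" using d by simp
  define p where "p = sobolev_exponent TYPE('a)"
  have p: "p > 0" using d by (simp add: p_def sobolev_exponent_def)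
  define G where "G = (\<integral>x. (norm (g x))\<^sup>2 \<partial>lebesgue)"
  have wm: "w \<in> borel_measurable lebesgue" and wi: "integrable lebesgue (\<lambda>x. norm (w x) powr p)"
    and gm: "g \<in> borel_measurable lebesgue" and gi: "integrable lebesgue (\<lambda>x. norm (g x) powr 2)"
    using w by (auto simp: has_D12_gradient_def Lp_space_def p_def)
  obtain \<phi> where t: "\<And>n. test_function (\<phi> n)"
    and c1: "(\<lambda>n. Lp_norm p (\<lambda>x. \<phi> n x - w x)) \<longlonglongrightarrow> 0"
    and c2: "(\<lambda>n. Lp_norm 2 (\<lambda>x. gradient (\<phi> n) x - g x)) \<longlonglongrightarrow> 0"
    using w unfolding has_D12_gradient_def p_def by blast
  have \<phi>m[measurable]: "\<phi> n \<in> borel_measurable borel" for n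
    by (rule borel_measurable_continuous_onI[OF test_function_continuous[OF t]])
  have \<phi>L: "\<phi> n \<in> borel_measurable lebesgue" for n
    using \<phi>m by (intro measurable_completion) simp
  have Gm: "gradient (\<phi> n) \<in> borel_measurable borel" for n
    by (rule borel_measurable_continuous_onI[OF test_function_continuous_gradient[OF t]])
  have GL: "gradient (\<phi> n) \<in> borel_measurable lebesgue" for n
    using Gm by (intro measurable_completion) simp
  have \<phi>i: "integrable lebesgue (\<lambda>x. norm (\<phi> n x) powr p)" for n
    using test_function_powr_integrable[OF t p] by (simp add: integrable_completion)
  have gradi: "integrable lebesgue (\<lambda>x. (norm (gradient (\<phi> n) x))\<^sup>2)" for n
    using test_function_gradient_square_integrable[OF t] Gm by (simp add: integrable_completion)
  have gradi': "integrable lebesgue (\<lambda>x. norm (gradient (\<phi> n) x) powr 2)" for n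
    using gradi by simp
  \<comment> \<open>Convergence in the critical Lebesgue space gives convergence almost everywhere of a subsequence.\<close>
  have "\<exists>r. strict_mono r \<and> (AE x in lebesgue. (\<lambda>n. norm (\<phi> (r n) x - w x) powr p) \<longlonglongrightarrow> 0)"
    using Lp_norm_tendsto_0_imp[OF p c1]
    by (intro tendsto_L1_AE_subseq integrable_diff_powr[OF p \<phi>L wm \<phi>i wi]) simp
  then obtain r where r: "strict_mono r" and ae: "AE x in lebesgue. (\<lambda>n. norm (\<phi> (r n) x - w x) powr p) \<longlonglongrightarrow> 0"
    by blast
  have ae: "AE x in lborel. (\<lambda>n. \<phi> (r n) x) \<longlonglongrightarrow> w x"
    using ae unfolding AE_completion_iff
  proof eventually_elim
    fix x assume l: "(\<lambda>n. norm (\<phi> (r n) x - w x) powr p) \<longlonglongrightarrow> 0"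
    have "(\<lambda>n. (norm (\<phi> (r n) x - w x) powr p) powr (1 / p)) \<longlonglongrightarrow> 0 powr (1 / p)"
      using l by (rule tendsto_powr'[OF _ tendsto_const]) (use p in auto)
    then have "(\<lambda>n. norm (\<phi> (r n) x - w x)) \<longlonglongrightarrow> 0" using p by (simp add: powr_powr)
    then show "(\<lambda>n. \<phi> (r n) x) \<longlonglongrightarrow> w x" by (simp only: tendsto_norm_zero_iff LIM_zero_iff)
  qed
  define E where "E n = (\<integral>x. (norm (gradient (\<phi> n) x - g x))\<^sup>2 \<partial>lebesgue)" for n
  have "E \<longlonglongrightarrow> 0" using Lp_norm_tendsto_0_imp[OF _ c2] by (simp add: E_def[abs_def])
  then have E0: "(\<lambda>k. E (r k)) \<longlonglongrightarrow> 0" using LIMSEQ_subseq_LIMSEQ[OF _ r] by (simp add: o_def)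
  have Ei: "integrable lebesgue (\<lambda>x. (norm (gradient (\<phi> n) x - g x))\<^sup>2)" for n
    using integrable_diff_powr[OF _ GL gm gradi' gi] by simp
  have gi': "integrable lebesgue (\<lambda>x. (norm (g x))\<^sup>2)" using gi by simp
  have grad_le: "(\<integral>x. (norm (gradient (\<phi> n) x))\<^sup>2 \<partial>lborel) \<le> (1 + \<theta>) * G + (1 + 1 / \<theta>) * E n" if "\<theta> > 0" for \<theta> n
  proof -
    have "(\<integral>x. (norm (gradient (\<phi> n) x))\<^sup>2 \<partial>lborel) = (\<integral>x. (norm (gradient (\<phi> n) x))\<^sup>2 \<partial>lebesgue)"
      using Gm by (simp add: integral_completion)
    also have "\<dots> \<le> (\<integral>x. (1 + \<theta>) * (norm (g x))\<^sup>2 + (1 + 1 / \<theta>) * (norm (gradient (\<phi> n) x - g x))\<^sup>2 \<partial>lebesgue)"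
      by (intro integral_mono gradi norm_square_le_perturbed that) (use gi' Ei in simp)
    also have "\<dots> = (1 + \<theta>) * G + (1 + 1 / \<theta>) * E n"
      using gi' Ei by (simp add: G_def E_def)
    finally show ?thesis .
  qed
  \<comment> \<open>The truncations are integrable and have smaller energy, as the kernel is nonnegative.\<close>
  define h where "h k x = min (f x) (real k) * indicator (ball 0 (real k)) x" for k x
  have h0: "h k x \<ge> 0" and hf: "h k x \<le> f x" for k x
    using f0[of x] by (auto simp: h_def split: split_indicator)
  have hm[measurable]: "h k \<in> borel_measurable borel" for k
    unfolding h_def[abs_def]
    by (intro borel_measurable_times borel_measurable_min borel_measurable_const borel_measurable_indicator) auto
  have hi: "integrable lborel (h k)" for k
  proof (rule Bochner_Integration.integrable_bound)
    show "integrable lborel (\<lambda>x. real k * indicator (ball (0::'a) (real k)) x)"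
      using emeasure_bounded_finite[OF bounded_ball[of "0::'a" "real k"]] by (intro integrable_mult_right integrable_real_indicator) auto
    show "AE x in lborel. norm (h k x) \<le> norm (real k * indicator (ball (0::'a) (real k)) x)"
      using f0 by (intro AE_I2) (auto simp: h_def split: split_indicator)
  qed measurable
  have hJ: "newton_energy (h k) \<le> ennreal J" for k
    using newton_energy_mono[OF d3 h0 hf] J(1) by (rule order_trans)
  define e where "e k = 1 / real (Suc k)" for k
  have e: "e k > 0" for k by (simp add: e_def)
  have e0: "e \<longlonglongrightarrow> 0" unfolding e_def by (intro LIMSEQ_Suc[OF lim_const_over_n])
  define u where "u k x = h k x * smooth_abs (e k) (\<phi> (r k) x)" for k x
  have um[measurable]: "u k \<in> borel_measurable borel" for k
    unfolding u_def[abs_def] smooth_abs_def by measurable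
  have u0: "u k x \<ge> 0" for k x unfolding u_def by (intro mult_nonneg_nonneg h0 smooth_abs_bounds e)
  have ulim: "AE x in lborel. (\<lambda>k. u k x) \<longlonglongrightarrow> f x * \<bar>w x\<bar>"
    using ae
  proof eventually_elim
    fix x assume l: "(\<lambda>n. \<phi> (r n) x) \<longlonglongrightarrow> w x"
    obtain m where m: "real m > max (f x) (norm x)" using reals_Archimedean2 by blast
    have "h k x = f x" if "k \<ge> m" for k
    proof -
      have "real k > max (f x) (norm x)" using m that by (simp add: less_le_trans)
      then show ?thesis by (simp add: h_def)
    qed
    then have "eventually (\<lambda>k. h k x = f x) sequentially" by (rule eventually_sequentiallyI)
    then have "(\<lambda>k. h k x) \<longlonglongrightarrow> f x" by (rule tendsto_eventually)
    then show "(\<lambda>k. u k x) \<longlonglongrightarrow> f x * \<bar>w x\<bar>"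
      unfolding u_def by (intro tendsto_mult smooth_abs_tendsto e0 l)
  qed
  have ule: "(\<integral>\<^sup>+x. ennreal (u k x) \<partial>lborel) \<le> ennreal ((a\<^sup>2 * ((1 + \<theta>) * G + (1 + 1 / \<theta>) * E (r k)) + J) / (2 * a))" if \<theta>: "\<theta> > 0" for k \<theta>
  proof -
    obtain B where B: "\<And>x. \<bar>\<phi> (r k) x\<bar> \<le> B" using test_function_bounded[OF t] by blast
    have ui: "integrable lborel (u k)"
    proof (rule Bochner_Integration.integrable_bound)
      show "integrable lborel (\<lambda>x. B * h k x)" using hi by simp
      show "AE x in lborel. norm (u k x) \<le> norm (B * h k x)"
      proof (rule AE_I2)
        fix x
        have "smooth_abs (e k) (\<phi> (r k) x) \<le> \<bar>B\<bar>"
          using smooth_abs_bounds(2)[OF e, of k "\<phi> (r k) x"] B[of x] by linarith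
        then have "h k x * smooth_abs (e k) (\<phi> (r k) x) \<le> h k x * \<bar>B\<bar>"
          by (intro mult_left_mono h0)
        then show "norm (u k x) \<le> norm (B * h k x)" using u0[of k x] h0[of k x]
          by (simp add: u_def abs_mult mult.commute)
      qed
    qed measurable
    have "2 * a * (\<integral>x. u k x \<partial>lborel) \<le> a\<^sup>2 * (\<integral>y. (norm (gradient (\<phi> (r k)) y))\<^sup>2 \<partial>lborel) + J"
      unfolding u_def by (rule sobolev_duality_smooth_abs[OF d hi h0 t e hJ J(2)])
    also have "\<dots> \<le> a\<^sup>2 * ((1 + \<theta>) * G + (1 + 1 / \<theta>) * E (r k)) + J"
      by (intro add_right_mono mult_left_mono grad_le \<theta>) simp
    finally have "(\<integral>x. u k x \<partial>lborel) \<le> (a\<^sup>2 * ((1 + \<theta>) * G + (1 + 1 / \<theta>) * E (r k)) + J) / (2 * a)"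
      using a by (simp add: field_simps)
    moreover have "(\<integral>\<^sup>+x. ennreal (u k x) \<partial>lborel) = ennreal (\<integral>x. u k x \<partial>lborel)"
      using ui u0 by (intro nn_integral_eq_integral) auto
    ultimately show ?thesis by (simp add: ennreal_leI)
  qed
  have fatou: "(\<integral>\<^sup>+x. ennreal (f x * \<bar>w x\<bar>) \<partial>lborel) \<le> ennreal ((a\<^sup>2 * ((1 + \<theta>) * G) + J) / (2 * a))" if \<theta>: "\<theta> > 0" for \<theta>
  proof -
    have "(\<integral>\<^sup>+x. ennreal (f x * \<bar>w x\<bar>) \<partial>lborel) \<le> (\<integral>\<^sup>+x. liminf (\<lambda>k. ennreal (u k x)) \<partial>lborel)"
    proof (rule nn_integral_mono_AE)
      show "AE x in lborel. ennreal (f x * \<bar>w x\<bar>) \<le> liminf (\<lambda>k. ennreal (u k x))"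
        using ulim
      proof eventually_elim
        fix x assume "(\<lambda>k. u k x) \<longlonglongrightarrow> f x * \<bar>w x\<bar>"
        then have "(\<lambda>k. ennreal (u k x)) \<longlonglongrightarrow> ennreal (f x * \<bar>w x\<bar>)" by (rule tendsto_ennrealI)
        from lim_imp_Liminf[OF _ this] show "ennreal (f x * \<bar>w x\<bar>) \<le> liminf (\<lambda>k. ennreal (u k x))" by simp
      qed
    qed
    also have "\<dots> \<le> liminf (\<lambda>k. \<integral>\<^sup>+x. ennreal (u k x) \<partial>lborel)"
      by (rule nn_integral_liminf) measurable
    also have "\<dots> \<le> liminf (\<lambda>k. ennreal ((a\<^sup>2 * ((1 + \<theta>) * G + (1 + 1 / \<theta>) * E (r k)) + J) / (2 * a)))"
      by (intro Liminf_mono always_eventually allI ule \<theta>)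
    also have "\<dots> = ennreal ((a\<^sup>2 * ((1 + \<theta>) * G) + J) / (2 * a))"
    proof (rule lim_imp_Liminf)
      have "(\<lambda>k. (a\<^sup>2 * ((1 + \<theta>) * G + (1 + 1 / \<theta>) * E (r k)) + J) / (2 * a)) \<longlonglongrightarrow>
          (a\<^sup>2 * ((1 + \<theta>) * G + (1 + 1 / \<theta>) * 0) + J) / (2 * a)"
        by (intro tendsto_intros E0) (use a in auto)
      then show "(\<lambda>k. ennreal ((a\<^sup>2 * ((1 + \<theta>) * G + (1 + 1 / \<theta>) * E (r k)) + J) / (2 * a))) \<longlonglongrightarrow>
          ennreal ((a\<^sup>2 * ((1 + \<theta>) * G) + J) / (2 * a))"
        by (intro tendsto_ennrealI) simp
    qed simp
    finally show ?thesis .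
  qed
  have "(\<lambda>k. (a\<^sup>2 * ((1 + e k) * G) + J) / (2 * a)) \<longlonglongrightarrow> (a\<^sup>2 * ((1 + 0) * G) + J) / (2 * a)"
    by (intro tendsto_intros e0) (use a in auto)
  then have "(\<lambda>k. ennreal ((a\<^sup>2 * ((1 + e k) * G) + J) / (2 * a))) \<longlonglongrightarrow> ennreal ((a\<^sup>2 * G + J) / (2 * a))"
    by (intro tendsto_ennrealI) simp
  then have "(\<integral>\<^sup>+x. ennreal (f x * \<bar>w x\<bar>) \<partial>lborel) \<le> ennreal ((a\<^sup>2 * G + J) / (2 * a))"
    by (rule LIMSEQ_le_const) (use fatou[OF e] in blast)
  then show ?thesis by (simp add: G_def)
qed

section \<open>Positivity of the Sobolev constant and the stability estimate\<close>

lemma newton_energy_eq_riesz_energy: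
  fixes f :: "'a::euclidean_space \<Rightarrow> real"
  assumes "DIM('a) \<ge> 3" and [measurable]: "f \<in> borel_measurable borel" and f0: "\<And>x. f x \<ge> 0"
  shows "newton_energy f = ennreal (1 / (real DIM('a) - 2) * inverse (sphere_area TYPE('a))) * riesz_energy f"
proof -
  define c where "c = 1 / (real DIM('a) - 2) * inverse (sphere_area TYPE('a))"
  have c: "c \<ge> 0" unfolding c_def using assms(1) sphere_area_pos[where 'a='a] by (intro mult_nonneg_nonneg) simp_all
  have "newton_energy f = (\<integral>\<^sup>+x. \<integral>\<^sup>+y. ennreal c * ennreal (f x * f y * norm (x - y) powr (2 - real DIM('a))) \<partial>lborel \<partial>lborel)"
    unfolding newton_energy_def newton_kernel_def c_def[symmetric]
  proof (intro nn_integral_cong)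
    fix x y :: 'a
    let ?k = "norm (x - y) powr (2 - real DIM('a))"
    have "f x * f y * (c * ?k) = c * (f x * f y * ?k)" by simp
    moreover have "0 \<le> f x * f y * ?k" by (intro mult_nonneg_nonneg f0) simp
    ultimately show "ennreal (f x * f y * (c * ?k)) = ennreal c * ennreal (f x * f y * ?k)"
      using c by (simp only: ennreal_mult)
  qed
  also have "\<dots> = (\<integral>\<^sup>+x. ennreal c * (\<integral>\<^sup>+y. ennreal (f x * f y * norm (x - y) powr (2 - real DIM('a))) \<partial>lborel) \<partial>lborel)"
    by (rule nn_integral_cong, rule nn_integral_cmult) measurable
  also have "\<dots> = ennreal c * riesz_energy f"
    unfolding riesz_energy_def by (rule nn_integral_cmult) measurable
  finally show ?thesis unfolding c_def .
qed

text \<open>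
  Links the iterated Bochner integral to the energy with values in \<open>[0,\<infinity>]\<close>. Where \<open>f\<close> is
  positive, finiteness of the energy makes the inner integral converge for almost every point; where
  \<open>f\<close> vanishes, both sides are zero.
\<close>
lemma integral_mult_inv_neg_laplacian:
  fixes f v :: "'a::euclidean_space \<Rightarrow> real"
  assumes d: "DIM('a) \<ge> 3" and fm[measurable]: "f \<in> borel_measurable borel" and f0: "\<And>x. f x \<ge> 0"
    and vm: "v \<in> borel_measurable lebesgue" and v: "AE x in lborel. v x = f x" and fin: "newton_energy f < \<infinity>"
  shows "(\<integral>x. v x * inv_neg_laplacian v x \<partial>lebesgue) = enn2real (newton_energy f)"
proof -
  have k0: "newton_kernel z \<ge> 0" for z :: 'a by (rule newton_kernel_nonneg[OF d])
  have [measurable]: "newton_kernel \<in> borel_measurable (borel :: 'a measure)"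
    unfolding newton_kernel_def[abs_def] by measurable
  define P where "P x = (\<integral>y. newton_kernel (x - y) * f y \<partial>lborel)" for x
  have [measurable]: "P \<in> borel_measurable borel" unfolding P_def[abs_def] by measurable
  have P0: "P x \<ge> 0" for x unfolding P_def by (intro integral_nonneg_AE AE_I2 mult_nonneg_nonneg k0 f0)
  have vL: "AE x in lebesgue. v x = f x" using v by (rule AE_completion)
  have fL: "f \<in> borel_measurable lebesgue" using fm by (intro measurable_completion) simp
  have inv: "inv_neg_laplacian v x = P x" for x
  proof -
    have "inv_neg_laplacian v x = (\<integral>y. newton_kernel (x - y) * f y \<partial>lebesgue)"
    proof -
      have kL: "(\<lambda>y. newton_kernel (x - y)) \<in> borel_measurable lebesgue"
        by (intro measurable_completion) measurable
      show ?thesis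
        unfolding inv_neg_laplacian_def
        using kL fL vL vm by (intro integral_cong_AE) auto
    qed
    also have "\<dots> = P x" unfolding P_def by (rule integral_completion) measurable
    finally show ?thesis .
  qed
  have "(\<integral>x. v x * inv_neg_laplacian v x \<partial>lebesgue) = (\<integral>x. f x * P x \<partial>lebesgue)"
  proof (rule integral_cong_AE)
    have PL: "P \<in> borel_measurable lebesgue" by (intro measurable_completion) simp
    show "(\<lambda>x. v x * inv_neg_laplacian v x) \<in> borel_measurable lebesgue"
      unfolding inv using PL vm by simp
    show "(\<lambda>x. f x * P x) \<in> borel_measurable lebesgue" using fL PL by simp
    show "AE x in lebesgue. v x * inv_neg_laplacian v x = f x * P x"
      using vL by eventually_elim (simp add: inv)
  qed
  also have "\<dots> = (\<integral>x. f x * P x \<partial>lborel)" by (rule integral_completion) measurable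
  also have "\<dots> = enn2real (\<integral>\<^sup>+x. ennreal (f x * P x) \<partial>lborel)"
    by (rule integral_eq_nn_integral) (use f0 P0 in auto)
  also have "(\<integral>\<^sup>+x. ennreal (f x * P x) \<partial>lborel) = newton_energy f"
    unfolding newton_energy_def
  proof (rule nn_integral_cong_AE)
    have "AE x in lborel. (\<integral>\<^sup>+y. ennreal (f x * f y * newton_kernel (x - y)) \<partial>lborel) \<noteq> \<infinity>"
      using fin unfolding newton_energy_def by (intro nn_integral_PInf_AE) auto
    then show "AE x in lborel. ennreal (f x * P x) = (\<integral>\<^sup>+y. ennreal (f x * f y * newton_kernel (x - y)) \<partial>lborel)"
    proof eventually_elim
      fix x assume ne: "(\<integral>\<^sup>+y. ennreal (f x * f y * newton_kernel (x - y)) \<partial>lborel) \<noteq> \<infinity>"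
      have eq: "(\<integral>\<^sup>+y. ennreal (f x * f y * newton_kernel (x - y)) \<partial>lborel)
         = ennreal (f x) * (\<integral>\<^sup>+y. ennreal (newton_kernel (x - y) * f y) \<partial>lborel)"
      proof -
        have "(\<integral>\<^sup>+y. ennreal (f x * f y * newton_kernel (x - y)) \<partial>lborel) = (\<integral>\<^sup>+y. ennreal (f x) * ennreal (newton_kernel (x - y) * f y) \<partial>lborel)"
          using f0 k0 by (intro nn_integral_cong) (simp add: ennreal_mult[symmetric] mult_ac)
        also have "\<dots> = ennreal (f x) * (\<integral>\<^sup>+y. ennreal (newton_kernel (x - y) * f y) \<partial>lborel)"
          by (rule nn_integral_cmult) measurable
        finally show ?thesis .
      qed
      show "ennreal (f x * P x) = (\<integral>\<^sup>+y. ennreal (f x * f y * newton_kernel (x - y)) \<partial>lborel)"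
      proof (cases "f x = 0")
        case False
        then have fx: "f x > 0" using f0[of x] by simp
        then have ne': "(\<integral>\<^sup>+y. ennreal (newton_kernel (x - y) * f y) \<partial>lborel) \<noteq> \<infinity>"
          using ne unfolding eq by (auto simp: ennreal_mult_eq_top_iff)
        have "integrable lborel (\<lambda>y. newton_kernel (x - y) * f y)"
          using ne' f0 k0 by (intro integrableI_nonneg) (auto simp: top.not_eq_extremum)
        then have "ennreal (P x) = (\<integral>\<^sup>+y. ennreal (newton_kernel (x - y) * f y) \<partial>lborel)"
          unfolding P_def using f0 k0 by (intro nn_integral_eq_integral[symmetric]) auto
        then show ?thesis unfolding eq using f0 P0 by (simp add: ennreal_mult)
      qed (simp add: eq)
    qed
  qed
  finally show ?thesis .
qed

definition critical_mass :: "('a::euclidean_space \<Rightarrow> real) \<Rightarrow> real" where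
  "critical_mass w = (\<integral>x. \<bar>w x\<bar> powr sobolev_exponent TYPE('a) \<partial>lebesgue)"

definition critical_energy :: "('a::euclidean_space \<Rightarrow> real) \<Rightarrow> real" where
  "critical_energy w = (\<integral>x. \<bar>w x\<bar> powr ((real DIM('a) + 2) / (real DIM('a) - 2)) *
     inv_neg_laplacian (\<lambda>y. \<bar>w y\<bar> powr ((real DIM('a) + 2) / (real DIM('a) - 2))) x \<partial>lebesgue)"

lemma critical_mass_nonneg: "critical_mass w \<ge> 0"
  unfolding critical_mass_def by (intro integral_nonneg_AE AE_I2) simp

text \<open>
  Provides a Borel version of \<open>|w|\<^sup>q\<close>, so that Fubini can be applied with the uncompleted
  measure. The exponents are such that both integrals in the conclusion are those of \<open>|w|\<^sup>2\<^sup>*\<close>.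
\<close>
lemma D12_borel_density:
  fixes w :: "'a::euclidean_space \<Rightarrow> real"
  assumes d: "DIM('a) \<ge> 5" and w: "has_D12_gradient w g"
  obtains f :: "'a \<Rightarrow> real" where "f \<in> borel_measurable borel" "\<And>x. f x \<ge> 0"
    "AE x in lborel. \<bar>w x\<bar> powr ((real DIM('a) + 2) / (real DIM('a) - 2)) = f x"
    "(\<integral>\<^sup>+x. ennreal (f x powr (2 * real DIM('a) / (real DIM('a) + 2))) \<partial>lborel) = ennreal (critical_mass w)"
    "(\<integral>\<^sup>+x. ennreal (f x * \<bar>w x\<bar>) \<partial>lborel) = ennreal (critical_mass w)"
proof -
  define n where "n = real DIM('a)"
  have n5: "n \<ge> 5" using d n_def by simp
  define q where "q = (n + 2) / (n - 2)"
  define p where "p = sobolev_exponent TYPE('a)"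
  have q: "q > 0" "q + 1 = p" "q * (2 * n / (n + 2)) = p"
    using n5 by (simp_all add: q_def p_def sobolev_exponent_def n_def[symmetric] divide_simps)
  have wm: "w \<in> borel_measurable lebesgue" and wi: "integrable lebesgue (\<lambda>x. \<bar>w x\<bar> powr p)"
    using w by (auto simp: has_D12_gradient_def Lp_space_def p_def)
  obtain w0 where w0[measurable]: "w0 \<in> borel_measurable lborel" and ae: "AE x in lborel. w x = w0 x"
    using completion_ex_borel_measurable_real[OF wm] by blast
  define f where "f x = \<bar>w0 x\<bar> powr q" for x
  have Nn: "(\<integral>\<^sup>+x. ennreal (\<bar>w x\<bar> powr p) \<partial>lborel) = ennreal (critical_mass w)"
    unfolding critical_mass_def p_def[symmetric] nn_integral_completion[of lborel, symmetric]
    using wi by (intro nn_integral_eq_integral) auto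
  show thesis
  proof (rule that)
    show "f \<in> borel_measurable borel" using w0 unfolding f_def[abs_def] by measurable
    show "f x \<ge> 0" for x by (simp add: f_def)
    show "AE x in lborel. \<bar>w x\<bar> powr ((real DIM('a) + 2) / (real DIM('a) - 2)) = f x"
      using ae by eventually_elim (simp add: f_def q_def n_def)
    show "(\<integral>\<^sup>+x. ennreal (f x powr (2 * real DIM('a) / (real DIM('a) + 2))) \<partial>lborel) = ennreal (critical_mass w)"
      unfolding Nn[symmetric] n_def[symmetric]
    proof (rule nn_integral_cong_AE)
      show "AE x in lborel. ennreal (f x powr (2 * n / (n + 2))) = ennreal (\<bar>w x\<bar> powr p)"
        using ae by eventually_elim (simp only: f_def powr_powr q)
    qed
    show "(\<integral>\<^sup>+x. ennreal (f x * \<bar>w x\<bar>) \<partial>lborel) = ennreal (critical_mass w)"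
      unfolding Nn[symmetric]
    proof (rule nn_integral_cong_AE)
      show "AE x in lborel. ennreal (f x * \<bar>w x\<bar>) = ennreal (\<bar>w x\<bar> powr p)"
        using ae by eventually_elim (simp add: f_def q(2)[symmetric] powr_add)
    qed
  qed
qed

lemma critical_energy_nonneg:
  fixes w :: "'a::euclidean_space \<Rightarrow> real"
  assumes "DIM('a) \<ge> 3"
  shows "critical_energy w \<ge> 0"
  unfolding critical_energy_def inv_neg_laplacian_def
  by (intro integral_nonneg_AE AE_I2 mult_nonneg_nonneg powr_ge_zero newton_kernel_nonneg[OF assms])

lemma hardy_littlewood_sobolev_newton_energy:
  assumes d: "DIM('a::euclidean_space) \<ge> 3"
  obtains C where "C > 0"
    "\<And>(f :: 'a \<Rightarrow> real) N. f \<in> borel_measurable borel \<Longrightarrow> (\<And>x. f x \<ge> 0) \<Longrightarrow>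
      N \<ge> 0 \<Longrightarrow> (\<integral>\<^sup>+x. ennreal (f x powr (2 * real DIM('a) / (real DIM('a) + 2))) \<partial>lborel) = ennreal N \<Longrightarrow>
      newton_energy f \<le> ennreal (C * N powr ((real DIM('a) + 2) / real DIM('a)))"
proof (rule hardy_littlewood_sobolev_energy[OF d])
  fix C :: real
  assume C: "C > 0"
    and hls: "\<And>(f :: 'a \<Rightarrow> real) N. f \<in> borel_measurable borel \<Longrightarrow> (\<And>x. f x \<ge> 0) \<Longrightarrow>
      N \<ge> 0 \<Longrightarrow> (\<integral>\<^sup>+x. ennreal (f x powr (2 * real DIM('a) / (real DIM('a) + 2))) \<partial>lborel) = ennreal N \<Longrightarrow>
      riesz_energy f \<le> ennreal (C * N powr ((real DIM('a) + 2) / real DIM('a)))"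
  define c where "c = 1 / (real DIM('a) - 2) * inverse (sphere_area TYPE('a))"
  have c: "c > 0" unfolding c_def using d sphere_area_pos[where 'a='a] by (intro mult_pos_pos) simp_all
  show thesis
  proof (rule that)
    show "c * C > 0" using c C by simp
    fix f :: "'a \<Rightarrow> real" and N :: real
    assume fm: "f \<in> borel_measurable borel" and f0: "\<And>x. f x \<ge> 0" and N0: "N \<ge> 0"
      and fN: "(\<integral>\<^sup>+x. ennreal (f x powr (2 * real DIM('a) / (real DIM('a) + 2))) \<partial>lborel) = ennreal N"
    have "newton_energy f \<le> ennreal c * ennreal (C * N powr ((real DIM('a) + 2) / real DIM('a)))"
      unfolding newton_energy_eq_riesz_energy[OF d fm f0] c_def[symmetric]
      by (intro mult_left_mono hls fm f0 fN N0) simp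
    also have "\<dots> = ennreal (c * C * N powr ((real DIM('a) + 2) / real DIM('a)))"
      unfolding mult.assoc using c C by (intro ennreal_mult[symmetric]) simp_all
    finally show "newton_energy f \<le> ennreal (c * C * N powr ((real DIM('a) + 2) / real DIM('a)))" .
  qed
qed

lemma newton_energy_eq_critical_energy:
  fixes f w :: "'a::euclidean_space \<Rightarrow> real"
  assumes d: "DIM('a) \<ge> 3" and wm: "w \<in> borel_measurable lebesgue"
    and fm: "f \<in> borel_measurable borel" and f0: "\<And>x. f x \<ge> 0"
    and ae: "AE x in lborel. \<bar>w x\<bar> powr ((real DIM('a) + 2) / (real DIM('a) - 2)) = f x"
    and N: "(\<integral>\<^sup>+x. ennreal (f x powr (2 * real DIM('a) / (real DIM('a) + 2))) \<partial>lborel) = ennreal (critical_mass w)"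
  shows "newton_energy f = ennreal (critical_energy w)"
proof -
  have fin: "newton_energy f < \<infinity>"
  proof (rule hardy_littlewood_sobolev_newton_energy[OF d])
    fix C :: real
    assume "\<And>(f :: 'a \<Rightarrow> real) N. f \<in> borel_measurable borel \<Longrightarrow> (\<And>x. f x \<ge> 0) \<Longrightarrow>
      N \<ge> 0 \<Longrightarrow> (\<integral>\<^sup>+x. ennreal (f x powr (2 * real DIM('a) / (real DIM('a) + 2))) \<partial>lborel) = ennreal N \<Longrightarrow>
      newton_energy f \<le> ennreal (C * N powr ((real DIM('a) + 2) / real DIM('a)))"
    from this[OF fm f0 critical_mass_nonneg N] show ?thesis by (rule le_less_trans) simp
  qed
  have "critical_energy w = enn2real (newton_energy f)"
    unfolding critical_energy_def
    by (rule integral_mult_inv_neg_laplacian[OF d fm f0 _ ae fin]) (use wm in measurable)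
  then show ?thesis using fin by (simp add: less_top)
qed

text \<open>
  The duality inequality with density \<open>|w|\<^sup>q\<close>, for which the pairing with \<open>|w|\<close> is the critical mass.
\<close>
lemma sobolev_duality_critical:
  fixes w :: "'a::euclidean_space \<Rightarrow> real"
  assumes d: "DIM('a) \<ge> 5" and w: "has_D12_gradient w g" and a: "a > 0"
  shows "2 * a * critical_mass w \<le> a\<^sup>2 * (\<integral>x. (norm (g x))\<^sup>2 \<partial>lebesgue) + critical_energy w"
proof -
  have d3: "DIM('a) \<ge> 3" using d by simp
  let ?N = "critical_mass w" and ?G = "\<integral>x. (norm (g x))\<^sup>2 \<partial>lebesgue" and ?I = "critical_energy w"
  have wm: "w \<in> borel_measurable lebesgue" using w by (simp add: has_D12_gradient_def Lp_space_def)
  have I0: "?I \<ge> 0" by (rule critical_energy_nonneg[OF d3])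
  have "ennreal ?N \<le> ennreal ((a\<^sup>2 * ?G + ?I) / (2 * a))"
  proof (rule D12_borel_density[OF d w])
    fix f :: "'a \<Rightarrow> real"
    assume fm: "f \<in> borel_measurable borel" and f0: "\<And>x. f x \<ge> 0"
      and ae: "AE x in lborel. \<bar>w x\<bar> powr ((real DIM('a) + 2) / (real DIM('a) - 2)) = f x"
      and fN: "(\<integral>\<^sup>+x. ennreal (f x powr (2 * real DIM('a) / (real DIM('a) + 2))) \<partial>lborel) = ennreal ?N"
      and fw: "(\<integral>\<^sup>+x. ennreal (f x * \<bar>w x\<bar>) \<partial>lborel) = ennreal ?N"
    show ?thesis
      unfolding fw[symmetric]
      by (rule sobolev_duality_D12[OF d w fm f0 _ I0 a])
        (simp only: newton_energy_eq_critical_energy[OF d3 wm fm f0 ae fN])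
  qed
  moreover have "?G \<ge> 0" by (intro integral_nonneg_AE AE_I2) simp
  then have "0 \<le> (a\<^sup>2 * ?G + ?I) / (2 * a)"
    using a I0 by (intro divide_nonneg_pos add_nonneg_nonneg mult_nonneg_nonneg) simp_all
  ultimately have "?N \<le> (a\<^sup>2 * ?G + ?I) / (2 * a)" by (simp only: ennreal_le_iff)
  then have "?N * (2 * a) \<le> a\<^sup>2 * ?G + ?I" using a by (simp only: pos_le_divide_eq mult_pos_pos zero_less_numeral)
  then show ?thesis by (simp only: mult.commute)
qed

lemma D12_gradient_works: "w \<in> D12 \<Longrightarrow> has_D12_gradient w (D12_gradient w)"
  using someI_ex[of "has_D12_gradient w"] by (simp add: D12_def D12_gradient_def)

lemma Lp_norm_2_square: "(Lp_norm 2 g)\<^sup>2 = (\<integral>x. (norm (g x))\<^sup>2 \<partial>lebesgue)"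
proof -
  have "0 \<le> (\<integral>x. (norm (g x))\<^sup>2 \<partial>lebesgue)" by (intro integral_nonneg_AE AE_I2) simp
  then show ?thesis by (simp add: Lp_norm_def powr_half_sqrt)
qed

lemma test_function_in_D12:
  fixes \<phi> :: "'a::euclidean_space \<Rightarrow> real"
  assumes "test_function \<phi>" "DIM('a) \<ge> 3"
  shows "\<phi> \<in> D12"
proof -
  have p: "sobolev_exponent TYPE('a) > 0" using assms(2) by (simp add: sobolev_exponent_def)
  have m: "\<phi> \<in> borel_measurable lborel" "gradient \<phi> \<in> borel_measurable lborel"
    using borel_measurable_continuous_onI[OF test_function_continuous[OF assms(1)]]
      borel_measurable_continuous_onI[OF test_function_continuous_gradient[OF assms(1)]] by simp_all
  have "has_D12_gradient \<phi> (gradient \<phi>)"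
    unfolding has_D12_gradient_def Lp_space_def
  proof (intro conjI CollectI exI[of _ "\<lambda>_. \<phi>"] allI assms(1))
    show "\<phi> \<in> borel_measurable lebesgue" "gradient \<phi> \<in> borel_measurable lebesgue"
      using m by (auto intro: measurable_completion)
    show "integrable lebesgue (\<lambda>x. norm (\<phi> x) powr sobolev_exponent TYPE('a))"
      using test_function_powr_integrable[OF assms(1) p] m by (simp add: integrable_completion)
    show "integrable lebesgue (\<lambda>x. norm (gradient \<phi> x) powr 2)"
      using test_function_gradient_square_integrable[OF assms(1)] m by (simp add: integrable_completion)
  qed (simp_all add: Lp_norm_def)
  then show ?thesis by (auto simp: D12_def)
qed

lemma bump_Lp_norm_pos:
  assumes "p > 0"
  shows "Lp_norm p (bump :: 'a::euclidean_space \<Rightarrow> real) > 0"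
proof -
  have i: "integrable lborel (\<lambda>x. \<bar>bump (x::'a)\<bar> powr p)"
    by (rule test_function_powr_integrable[OF test_function_bump assms])
  have "(\<integral>x. \<bar>bump (x::'a)\<bar> powr p \<partial>lborel) \<noteq> 0"
  proof
    assume "(\<integral>x. \<bar>bump (x::'a)\<bar> powr p \<partial>lborel) = 0"
    then have "AE x in (lborel :: 'a measure). \<bar>bump x\<bar> powr p = 0"
      using integral_nonneg_eq_0_iff_AE[OF i] by simp
    then have "AE x in (lborel :: 'a measure). x \<notin> ball 0 1"
    proof eventually_elim
      fix x :: 'a assume "\<bar>bump x\<bar> powr p = 0"
      then have "\<not> bump x > 0" by simp
      then show "x \<notin> ball 0 1" by (simp add: bump_pos_iff)
    qed
    then have "emeasure lborel (ball (0::'a) 1) = 0"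
      by (subst (asm) AE_iff_measurable[where N = "ball 0 1"]) auto
    then have "measure lborel (ball (0::'a) 1) = 0" by (simp only: measure_def enn2real_0)
    then show False using content_ball_gt_0_iff[of "0::'a" 1] by simp
  qed
  moreover have "(\<integral>x. \<bar>bump (x::'a)\<bar> powr p \<partial>lborel) \<ge> 0" by (intro integral_nonneg_AE AE_I2) simp
  moreover have "(\<integral>x. norm (bump (x::'a)) powr p \<partial>lebesgue) = (\<integral>x. \<bar>bump (x::'a)\<bar> powr p \<partial>lborel)"
    using i by (simp add: integral_completion)
  ultimately show ?thesis unfolding Lp_norm_def by simp
qed

lemma Lp_norm_powr:
  assumes "p > 0"
  shows "Lp_norm p u powr a = (\<integral>x. norm (u x) powr p \<partial>lebesgue) powr (a / p)"
  by (simp add: Lp_norm_def powr_powr)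

lemma Lp_norm_square:
  "(Lp_norm p u)\<^sup>2 = (\<integral>x. norm (u x) powr p \<partial>lebesgue) powr (2 / p)"
  by (simp add: Lp_norm_def power2_eq_square powr_add[symmetric])

text \<open>
  Duality and the Hardy-Littlewood-Sobolev inequality bound the critical mass \<open>N\<close> by
  \<open>2 a N \<le> a\<^sup>2 G + C N\<^bsup>(d+2)/d\<^esup>\<close>. With \<open>a = C N\<^bsup>2/d\<^esup>\<close> the last term is half of the
  left-hand side and can be absorbed.
\<close>
theorem sobolev_inequality_D12:
  assumes d: "DIM('a::euclidean_space) \<ge> 5"
  obtains C where "C > 0"
    "\<And>u :: 'a \<Rightarrow> real. u \<in> D12 \<Longrightarrow>
       (Lp_norm (sobolev_exponent TYPE('a)) u)\<^sup>2 \<le> C * (Lp_norm 2 (D12_gradient u))\<^sup>2"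
proof -
  define n where "n = real DIM('a)"
  have n: "n \<ge> 5" using d by (simp add: n_def)
  have d3: "DIM('a) \<ge> 3" using d by simp
  let ?p = "sobolev_exponent TYPE('a)"
  have p2: "2 / ?p = (n - 2) / n" using n by (simp add: sobolev_exponent_def n_def[symmetric] field_simps)
  show thesis
  proof (rule hardy_littlewood_sobolev_newton_energy[OF d3], rule that)
    fix C :: real
    assume C: "C > 0"
      and bound: "\<And>(f :: 'a \<Rightarrow> real) N. f \<in> borel_measurable borel \<Longrightarrow> (\<And>x. f x \<ge> 0) \<Longrightarrow>
        N \<ge> 0 \<Longrightarrow> (\<integral>\<^sup>+x. ennreal (f x powr (2 * real DIM('a) / (real DIM('a) + 2))) \<partial>lborel) = ennreal N \<Longrightarrow>
        newton_energy f \<le> ennreal (C * N powr ((real DIM('a) + 2) / real DIM('a)))"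
    show "C > 0" by fact
    fix u :: "'a \<Rightarrow> real" assume u: "u \<in> D12"
    define N where "N = critical_mass u"
    define G where "G = (\<integral>x. (norm (D12_gradient u x))\<^sup>2 \<partial>lebesgue)"
    have G0: "G \<ge> 0" unfolding G_def by (intro integral_nonneg_AE AE_I2) simp
    have N0: "N \<ge> 0" unfolding N_def by (rule critical_mass_nonneg)
    define I where "I = critical_energy u"
    have uD: "has_D12_gradient u (D12_gradient u)" by (rule D12_gradient_works[OF u])
    have um: "u \<in> borel_measurable lebesgue" using uD by (simp add: has_D12_gradient_def Lp_space_def)
    have "I \<le> C * N powr ((n + 2) / n)"
    proof (rule D12_borel_density[OF d uD])
      fix f :: "'a \<Rightarrow> real"
      assume f: "f \<in> borel_measurable borel" "\<And>x. f x \<ge> 0"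
        "AE x in lborel. \<bar>u x\<bar> powr ((real DIM('a) + 2) / (real DIM('a) - 2)) = f x"
        "(\<integral>\<^sup>+x. ennreal (f x powr (2 * real DIM('a) / (real DIM('a) + 2))) \<partial>lborel) = ennreal (critical_mass u)"
      have "ennreal I \<le> ennreal (C * N powr ((n + 2) / n))"
        using bound[OF f(1,2) critical_mass_nonneg f(4)]
        unfolding newton_energy_eq_critical_energy[OF d3 um f] I_def N_def n_def .
      moreover have "0 \<le> C * N powr ((n + 2) / n)" using C by simp
      ultimately show ?thesis by (simp only: ennreal_le_iff)
    qed
    note I = this sobolev_duality_critical[OF d uD, folded I_def N_def G_def]
    have "N powr ((n - 2) / n) \<le> C * G"
    proof (cases "N = 0")
      case False
      then have Npos: "N > 0" using N0 by simp
      define t where "t = N powr (2 / n)"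
      have t: "t > 0" using Npos by (simp add: t_def)
      have e1: "N powr ((n + 2) / n) = t * N"
        using n Npos by (simp add: t_def add_divide_distrib powr_add)
      have e2: "N powr ((n - 2) / n) * t = N"
        unfolding t_def powr_add[symmetric] using n Npos by (simp add: add_divide_distrib[symmetric])
      have "2 * (C * t) * N \<le> (C * t)\<^sup>2 * G + C * (t * N)"
        by (rule order_trans[OF I(2) add_left_mono]) (use I(1) e1 C t in simp_all)
      then have "(C * t) * N \<le> (C * t) * ((C * t) * G)" by (simp add: power2_eq_square algebra_simps)
      then have "N \<le> (C * t) * G" using C t by (simp only: mult_le_cancel_left_pos mult_pos_pos)
      then have "N powr ((n - 2) / n) * t \<le> (C * G) * t" unfolding e2 by (simp add: mult_ac)
      then show ?thesis using t by (simp only: mult_le_cancel_right_pos)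
    qed (use C G0 in simp)
    then show "(Lp_norm ?p u)\<^sup>2 \<le> C * (Lp_norm 2 (D12_gradient u))\<^sup>2"
      unfolding Lp_norm_square[of ?p] Lp_norm_2_square p2 by (simp add: N_def G_def critical_mass_def)
  qed
qed

text \<open>
  The set of admissible constants is nonempty, and each of its elements is at least the quotient of the
  two norms of the bump function.
\<close>
lemma sobolev_constant_pos:
  assumes d: "DIM('a::euclidean_space) \<ge> 5"
  shows "sobolev_constant TYPE('a) > 0"
proof -
  let ?p = "sobolev_exponent TYPE('a)"
  have p: "?p > 0" using d by (simp add: sobolev_exponent_def)
  define A where "A = {S. \<forall>u\<in>(D12 :: ('a \<Rightarrow> real) set). (Lp_norm ?p u)\<^sup>2 \<le> S * (Lp_norm 2 (D12_gradient u))\<^sup>2}"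
  obtain C where CA: "C \<in> A"
  proof (rule sobolev_inequality_D12[OF d])
    fix C
    assume "\<And>u :: 'a \<Rightarrow> real. u \<in> D12 \<Longrightarrow> (Lp_norm ?p u)\<^sup>2 \<le> C * (Lp_norm 2 (D12_gradient u))\<^sup>2"
    then have "C \<in> A" unfolding A_def by (intro CollectI ballI)
    then show thesis by (rule that)
  qed
  define m where "m = (Lp_norm ?p (bump :: 'a \<Rightarrow> real))\<^sup>2"
  define M where "M = (Lp_norm 2 (D12_gradient (bump :: 'a \<Rightarrow> real)))\<^sup>2"
  have m: "m > 0" using bump_Lp_norm_pos[OF p, where 'a='a] by (simp add: m_def)
  have b: "(bump :: 'a \<Rightarrow> real) \<in> D12" using d by (intro test_function_in_D12 test_function_bump) simp
  have mM: "m \<le> S * M" if "S \<in> A" for S using that b by (auto simp: A_def m_def M_def)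
  have "M \<ge> 0" by (simp add: M_def)
  moreover have "M \<noteq> 0" using mM[OF CA] m by auto
  ultimately have M: "M > 0" by simp
  have "m / M \<le> Inf A"
    by (rule cInf_greatest) (use CA mM M in \<open>auto simp: pos_divide_le_eq\<close>)
  then have "Inf A > 0" using m M by (meson divide_pos_pos less_le_trans)
  then show ?thesis by (simp add: sobolev_constant_def A_def)
qed

theorem theorem1p2:
  fixes d :: nat and q twostar S :: real
  assumes "d = DIM('a::euclidean_space)" and "d \<ge> 5"
    and "q = (real d + 2) / (real d - 2)"
    and "twostar = 2 * real d / (real d - 2)"
    and "S = sobolev_constant TYPE('a)"
  shows "\<exists>C::real. C > 0 \<and> C \<le> (1 + 2 / real d) * (1 - exp (- (real d / 2))) * S \<and>
    (\<forall>w\<in>(D12 :: ('a \<Rightarrow> real) set).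
       S * (Lp_norm (2 * real d / (real d + 2)) (\<lambda>x. \<bar>w x\<bar> powr q))\<^sup>2
         - (\<integral>x. \<bar>w x\<bar> powr q * inv_neg_laplacian (\<lambda>y. \<bar>w y\<bar> powr q) x \<partial>lebesgue)
       \<le> C * Lp_norm twostar w powr (8 / (real d - 2)) *
           (S * (Lp_norm 2 (D12_gradient w))\<^sup>2 - (Lp_norm twostar w)\<^sup>2))"
proof -
  define n where "n = real d"
  have n: "n \<ge> 5" "n = real DIM('a)" using assms by (simp_all add: n_def)
  have d: "DIM('a) \<ge> 5" using assms by simp
  have S: "S > 0" using sobolev_constant_pos[OF d] assms(5) by simp
  have ts: "twostar = 2 * n / (n - 2)" "twostar > 0" using assms(4) n by (simp_all add: n_def)
  have qd: "q = (n + 2) / (n - 2)" using assms(3) by (simp add: n_def)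
  have "1 * S \<le> (1 + 2 / n) * (1 - exp (- (n / 2))) * S"
  proof (rule mult_right_mono)
    have "1 + n / 2 \<le> exp (n / 2)" by (rule exp_ge_add_one_self)
    then have "exp (- (n / 2)) \<le> 1 / (1 + n / 2)"
      using n unfolding exp_minus by (simp only: inverse_eq_divide) (intro divide_left_mono, auto)
    then have "(1 + 2 / n) * (1 - 1 / (1 + n / 2)) \<le> (1 + 2 / n) * (1 - exp (- (n / 2)))"
      using n by (intro mult_left_mono) auto
    moreover have "1 + 2 / n = (n + 2) / n" "1 - 1 / (1 + n / 2) = n / (n + 2)" using n(1) by (simp_all add: field_simps)
    ultimately show "1 \<le> (1 + 2 / n) * (1 - exp (- (n / 2)))" using n(1) by simp
  qed (use S in simp)
  moreover have "S * (Lp_norm (2 * n / (n + 2)) (\<lambda>x. \<bar>w x\<bar> powr q))\<^sup>2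
         - (\<integral>x. \<bar>w x\<bar> powr q * inv_neg_laplacian (\<lambda>y. \<bar>w y\<bar> powr q) x \<partial>lebesgue)
       \<le> S * Lp_norm twostar w powr (8 / (n - 2)) *
           (S * (Lp_norm 2 (D12_gradient w))\<^sup>2 - (Lp_norm twostar w)\<^sup>2)" if w: "w \<in> D12" for w :: "'a \<Rightarrow> real"
  proof -
    define N where "N = critical_mass w"
    define G where "G = (\<integral>x. (norm (D12_gradient w x))\<^sup>2 \<partial>lebesgue)"
    define I where "I = critical_energy w"
    have Nts: "N = (\<integral>x. \<bar>w x\<bar> powr twostar \<partial>lebesgue)"
      unfolding N_def critical_mass_def sobolev_exponent_def ts n(2) ..
    have Iq: "I = (\<integral>x. \<bar>w x\<bar> powr q * inv_neg_laplacian (\<lambda>y. \<bar>w y\<bar> powr q) x \<partial>lebesgue)"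
      unfolding I_def critical_energy_def qd n(2) ..
    have N0: "N \<ge> 0" unfolding N_def by (rule critical_mass_nonneg)
    have I: "0 \<le> I" unfolding I_def using d by (intro critical_energy_nonneg) simp
    note dual = sobolev_duality_critical[OF d D12_gradient_works[OF w], folded I_def N_def G_def]
    have l1: "(Lp_norm (2 * n / (n + 2)) (\<lambda>x. \<bar>w x\<bar> powr q))\<^sup>2 = N powr ((n + 2) / n)"
    proof -
      have "q * (2 * n / (n + 2)) = twostar" "2 / (2 * n / (n + 2)) = (n + 2) / n"
        using n(1) by (simp_all add: qd ts divide_simps)
      then show ?thesis unfolding Lp_norm_square Nts by (simp only: real_norm_def abs_of_nonneg powr_ge_zero powr_powr)
    qed
    have l2: "(Lp_norm twostar w)\<^sup>2 = N powr ((n - 2) / n)"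
    proof -
      have "2 / twostar = (n - 2) / n" using n(1) by (simp add: ts field_simps)
      then show ?thesis unfolding Lp_norm_square Nts by (simp only: real_norm_def)
    qed
    have l3: "Lp_norm twostar w powr (8 / (n - 2)) = N powr (4 / n)"
    proof -
      have "8 / (n - 2) / twostar = 4 / n" using n(1) by (simp add: ts divide_simps)
      then show ?thesis unfolding Lp_norm_powr[OF ts(2)] Nts by (simp only: real_norm_def)
    qed
    have "S * N powr ((n + 2) / n) - I \<le> S * N powr (4 / n) * (S * G - N powr ((n - 2) / n))"
    proof (cases "N = 0")
      case False
      then have Npos: "N > 0" using N0 by simp
      define t where "t = N powr (2 / n)"
      have t: "t > 0" using Npos by (simp add: t_def)
      have e1: "N powr ((n + 2) / n) = t * N"
        using n(1) Npos by (simp add: t_def add_divide_distrib powr_add)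
      have e2: "N powr ((n - 2) / n) * t = N"
        unfolding t_def powr_add[symmetric] using n(1) Npos by (simp add: add_divide_distrib[symmetric])
      have e3: "N powr (4 / n) = t * t"
        unfolding t_def powr_add[symmetric] by simp
      \<comment> \<open>The value \<open>a = S t\<close> makes the mixed term twice the first term of the claim.\<close>
      have "2 * (S * t) * N \<le> (S * t)\<^sup>2 * G + I" using dual[of "S * t"] S t by simp
      moreover have "S * N powr (4 / n) * (S * G - N powr ((n - 2) / n)) = (S * t)\<^sup>2 * G - S * t * (N powr ((n - 2) / n) * t)"
        unfolding e3 by (simp add: power2_eq_square algebra_simps)
      ultimately show ?thesis unfolding e1 e2 by (simp add: algebra_simps)
    qed (use I in simp)
    then show ?thesis unfolding l1 l2 l3 Lp_norm_2_square Iq G_def .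
  qed
  ultimately show ?thesis
    using S unfolding n_def by (intro exI[of _ S]) simp
qed

end
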